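(* If $\mathrm{P}=\mathrm{UP}\cap\mathrm{coUP}$, then every nongappy semistrong-P-rankable set is strong-P-rankable.
   Context: $\Sigma=\{0,1\}$; strings are ordered in length-lexicographic order, and natural numbers are identified with strings in the standard way. For $A\subseteq\Sigma^*$, $\mathrm{rank}_A(y)=\|\{z\mid z\le y \wedge z\in A\}\|$. A set $A$ is strong-P-rankable if there is a total polynomial-time computable $f$ with $f(x)=\mathrm{rank}_A(x)$ for all $x$. A set $A$ is semistrong-P-rankable if there is a total polynomial-time computable $f$ such that $f(x)=\mathrm{rank}_A(x)$ for $x\in A$ and $f(x)$ outputs a special indication ``not in set'' for $x\notin A$. A set $A$ is nongappy if there is a polynomial $p$ such that for each $n\in\mathbb N$ there is $y\in A$ with $n\le |y|\le p(n)$. UP is the class of languages accepted by nondeterministic polynomial-time machines with at most one accepting path on every input; coUP is the class of complements of UP languages. *)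

theory Defs
  imports Main "HOL-Computational_Algebra.Polynomial"
begin

section \<open>Strings, length-lexicographic order, numbers as strings\<close>

type_synonym bits = "bool list"

abbreviation llex :: "(bits \<times> bits) set" where
  "llex \<equiv> lenlex {(False, True)}"

definition rank :: "bits set \<Rightarrow> bits \<Rightarrow> nat" where
  "rank A y = card {z. (z = y \<or> (z, y) \<in> llex) \<and> z \<in> A}"

text \<open>The number \<open>n\<close> is identified with the \<open>n\<close>-th string in length-lexicographic order,
  counting from \<open>0\<close>; the recursion is bijective base-2 notation, and
  \<open>card_llex_nat_bits\<close> below confirms that it gives this identification.\<close>

fun nat_bits :: "nat \<Rightarrow> bits" where
  "nat_bits 0 = []"
| "nat_bits (Suc n) = nat_bits (n div 2) @ [odd n]"

fun bits_nat_rev :: "bits \<Rightarrow> nat" where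
  "bits_nat_rev [] = 0"
| "bits_nat_rev (b # w) = 2 * bits_nat_rev w + (if b then 2 else 1)"

lemma bits_nat_rev_inverse: "nat_bits (bits_nat_rev (rev w)) = w"
proof (induction w rule: rev_induct)
  case (snoc b w)
  have "bits_nat_rev (rev (w @ [b])) = Suc (2 * bits_nat_rev (rev w) + (if b then 1 else 0))"
    by simp
  then show ?case
    using snoc by (simp only: nat_bits.simps) auto
qed simp

lemma nat_bits_inverse: "bits_nat_rev (rev (nat_bits n)) = n"
proof (induction n rule: nat_bits.induct)
  case (2 n)
  have "2 * (n div 2) + (if odd n then 2 else 1) = Suc n"
    by (cases "odd n") (auto elim!: oddE evenE)
  with 2 show ?case by simp
qed simp

lemma llex_snoc: "(u @ [a], v @ [b]) \<in> llex \<longleftrightarrow> (u, v) \<in> llex \<or> u = v \<and> \<not> a \<and> b"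
proof (cases "length u = length v")
  case True
  then show ?thesis
    by (induction u v rule: list_induct2) (auto simp: lenlex_conv Cons_in_lex)
qed (auto simp: lenlex_conv)

lemma llex_iff: "(u, v) \<in> llex \<longleftrightarrow> bits_nat_rev (rev u) < bits_nat_rev (rev v)"
proof (induction u arbitrary: v rule: rev_induct)
  case Nil
  then show ?case by (cases v rule: rev_cases) auto
next
  case (snoc a u)
  show ?case
  proof (cases v rule: rev_cases)
    case (snoc v' b)
    have "u = v' \<longleftrightarrow> bits_nat_rev (rev u) = bits_nat_rev (rev v')"
      by (metis bits_nat_rev_inverse)
    then show ?thesis
      using snoc.IH[of v'] by (auto simp: snoc llex_snoc)
  qed simp
qed

lemma card_llex_nat_bits: "card {z. (z, nat_bits n) \<in> llex} = n"
proof -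
  have "bij_betw nat_bits {..<n} {z. (z, nat_bits n) \<in> llex}"
    by (rule bij_betw_byWitness[where f' = "\<lambda>w. bits_nat_rev (rev w)"])
      (auto simp: llex_iff nat_bits_inverse bits_nat_rev_inverse)
  then show ?thesis
    by (simp add: bij_betw_same_card[symmetric])
qed

section \<open>Nondeterministic multitape Turing machines\<close>

text \<open>Only finitely many symbols and states occur in a machine, since its instruction set is
  required to be finite; \<open>Mark i\<close> are the auxiliary symbols.\<close>

datatype symbol = Blank | Bit bool | Mark nat

datatype move = MoveLeft | Stay | MoveRight

fun offset :: "move \<Rightarrow> int" where
  "offset MoveLeft = -1" | "offset Stay = 0" | "offset MoveRight = 1"

text \<open>An instruction \<open>(q, rs, q', as)\<close> applies in state \<open>q\<close> when the scanned symbols are \<open>rs\<close> (one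
  per tape); the machine enters \<open>q'\<close> and on each tape writes a symbol and moves the head.\<close>

type_synonym instruction = "nat \<times> symbol list \<times> nat \<times> (symbol \<times> move) list"

record machine =
  n_tapes :: nat
  instrs :: "instruction set"
  start :: nat
  accepting :: "nat set"

definition machine_wf :: "machine \<Rightarrow> bool" where
  "machine_wf M \<longleftrightarrow> n_tapes M \<ge> 1 \<and> finite (instrs M) \<and>
     (\<forall>(q, rs, q', as) \<in> instrs M. length rs = n_tapes M \<and> length as = n_tapes M)"

definition deterministic :: "machine \<Rightarrow> bool" where
  "deterministic M \<longleftrightarrow>
     (\<forall>q rs q1 as1 q2 as2. (q, rs, q1, as1) \<in> instrs M \<longrightarrow> (q, rs, q2, as2) \<in> instrs M \<longrightarrow>
        q1 = q2 \<and> as1 = as2)"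

text \<open>Tapes are two-way infinite; a tape is its contents together with the head position. As
  positions are absolute, different instructions lead to different configurations, so that paths
  may be counted as sequences of configurations.\<close>

type_synonym tape = "(int \<Rightarrow> symbol) \<times> int"
type_synonym config = "nat \<times> tape list"

fun scanned :: "tape \<Rightarrow> symbol" where
  "scanned (t, i) = t i"

fun act :: "symbol \<times> move \<Rightarrow> tape \<Rightarrow> tape" where
  "act (s, m) (t, i) = (t(i := s), i + offset m)"

inductive step :: "machine \<Rightarrow> config \<Rightarrow> config \<Rightarrow> bool" for M where
  "(q, map scanned ts, q', as) \<in> instrs M \<Longrightarrow> step M (q, ts) (q', map2 act as ts)"

definition halted :: "machine \<Rightarrow> config \<Rightarrow> bool" where
  "halted M c \<longleftrightarrow> (\<nexists>c'. step M c c')"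

definition blank_tape :: tape where
  "blank_tape = (\<lambda>_. Blank, 0)"

definition input_tape :: "bits \<Rightarrow> tape" where
  "input_tape x = (\<lambda>i. if 0 \<le> i \<and> i < int (length x) then Bit (x ! nat i) else Blank, 0)"

definition initial :: "machine \<Rightarrow> bits \<Rightarrow> config" where
  "initial M x = (start M, input_tape x # replicate (n_tapes M - 1) blank_tape)"

definition path :: "machine \<Rightarrow> bits \<Rightarrow> config list \<Rightarrow> bool" where
  "path M x cs \<longleftrightarrow> cs \<noteq> [] \<and> hd cs = initial M x \<and> successively (step M) cs"

definition accepting_path :: "machine \<Rightarrow> bits \<Rightarrow> config list \<Rightarrow> bool" where
  "accepting_path M x cs \<longleftrightarrow>
     path M x cs \<and> halted M (last cs) \<and> fst (last cs) \<in> accepting M"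

definition lang :: "machine \<Rightarrow> bits set" where
  "lang M = {x. \<exists>cs. accepting_path M x cs}"

text \<open>The bound applies to all partial paths; hence no path is infinite.\<close>

definition poly_time :: "machine \<Rightarrow> bool" where
  "poly_time M \<longleftrightarrow>
     machine_wf M \<and> (\<exists>p :: nat poly. \<forall>x cs. path M x cs \<longrightarrow> length cs \<le> poly p (length x))"

section \<open>The classes P, UP and coUP\<close>

definition class_P :: "bits set set" where
  "class_P = {lang M |M. poly_time M \<and> deterministic M}"

definition class_UP :: "bits set set" where
  "class_UP =
     {lang M |M. poly_time M \<and> (\<forall>x. \<exists>\<^sub>\<le>\<^sub>1 cs. accepting_path M x cs)}"

definition class_coUP :: "bits set set" where
  "class_coUP = {- L |L. L \<in> class_UP}"

section \<open>Polynomial-time computable functions\<close>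

text \<open>The output is the word on the last tape that starts at cell \<open>0\<close> and ends before the first
  blank cell.\<close>

definition outputs :: "config \<Rightarrow> symbol list \<Rightarrow> bool" where
  "outputs c w \<longleftrightarrow> (let t = fst (last (snd c)) in
     (\<forall>i < length w. t (int i) = w ! i \<and> w ! i \<noteq> Blank) \<and> t (int (length w)) = Blank)"

definition poly_time_computable :: "(bits \<Rightarrow> symbol list) \<Rightarrow> bool" where
  "poly_time_computable f \<longleftrightarrow>
     (\<exists>M. poly_time M \<and> deterministic M \<and>
        (\<forall>x. \<exists>cs. path M x cs \<and> halted M (last cs) \<and> outputs (last cs) (f x)))"

section \<open>Rankability\<close>

definition number :: "nat \<Rightarrow> symbol list" where
  "number n = map Bit (nat_bits n)"

text \<open>Since every string over \<open>{0, 1}\<close> is a number, the indication \<open>not in set\<close> needs a symbol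
  outside of the binary alphabet.\<close>

definition not_in_set :: "symbol list" where
  "not_in_set = [Mark 0]"

definition strong_P_rankable :: "bits set \<Rightarrow> bool" where
  "strong_P_rankable A \<longleftrightarrow>
     (\<exists>f. poly_time_computable f \<and> (\<forall>x. f x = number (rank A x)))"

definition semistrong_P_rankable :: "bits set \<Rightarrow> bool" where
  "semistrong_P_rankable A \<longleftrightarrow>
     (\<exists>f. poly_time_computable f \<and>
        (\<forall>x \<in> A. f x = number (rank A x)) \<and> (\<forall>x. x \<notin> A \<longrightarrow> f x = not_in_set))"

definition nongappy :: "bits set \<Rightarrow> bool" where
  "nongappy A \<longleftrightarrow>
     (\<exists>p :: nat poly. \<forall>n. \<exists>y \<in> A. n \<le> length y \<and> length y \<le> poly p n)"

end

theory Submission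
  imports Defs "HOL-Library.Sublist"
begin

text \<open>For a string \<open>x\<close> let \<open>y\<close> be the last element of \<open>A\<close> up to \<open>x\<close>, and let \<open>z\<close> be the next
  element of \<open>A\<close>. Then \<open>x\<close> and \<open>y\<close> have the same rank. The pair \<open>(y, z)\<close> is short, since \<open>A\<close> is
  nongappy, and it is certified by \<open>y \<le> x < z\<close> and \<open>rank z = rank y + 1\<close>, where the semistrong ranking
  function yields both ranks. As the certificate is unique, the question whether a given word is a
  prefix of the rank of \<open>x\<close> lies in UP, and so does its negation. If UP \<open>\<inter>\<close> coUP = P, then the rank can
  be found digit by digit.\<close>

text \<open>For \<open>x\<close> outside \<open>A\<close> the ranking function yields nothing, and
  searching for a neighbour of \<open>x\<close> in \<open>A\<close> is too slow: its length is
  polynomially bounded, but exponentially many strings may lie in between. The neighbours can only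
  be guessed, and \<open>rank z = rank y + 1\<close> is what excludes that an element of
  \<open>A\<close> between them has been overlooked. A certificate fixes the whole rank, so the same
  certificates serve for positive and negative answers.

  The classes are defined by concrete multitape machines, and this shapes the development. Programs
  with exact step counts are compiled to machines. A compiled machine guesses exactly as many bits
  as its input has, so queries carry padding until a certificate fits. Programs simulate given
  machines again and again on the same tapes, so these must be blank after each run. Words are read
  onto stacks, which shows their last letter first; hence all arithmetic starts with the least
  significant digit.\<close>

type_synonym store = "nat \<Rightarrow> tape"
type_synonym reading = "nat \<Rightarrow> symbol"
type_synonym actions = "nat \<Rightarrow> symbol \<times> move"

section \<open>Programs acting on tapes\<close>

datatype com =
    Act "reading \<Rightarrow> actions"
  | Seq com com  (infixr ";;" 60)
  | Cond "reading \<Rightarrow> bool" com com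
  | While "reading \<Rightarrow> bool" com

definition reads :: "store \<Rightarrow> reading" where
  "reads s = (\<lambda>i. scanned (s i))"

definition acts :: "actions \<Rightarrow> store \<Rightarrow> store" where
  "acts a s = (\<lambda>i. act (a i) (s i))"

definition keep :: "reading \<Rightarrow> actions" where
  "keep r = (\<lambda>i. (r i, Stay))"

lemma act_scanned_Stay [simp]: "act (scanned t, Stay) t = t"
  by (cases t) auto

lemma acts_keep [simp]: "acts (keep (reads s)) s = s"
  by (auto simp: acts_def keep_def reads_def)

text \<open>The counts are exactly those of the compiled code: a test costs one step, leaving the
  first branch of \<open>Cond\<close> and returning to the test of a loop cost one jump each, and
  the second branch of \<open>Cond\<close> falls through.\<close>

inductive exec :: "com \<Rightarrow> store \<Rightarrow> nat \<Rightarrow> store \<Rightarrow> bool" where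
  exec_Act: "exec (Act f) s 1 (acts (f (reads s)) s)"
| exec_Seq: "exec p s t s' \<Longrightarrow> exec q s' t' s'' \<Longrightarrow> exec (p ;; q) s (t + t') s''"
| exec_Cond_True: "b (reads s) \<Longrightarrow> exec p s t s' \<Longrightarrow> exec (Cond b p q) s (t + 2) s'"
| exec_Cond_False: "\<not> b (reads s) \<Longrightarrow> exec q s t s' \<Longrightarrow> exec (Cond b p q) s (t + 1) s'"
| exec_While_False: "\<not> b (reads s) \<Longrightarrow> exec (While b p) s 1 s"
| exec_While_True: "b (reads s) \<Longrightarrow> exec p s t s' \<Longrightarrow> exec (While b p) s' t' s'' \<Longrightarrow>
    exec (While b p) s (t + t' + 2) s''"

section \<open>Compilation to Turing machines\<close>

type_synonym line = "reading \<Rightarrow> nat \<times> actions"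

fun csize :: "com \<Rightarrow> nat" where
  "csize (Act f) = 1"
| "csize (p ;; q) = csize p + csize q"
| "csize (Cond b p q) = csize p + csize q + 2"
| "csize (While b p) = csize p + 2"

text \<open>Addresses are absolute, with \<open>n\<close> the address of the first line. All code is
  left towards \<open>n + csize p\<close>, so sequencing needs no jump.\<close>

fun compile :: "com \<Rightarrow> nat \<Rightarrow> line list" where
  "compile (Act f) n = [\<lambda>r. (n + 1, f r)]"
| "compile (p ;; q) n = compile p n @ compile q (n + csize p)"
| "compile (Cond b p q) n =
     (\<lambda>r. (if b r then n + 1 else n + 2 + csize p, keep r)) # compile p (n + 1) @
     (\<lambda>r. (n + 2 + csize p + csize q, keep r)) # compile q (n + 2 + csize p)"
| "compile (While b p) n =
     (\<lambda>r. (if b r then n + 1 else n + 2 + csize p, keep r)) # compile p (n + 1) @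
     [\<lambda>r. (n, keep r)]"

lemma length_compile [simp]: "length (compile p n) = csize p"
  by (induction p n rule: compile.induct) auto

text \<open>Line \<open>0\<close> is excluded because state \<open>0\<close> of the machine is
  reserved for guessing.\<close>

definition lstep :: "line list \<Rightarrow> nat \<times> store \<Rightarrow> nat \<times> store \<Rightarrow> bool" where
  "lstep L c c' \<longleftrightarrow> 1 \<le> fst c \<and> fst c < length L \<and>
     c' = (fst ((L ! fst c) (reads (snd c))), acts (snd ((L ! fst c) (reads (snd c)))) (snd c))"

lemma lstep_at:
  assumes "L = pre @ l # post" "length pre = n" "1 \<le> n"
  shows "lstep L (n, s) (fst (l (reads s)), acts (snd (l (reads s))) s)"
  using assms by (auto simp: lstep_def nth_append)

lemma relpowp_trans: "(R ^^ m) a b \<Longrightarrow> (R ^^ n) b c \<Longrightarrow> (R ^^ (m + n)) a c"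
  for R :: "'a \<Rightarrow> 'a \<Rightarrow> bool"
  by (auto simp: relpowp_add relcompp.simps)

lemma relpowp_Suc_left: "R a b \<Longrightarrow> (R ^^ n) b c \<Longrightarrow> (R ^^ Suc n) a c"
  for R :: "'a \<Rightarrow> 'a \<Rightarrow> bool"
  by (rule relpowp_Suc_I2)

text \<open>The contexts \<open>pre\<close> and \<open>post\<close> are arbitrary because in the
  induction each subprogram sits at an inner address of the same list \<open>L\<close>.\<close>

lemma exec_lsteps:
  assumes "exec p s t s'" "L = pre @ compile p n @ post" "length pre = n" "1 \<le> n"
  shows "(lstep L ^^ t) (n, s) (n + csize p, s')"
  using assms
proof (induction arbitrary: pre n post rule: exec.induct)
  case (exec_Act f s)
  then show ?case
    using lstep_at[of L pre "\<lambda>r. (n + 1, f r)" post n s] by auto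
next
  case (exec_Seq p s t s' q t' s'')
  have "(lstep L ^^ t) (n, s) (n + csize p, s')"
    by (rule exec_Seq.IH(1)[of pre n "compile q (n + csize p) @ post"]) (use exec_Seq.prems in auto)
  moreover have "(lstep L ^^ t') (n + csize p, s') (n + csize p + csize q, s'')"
    by (rule exec_Seq.IH(2)[of "pre @ compile p n" "n + csize p" post]) (use exec_Seq.prems in auto)
  ultimately show ?case
    by (auto dest: relpowp_trans simp: add.assoc)
next
  case (exec_Cond_True b s p t s' q)
  let ?g = "\<lambda>r. (n + 2 + csize p + csize q, keep r)"
  have 1: "lstep L (n, s) (n + 1, s)"
    using lstep_at[OF exec_Cond_True.prems(1)[unfolded compile.simps append_Cons] exec_Cond_True.prems(2,3),
      of s] exec_Cond_True.hyps by simp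
  have 2: "(lstep L ^^ t) (n + 1, s) (n + 1 + csize p, s')"
    by (rule exec_Cond_True.IH[of "pre @ [\<lambda>r. (if b r then n + 1 else n + 2 + csize p, keep r)]" "n + 1"
        "?g # compile q (n + 2 + csize p) @ post"])
      (use exec_Cond_True.prems in auto)
  have 3: "lstep L (n + 1 + csize p, s') (n + 2 + csize p + csize q, s')"
    using lstep_at[of L "pre @ (\<lambda>r. (if b r then n + 1 else n + 2 + csize p, keep r)) # compile p (n + 1)"
        ?g "compile q (n + 2 + csize p) @ post" "n + 1 + csize p" s'] exec_Cond_True.prems by simp
  show ?case
    using relpowp_Suc_left[OF 1 relpowp_Suc_I[OF 2 3]] by (simp add: add_ac)
next
  case (exec_Cond_False b s q t s' p)
  have 1: "lstep L (n, s) (n + 2 + csize p, s)"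
    using lstep_at[OF exec_Cond_False.prems(1)[unfolded compile.simps append_Cons] exec_Cond_False.prems(2,3),
      of s] exec_Cond_False.hyps by simp
  have 2: "(lstep L ^^ t) (n + 2 + csize p, s) (n + 2 + csize p + csize q, s')"
    by (rule exec_Cond_False.IH[of "pre @ (\<lambda>r. (if b r then n + 1 else n + 2 + csize p, keep r)) #
        compile p (n + 1) @ [\<lambda>r. (n + 2 + csize p + csize q, keep r)]" _ post])
      (use exec_Cond_False.prems in auto)
  show ?case
    using relpowp_Suc_left[OF 1 2] by (simp add: add_ac)
next
  case (exec_While_False b s p)
  have 1: "lstep L (n, s) (n + 2 + csize p, s)"
    using lstep_at[OF exec_While_False.prems(1)[unfolded compile.simps append_Cons] exec_While_False.prems(2,3),
      of s] exec_While_False.hyps by simp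
  then show ?case by auto
next
  case (exec_While_True b s p t s' t' s'')
  have 1: "lstep L (n, s) (n + 1, s)"
    using lstep_at[OF exec_While_True.prems(1)[unfolded compile.simps append_Cons] exec_While_True.prems(2,3),
      of s] exec_While_True.hyps by simp
  have 2: "(lstep L ^^ t) (n + 1, s) (n + 1 + csize p, s')"
    by (rule exec_While_True.IH(1)[of "pre @ [\<lambda>r. (if b r then n + 1 else n + 2 + csize p, keep r)]"
          "n + 1" "(\<lambda>r. (n, keep r)) # post"])
      (use exec_While_True.prems in auto)
  have 3: "lstep L (n + 1 + csize p, s') (n, s')"
    using lstep_at[of L "pre @ (\<lambda>r. (if b r then n + 1 else n + 2 + csize p, keep r)) # compile p (n + 1)"
        "\<lambda>r. (n, keep r)" post "n + 1 + csize p" s'] exec_While_True.prems by simp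
  have 4: "(lstep L ^^ t') (n, s') (n + csize (While b p), s'')"
    by (rule exec_While_True.IH(2)[OF exec_While_True.prems])
  show ?case
    using relpowp_trans[OF relpowp_Suc_left[OF 1 relpowp_Suc_I[OF 2 3]] 4] by (simp add: add_ac)
qed

text \<open>A machine with \<open>K\<close> tapes over the alphabet \<open>G\<close> can perform a line only if the line depends on
  these tapes alone and does not leave the alphabet.\<close>

definition local_to :: "nat \<Rightarrow> (reading \<Rightarrow> 'a) \<Rightarrow> bool" where
  "local_to K h \<longleftrightarrow> (\<forall>r r'. (\<forall>i<K. r i = r' i) \<longrightarrow> h r = h r')"

definition acts_ok :: "nat \<Rightarrow> symbol set \<Rightarrow> (reading \<Rightarrow> actions) \<Rightarrow> bool" where
  "acts_ok K G f \<longleftrightarrow> (\<forall>i<K. local_to K (\<lambda>r. f r i) \<and> (\<forall>r. (\<forall>i<K. r i \<in> G) \<longrightarrow> fst (f r i) \<in> G))"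

fun com_ok :: "nat \<Rightarrow> symbol set \<Rightarrow> com \<Rightarrow> bool" where
  "com_ok K G (Act f) \<longleftrightarrow> acts_ok K G f"
| "com_ok K G (p ;; q) \<longleftrightarrow> com_ok K G p \<and> com_ok K G q"
| "com_ok K G (Cond b p q) \<longleftrightarrow> local_to K b \<and> com_ok K G p \<and> com_ok K G q"
| "com_ok K G (While b p) \<longleftrightarrow> local_to K b \<and> com_ok K G p"

definition line_ok :: "nat \<Rightarrow> symbol set \<Rightarrow> line \<Rightarrow> bool" where
  "line_ok K G l \<longleftrightarrow> local_to K (\<lambda>r. fst (l r)) \<and> acts_ok K G (\<lambda>r. snd (l r))"

lemma local_to_const [simp]: "local_to K (\<lambda>r. c)"
  by (auto simp: local_to_def)

lemma local_to_nth [simp]: "i < K \<Longrightarrow> local_to K (\<lambda>r. r i)"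
  by (auto simp: local_to_def)

lemma local_to_comp: "local_to K h \<Longrightarrow> local_to K (\<lambda>r. g (h r))"
  unfolding local_to_def by metis

lemma within_keep [simp]: "acts_ok K G keep"
  by (auto simp: acts_ok_def keep_def local_to_def)

lemma compile_line_ok: "com_ok K G p \<Longrightarrow> l \<in> set (compile p n) \<Longrightarrow> line_ok K G l"
  by (induction p n rule: compile.induct)
    (auto simp: line_ok_def local_to_comp[of K _ "\<lambda>b. if b then _ else _"])

section \<open>Machines that guess and then run a program\<close>

definition begin_store :: "bits \<Rightarrow> bits \<Rightarrow> store" where
  "begin_store x g = (\<lambda>i. if i = 0 then (fst (input_tape x), int (length x) - 1)
     else if i = 1 then (fst (input_tape g), int (length g) - 1) else (\<lambda>_. Blank, -1))"

text \<open>State \<open>0\<close> walks over the input and writes as many guessed bits from \<open>Bs\<close> on tape \<open>1\<close>; then all heads step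
  to the left, so that the program finds its tapes as stacks. At the end tape \<open>v\<close> is tested: the machine
  accepts if a blank is scanned there. State \<open>i\<close> performs line \<open>i\<close>; line \<open>0\<close> is a dummy.\<close>

locale compiled =
  fixes K :: nat and G :: "symbol set" and Bs :: "bool set" and v :: nat and p :: com
  assumes ok: "com_ok K G p" and K: "2 \<le> K" and v: "v < K" and fin: "finite G"
    and G: "Blank \<in> G" "Bit True \<in> G" "Bit False \<in> G"
begin

text \<open>Both targets of the final test, \<open>length lines\<close> and its successor, are
  states without instructions; so the machine halts in either of them.\<close>

definition lines :: "line list" where
  "lines = (\<lambda>r. (0, keep r)) # compile p 1 @
     [\<lambda>r. (if r v = Blank then csize p + 2 else csize p + 3, keep r)]"

definition words :: "symbol list set" where
  "words = {rs. set rs \<subseteq> G \<and> length rs = K}"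

definition guess_acts :: "bool \<Rightarrow> reading \<Rightarrow> actions" where
  "guess_acts b r = (keep r)(0 := (r 0, MoveRight), 1 := (Bit b, MoveRight))"

definition left_acts :: "reading \<Rightarrow> actions" where
  "left_acts r = (\<lambda>i. (r i, MoveLeft))"

text \<open>Lines depend on infinite readings, instructions on words of length \<open>K\<close>. The
  blanks filled in cannot be noticed, since every line is \<open>local_to K\<close>.\<close>

definition reading_of :: "symbol list \<Rightarrow> reading" where
  "reading_of rs = (\<lambda>i. if i < K then rs ! i else Blank)"

definition instr :: "nat \<Rightarrow> symbol list \<Rightarrow> nat \<Rightarrow> (reading \<Rightarrow> actions) \<Rightarrow> instruction" where
  "instr q rs q' f = (q, rs, q', map (f (reading_of rs)) [0..<K])"

definition machine_instrs :: "instruction set" where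
  "machine_instrs =
     (\<Union>rs\<in>{rs \<in> words. hd rs \<noteq> Blank}. (\<lambda>b. instr 0 rs 0 (guess_acts b)) ` Bs) \<union>
     (\<lambda>rs. instr 0 rs 1 left_acts) ` {rs \<in> words. hd rs = Blank} \<union>
     (\<Union>q\<in>{1..<length lines}.
       (\<lambda>rs. instr q rs (fst ((lines ! q) (reading_of rs))) (\<lambda>r. snd ((lines ! q) r))) ` words)"

definition M :: machine where
  "M = \<lparr>n_tapes = K, instrs = machine_instrs, start = 0, accepting = {csize p + 2}\<rparr>"

lemma length_lines [simp]: "length lines = csize p + 2"
  by (simp add: lines_def)

lemma finite_words: "finite words"
  unfolding words_def using finite_lists_length_eq[OF fin] .

lemma finite_instrs: "finite machine_instrs"
  unfolding machine_instrs_def using finite_words by (auto intro!: finite_subset[of _ words])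

lemma wf: "machine_wf M"
  using K finite_instrs by (auto simp: machine_wf_def M_def machine_instrs_def instr_def words_def)

definition proj :: "store \<Rightarrow> tape list" where
  "proj s = map s [0..<K]"

definition over :: "store \<Rightarrow> bool" where
  "over s \<longleftrightarrow> (\<forall>i<K. \<forall>j. fst (s i) j \<in> G)"

lemma over_scanned: "over s \<Longrightarrow> i < K \<Longrightarrow> scanned (s i) \<in> G"
  by (cases "s i") (auto simp: over_def dest!: spec[of _ i])

lemma scanned_words: "over s \<Longrightarrow> map scanned (proj s) \<in> words"
  by (auto simp: words_def proj_def over_scanned)

lemma reading_of_scanned: "i < K \<Longrightarrow> reading_of (map scanned (proj s)) i = reads s i"
  by (auto simp: reading_of_def proj_def reads_def)

lemma map2_act_proj:
  assumes "\<forall>i<K. f r i = f (reads s) i"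
  shows "map2 act (map (f r) [0..<K]) (proj s) = proj (acts (f (reads s)) s)"
  by (rule nth_equalityI) (use assms in \<open>auto simp: proj_def acts_def\<close>)

lemma line_ok: "1 \<le> q \<Longrightarrow> q < length lines \<Longrightarrow> line_ok K G (lines ! q)"
proof -
  assume "1 \<le> q" "q < length lines"
  then have "lines ! q = tl lines ! (q - 1)" "q - 1 < length (tl lines)"
    by (auto simp: nth_tl)
  then have "lines ! q \<in> set (tl lines)"
    by (metis nth_mem)
  moreover have "line_ok K G (\<lambda>r. (if r v = Blank then csize p + 2 else csize p + 3, keep r))"
    using v by (auto simp: line_ok_def local_to_comp[of K "\<lambda>r. r v" "\<lambda>a. if a = Blank then _ else _"])
  ultimately show ?thesis
    using compile_line_ok[OF ok] by (auto simp: lines_def)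
qed

lemma hd_scanned: "hd (map scanned (proj s)) = scanned (s 0)"
  using K by (simp add: proj_def hd_map hd_upt upt_rec[of 0 K])

lemma step_iff: "step M (q, ts) c' \<longleftrightarrow>
    (\<exists>q' as. (q, map scanned ts, q', as) \<in> machine_instrs \<and> c' = (q', map2 act as ts))"
  by (auto simp: step.simps M_def)

lemma instrs_line: "1 \<le> q \<Longrightarrow> (q, rs, q', as) \<in> machine_instrs \<longleftrightarrow>
    rs \<in> words \<and> q < length lines \<and> q' = fst ((lines ! q) (reading_of rs)) \<and>
    as = map (snd ((lines ! q) (reading_of rs))) [0..<K]"
  unfolding machine_instrs_def instr_def by (auto simp: image_iff)

lemma instrs_guess: "hd rs \<noteq> Blank \<Longrightarrow> (0, rs, q', as) \<in> machine_instrs \<longleftrightarrow>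
    rs \<in> words \<and> q' = 0 \<and> (\<exists>b\<in>Bs. as = map (guess_acts b (reading_of rs)) [0..<K])"
  unfolding machine_instrs_def instr_def by (auto simp: image_iff)

lemma instrs_left: "hd rs = Blank \<Longrightarrow> (0, rs, q', as) \<in> machine_instrs \<longleftrightarrow>
    rs \<in> words \<and> q' = 1 \<and> as = map (left_acts (reading_of rs)) [0..<K]"
  unfolding machine_instrs_def instr_def by (auto simp: image_iff)

lemma step_line:
  assumes q: "1 \<le> q" "q < length lines" and s: "over s"
  shows "step M (q, proj s) c' \<longleftrightarrow>
    c' = (fst ((lines ! q) (reads s)), proj (acts (snd ((lines ! q) (reads s))) s))"
proof -
  let ?r = "reading_of (map scanned (proj s))"
  have *: "\<forall>i<K. ?r i = reads s i" by (simp add: reading_of_scanned)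
  note ok = line_ok[OF q, unfolded line_ok_def acts_ok_def]
  have 1: "fst ((lines ! q) ?r) = fst ((lines ! q) (reads s))"
    using * ok unfolding local_to_def by blast
  have "\<forall>i<K. snd ((lines ! q) ?r) i = snd ((lines ! q) (reads s)) i"
    using * ok unfolding local_to_def by blast
  from map2_act_proj[OF this] have 2: "map2 act (map (snd ((lines ! q) ?r)) [0..<K]) (proj s) =
    proj (acts (snd ((lines ! q) (reads s))) s)" .
  show ?thesis
    using q scanned_words[OF s] 1 2 by (simp add: step_iff instrs_line)
qed

lemma over_acts:
  assumes "acts_ok K G f" "over s"
  shows "over (acts (f (reads s)) s)"
proof -
  have "fst (f (reads s) i) \<in> G" if "i < K" for i
    using assms that over_scanned[OF assms(2)] by (auto simp: acts_ok_def reads_def)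
  moreover have "fst (act (a, m) t) j \<in> insert a (range (fst t))" for a m t j
    by (cases t) auto
  ultimately have "fst (act (f (reads s) i) (s i)) j \<in> G" if "i < K" for i j
    using that assms(2) unfolding over_def
    by (metis (no_types, lifting) imageE insertE prod.collapse)
  then show ?thesis
    by (simp add: over_def acts_def)
qed

lemma over_lstep: "lstep lines c c' \<Longrightarrow> over (snd c) \<Longrightarrow> over (snd c')"
  using over_acts line_ok by (auto simp: lstep_def line_ok_def)

lemma step_lstep: "lstep lines (q, s) (q', s') \<Longrightarrow> over s \<Longrightarrow>
    step M (q, proj s) c' \<longleftrightarrow> c' = (q', proj s')"
  by (subst step_line) (auto simp: lstep_def)

lemma halted_end: "length lines \<le> q \<Longrightarrow> halted M (q, ts)"
  by (auto simp: halted_def step_iff instrs_line)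

lemma successively_halted:
  "successively (step M) (c # cs) \<Longrightarrow> halted M c \<Longrightarrow> cs = []"
  by (cases cs) (auto simp: halted_def)

text \<open>After the guess the machine has no choice, so all its computations are initial pieces of
  one chain \<open>ds\<close>. That every path is a prefix of it serves for the time bound; that
  every halted path equals it serves for counting accepting paths.\<close>

lemma lsteps_chain:
  assumes "(lstep lines ^^ t) (q, s) (q', s')" "over s" "length lines \<le> q'"
  shows "\<exists>ds. length ds = t \<and> last ((q, proj s) # ds) = (q', proj s') \<and>
    successively (step M) ((q, proj s) # ds) \<and>
    (\<forall>cs. successively (step M) ((q, proj s) # cs) \<longrightarrow>
       prefix cs ds \<and> (halted M (last ((q, proj s) # cs)) \<longrightarrow> cs = ds))"
  using assms
proof (induction t arbitrary: q s)
  case 0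
  then have "halted M (q, proj s)"
    by (auto intro: halted_end)
  then show ?case
    using 0 by (auto dest: successively_halted)
next
  case (Suc t)
  then obtain q1 s1 where 1: "lstep lines (q, s) (q1, s1)" "(lstep lines ^^ t) (q1, s1) (q', s')"
    by (metis relpowp_Suc_D2 surj_pair)
  have s1: "over s1" using over_lstep[OF 1(1)] Suc.prems by simp
  note st = step_lstep[OF 1(1) Suc.prems(2)]
  obtain ds where ds: "length ds = t" "last ((q1, proj s1) # ds) = (q', proj s')"
    "successively (step M) ((q1, proj s1) # ds)"
    "\<And>cs. successively (step M) ((q1, proj s1) # cs) \<Longrightarrow>
       prefix cs ds \<and> (halted M (last ((q1, proj s1) # cs)) \<longrightarrow> cs = ds)"
    using Suc.IH[OF 1(2) s1 Suc.prems(3)] by blast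
  have nh: "\<not> halted M (q, proj s)"
    using st by (auto simp: halted_def)
  have *: "cs = [] \<or> (\<exists>cs'. cs = (q1, proj s1) # cs' \<and> successively (step M) ((q1, proj s1) # cs'))"
    if "successively (step M) ((q, proj s) # cs)" for cs
    using that st by (cases cs) (simp_all add: successively_Cons)
  show ?case
  proof (intro exI[of _ "(q1, proj s1) # ds"] conjI allI impI)
    fix cs assume cs: "successively (step M) ((q, proj s) # cs)"
    show "prefix cs ((q1, proj s1) # ds)"
      using *[OF cs] ds(4) by fastforce
    show "cs = (q1, proj s1) # ds" if "halted M (last ((q, proj s) # cs))"
      using *[OF cs] ds(4) nh that by fastforce
  next
    show "successively (step M) ((q, proj s) # (q1, proj s1) # ds)"
      using ds(3) st by simp
  qed (use ds(1,2) in auto)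
qed

text \<open>The tapes in state \<open>0\<close> once \<open>g\<close> has been guessed; both heads
  have moved by \<open>length g\<close>.\<close>

definition pre :: "bits \<Rightarrow> bits \<Rightarrow> store" where
  "pre x g = (\<lambda>i. if i = 0 then (fst (input_tape x), int (length g))
     else if i = 1 then (fst (input_tape g), int (length g)) else blank_tape)"

lemma over_input: "fst (input_tape x) j \<in> G"
  using G by (cases "x ! nat j") (auto simp: input_tape_def)

lemma over_pre: "over (pre x g)"
  using over_input G by (auto simp: over_def pre_def blank_tape_def)

lemma over_begin: "over (begin_store x g)"
  using over_input G by (auto simp: over_def begin_store_def)

lemma initial_pre: "initial M x = (0, proj (pre x []))"
proof -
  have "proj (pre x []) = pre x [] 0 # map (pre x []) [1..<K]"
    using K by (simp add: proj_def upt_rec[of 0 K])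
  also have "map (pre x []) [1..<K] = replicate (K - 1) blank_tape"
    by (rule nth_equalityI) (auto simp: pre_def blank_tape_def input_tape_def)
  finally show ?thesis
    by (simp add: initial_def M_def pre_def input_tape_def)
qed

lemma acts_guess:
  assumes "length g < length x"
  shows "acts (guess_acts b (reads (pre x g))) (pre x g) = pre x (g @ [b])"
proof
  fix i
  show "acts (guess_acts b (reads (pre x g))) (pre x g) i = pre x (g @ [b]) i"
    by (auto simp: acts_def guess_acts_def pre_def reads_def keep_def input_tape_def blank_tape_def
        fun_eq_iff nth_append)
qed

lemma acts_left:
  assumes "length g = length x"
  shows "acts (left_acts (reads (pre x g))) (pre x g) = begin_store x g"
  using assms by (auto simp: acts_def left_acts_def pre_def reads_def begin_store_def input_tape_def
      blank_tape_def fun_eq_iff)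

lemma guess_cong: "(\<forall>i<K. r i = r' i) \<Longrightarrow> \<forall>i<K. guess_acts b r i = guess_acts b r' i"
  using K by (auto simp: guess_acts_def keep_def)

lemma left_cong: "(\<forall>i<K. r i = r' i) \<Longrightarrow> \<forall>i<K. left_acts r i = left_acts r' i"
  by (auto simp: left_acts_def)

lemma step_guess:
  assumes g: "length g < length x"
  shows "step M (0, proj (pre x g)) c' \<longleftrightarrow> (\<exists>b\<in>Bs. c' = (0, proj (pre x (g @ [b]))))"
proof -
  let ?r = "reading_of (map scanned (proj (pre x g)))"
  have "\<forall>i<K. guess_acts b ?r i = guess_acts b (reads (pre x g)) i" for b
    by (rule guess_cong) (simp add: reading_of_scanned)
  from map2_act_proj[where f = "guess_acts _", OF this] have 1: "map2 act (map (guess_acts b ?r) [0..<K]) (proj (pre x g)) =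
      proj (pre x (g @ [b]))" for b
    by (simp add: acts_guess[OF g])
  have 2: "hd (map scanned (proj (pre x g))) \<noteq> Blank"
    using g by (simp add: hd_scanned pre_def input_tape_def)
  show ?thesis
    using 1 scanned_words[OF over_pre] by (auto simp: step_iff instrs_guess[OF 2])
qed

lemma step_left:
  assumes g: "length g = length x"
  shows "step M (0, proj (pre x g)) c' \<longleftrightarrow> c' = (1, proj (begin_store x g))"
proof -
  let ?r = "reading_of (map scanned (proj (pre x g)))"
  have "\<forall>i<K. left_acts ?r i = left_acts (reads (pre x g)) i"
    by (rule left_cong) (simp add: reading_of_scanned)
  from map2_act_proj[where f = "left_acts", OF this] have 1: "map2 act (map (left_acts ?r) [0..<K]) (proj (pre x g)) =
      proj (begin_store x g)"
    by (simp add: acts_left[OF g])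
  have 2: "hd (map scanned (proj (pre x g))) = Blank"
    using g by (simp add: hd_scanned pre_def input_tape_def)
  show ?thesis
    using 1 scanned_words[OF over_pre] by (auto simp: step_iff instrs_left[OF 2])
qed

lemma exec_final:
  assumes "exec p s t s'"
  shows "(lstep lines ^^ (t + 1)) (1, s)
    (if scanned (s' v) = Blank then csize p + 2 else csize p + 3, s')"
proof -
  have "(lstep lines ^^ t) (1, s) (1 + csize p, s')"
    by (rule exec_lsteps[OF assms, where pre = "[\<lambda>r. (0, keep r)]"]) (auto simp: lines_def)
  moreover have "lstep lines (1 + csize p, s')
      (if scanned (s' v) = Blank then csize p + 2 else csize p + 3, s')"
    by (simp add: lstep_def lines_def nth_append) (simp add: reads_def)
  ultimately show ?thesis
    by (auto intro: relpowp_Suc_I simp del: relpowp.simps(2))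
qed

definition accepts_from :: "config \<Rightarrow> config list \<Rightarrow> bool" where
  "accepts_from c cs \<longleftrightarrow> successively (step M) (c # cs) \<and> halted M (last (c # cs)) \<and>
     fst (last (c # cs)) \<in> accepting M"

lemma accepting_path_iff:
  "accepting_path M x cs \<longleftrightarrow> (\<exists>ds. cs = (0, proj (pre x [])) # ds \<and>
     accepts_from (0, proj (pre x [])) ds)"
  by (cases cs) (auto simp: accepting_path_def path_def accepts_from_def initial_pre)

lemma path_iff:
  "path M x cs \<longleftrightarrow> (\<exists>ds. cs = (0, proj (pre x [])) # ds \<and>
     successively (step M) ((0, proj (pre x [])) # ds))"
  by (cases cs) (auto simp: path_def initial_pre)

lemma guess_cases:
  assumes "successively (step M) ((0, proj (pre x g)) # cs)" "length g < length x"
  shows "cs = [] \<or> (\<exists>b\<in>Bs. \<exists>cs'. cs = (0, proj (pre x (g @ [b]))) # cs' \<and>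
    successively (step M) ((0, proj (pre x (g @ [b]))) # cs'))"
  using assms step_guess[OF assms(2)] by (cases cs) (auto simp: successively_Cons)

lemma left_cases:
  assumes "successively (step M) ((0, proj (pre x g)) # cs)" "length g = length x"
  shows "cs = [] \<or> (\<exists>cs'. cs = (1, proj (begin_store x g)) # cs' \<and>
    successively (step M) ((1, proj (begin_store x g)) # cs'))"
  using assms step_left[OF assms(2)] by (cases cs) (auto simp: successively_Cons)

lemma accepts_guess_cases:
  assumes "Bs \<noteq> {}" "accepts_from (0, proj (pre x g)) cs" "length g < length x"
  shows "\<exists>b\<in>Bs. \<exists>cs'. cs = (0, proj (pre x (g @ [b]))) # cs' \<and>
    accepts_from (0, proj (pre x (g @ [b]))) cs'"
proof -
  have "\<not> halted M (0, proj (pre x g))"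
    using step_guess[OF assms(3)] assms(1) by (auto simp: halted_def)
  then show ?thesis
    using guess_cases[of x g cs] assms by (fastforce simp: accepts_from_def)
qed

lemma accepts_left_cases:
  assumes "accepts_from (0, proj (pre x g)) cs" "length g = length x"
  shows "\<exists>cs'. cs = (1, proj (begin_store x g)) # cs' \<and>
    accepts_from (1, proj (begin_store x g)) cs'"
proof -
  have "\<not> halted M (0, proj (pre x g))"
    using step_left[OF assms(2)] by (auto simp: halted_def)
  then show ?thesis
    using left_cases[of x g cs] assms by (fastforce simp: accepts_from_def)
qed

end

section \<open>Witness relations and UP\<close>

definition poly_bounded :: "(nat \<Rightarrow> nat) \<Rightarrow> bool" where
  "poly_bounded T \<longleftrightarrow> (\<exists>q :: nat poly. \<forall>n. T n \<le> poly q n)"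

text \<open>\<open>R x g\<close> is the relation that the program decides for input \<open>x\<close>
  and guess \<open>g\<close>. With \<open>Bs = UNIV\<close> this gives a nondeterministic verifier;
  with a singleton \<open>Bs\<close> only one guess exists and the machine is deterministic.\<close>

locale compiled_decider = compiled +
  fixes T :: "nat \<Rightarrow> nat" and R :: "bits \<Rightarrow> bits \<Rightarrow> bool"
  assumes Bs: "Bs \<noteq> {}" and T: "poly_bounded T"
    and run: "\<And>x g. length g = length x \<Longrightarrow> set g \<subseteq> Bs \<Longrightarrow>
      \<exists>t s'. t \<le> T (length x) \<and> exec p (begin_store x g) t s' \<and> (scanned (s' v) = Blank \<longleftrightarrow> R x g)"
begin

lemma run_chain:
  assumes "length g = length x" "set g \<subseteq> Bs"
  shows "\<exists>ds. length ds \<le> T (length x) + 1 \<and>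
     (accepts_from (1, proj (begin_store x g)) ds \<longleftrightarrow> R x g) \<and>
     (\<forall>cs. successively (step M) ((1, proj (begin_store x g)) # cs) \<longrightarrow> prefix cs ds \<and>
       (halted M (last ((1, proj (begin_store x g)) # cs)) \<longrightarrow> cs = ds))"
proof -
  obtain t s' where t: "t \<le> T (length x)" "exec p (begin_store x g) t s'"
      "scanned (s' v) = Blank \<longleftrightarrow> R x g"
    using run[OF assms] by blast
  let ?q = "if scanned (s' v) = Blank then csize p + 2 else csize p + 3"
  have "length lines \<le> ?q"
    by simp
  from lsteps_chain[OF exec_final[OF t(2)] over_begin this]
  obtain ds where ds: "length ds = t + 1"
      "last ((1, proj (begin_store x g)) # ds) = (?q, proj s')"
      "successively (step M) ((1, proj (begin_store x g)) # ds)"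
      "\<forall>cs. successively (step M) ((1, proj (begin_store x g)) # cs) \<longrightarrow> prefix cs ds \<and>
        (halted M (last ((1, proj (begin_store x g)) # cs)) \<longrightarrow> cs = ds)"
    by blast
  have "accepts_from (1, proj (begin_store x g)) ds \<longleftrightarrow> ?q = csize p + 2"
    unfolding accepts_from_def ds(2) using ds(3) halted_end by (simp add: M_def)
  then have "accepts_from (1, proj (begin_store x g)) ds \<longleftrightarrow> R x g"
    using t(3) by simp
  moreover have "length ds \<le> T (length x) + 1"
    using ds(1) t(1) by simp
  ultimately show ?thesis
    using ds(4) by blast
qed

text \<open>The remaining guesses are followed by one step to the left, at most \<open>T\<close>
  steps of the program and one final test.\<close>

lemma chain_bound:
  assumes "successively (step M) ((0, proj (pre x g)) # cs)" "length g \<le> length x" "set g \<subseteq> Bs"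
  shows "length cs \<le> (length x - length g) + 2 + T (length x)"
  using assms
proof (induction "length x - length g" arbitrary: g cs)
  case 0
  then have g: "length g = length x" by simp
  from left_cases[OF 0(2) this] show ?case
  proof (elim disjE exE conjE)
    fix cs' assume "cs = (1, proj (begin_store x g)) # cs'"
      "successively (step M) ((1, proj (begin_store x g)) # cs')"
    with run_chain[OF g 0(4)] show ?thesis
      by (fastforce dest: prefix_length_le)
  qed simp
next
  case (Suc k)
  then have g: "length g < length x" by simp
  from guess_cases[OF Suc(3) this] show ?case
  proof (elim disjE exE conjE bexE)
    fix b cs' assume "b \<in> Bs" "cs = (0, proj (pre x (g @ [b]))) # cs'"
      "successively (step M) ((0, proj (pre x (g @ [b]))) # cs')"
    with Suc(1)[of "g @ [b]" cs'] Suc(2,5) g show ?thesis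
      by fastforce
  qed simp
qed

lemma poly_time_M: "poly_time M"
proof -
  obtain q :: "nat poly" where q: "\<And>n. T n \<le> poly q n"
    using T by (auto simp: poly_bounded_def)
  \<comment> \<open>The \<open>3\<close> counts the step to the left, the final test and the initial
    configuration; the \<open>1\<close> is the coefficient of the guessing steps.\<close>
  have "length cs \<le> poly (q + [:3, 1:]) (length x)" if "path M x cs" for x cs
    using that chain_bound[of x "[]"] q[of "length x"] by (fastforce simp: path_iff)
  then show ?thesis
    using wf unfolding poly_time_def by blast
qed

lemma accepts_from_R:
  assumes "accepts_from (0, proj (pre x g)) cs" "length g \<le> length x" "set g \<subseteq> Bs"
  shows "\<exists>g'. length g' = length x \<and> set g' \<subseteq> Bs \<and> prefix g g' \<and> R x g'"
  using assms
proof (induction "length x - length g" arbitrary: g cs)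
  case 0
  then have g: "length g = length x" by simp
  obtain cs' where "accepts_from (1, proj (begin_store x g)) cs'"
    using accepts_left_cases[OF 0(2) g] by blast
  then show ?case
    using run_chain[OF g 0(4)] g 0(4) unfolding accepts_from_def by blast
next
  case (Suc k)
  then have g: "length g < length x" by simp
  obtain b cs' where b: "b \<in> Bs" "accepts_from (0, proj (pre x (g @ [b]))) cs'"
    using accepts_guess_cases[OF Bs Suc(3) g] by blast
  show ?case
    using Suc(1)[OF _ b(2)] Suc(2,5) g b(1) by (fastforce dest: append_prefixD)
qed

text \<open>If two accepting paths first differed in the guessed bits \<open>b\<close> and
  \<open>b'\<close>, they would lead to witnesses extending \<open>g @ [b]\<close> and
  \<open>g @ [b']\<close>. These witnesses coincide by uniqueness, so \<open>b = b'\<close>. After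
  the guess there is no choice left.\<close>

lemma accepts_from_unique:
  assumes unique: "\<And>g g'. length g = length x \<Longrightarrow> length g' = length x \<Longrightarrow> set g \<subseteq> Bs \<Longrightarrow>
      set g' \<subseteq> Bs \<Longrightarrow> R x g \<Longrightarrow> R x g' \<Longrightarrow> g = g'"
    and "accepts_from (0, proj (pre x g)) cs" "accepts_from (0, proj (pre x g)) cs'"
      "length g \<le> length x" "set g \<subseteq> Bs"
  shows "cs = cs'"
  using assms(2-)
proof (induction "length x - length g" arbitrary: g cs cs')
  case 0
  then have g: "length g = length x" by simp
  from accepts_left_cases[OF 0(2) g] accepts_left_cases[OF 0(3) g] run_chain[OF g 0(5)]
  show ?case
    unfolding accepts_from_def by blast
next
  case (Suc k)
  then have g: "length g < length x" by simp
  obtain b cs1 where b: "b \<in> Bs" "accepts_from (0, proj (pre x (g @ [b]))) cs1"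
      "cs = (0, proj (pre x (g @ [b]))) # cs1"
    using accepts_guess_cases[OF Bs Suc(3) g] by blast
  obtain b' cs2 where b': "b' \<in> Bs" "accepts_from (0, proj (pre x (g @ [b']))) cs2"
      "cs' = (0, proj (pre x (g @ [b']))) # cs2"
    using accepts_guess_cases[OF Bs Suc(4) g] by blast
  obtain h where h: "length h = length x" "set h \<subseteq> Bs" "prefix (g @ [b]) h" "R x h"
    using accepts_from_R[OF b(2)] g b(1) Suc(6) by auto
  obtain h' where h': "length h' = length x" "set h' \<subseteq> Bs" "prefix (g @ [b']) h'" "R x h'"
    using accepts_from_R[OF b'(2)] g b'(1) Suc(6) by auto
  have "h = h'"
    using unique h h' by blast
  then have "b = b'"
    using h(3) h'(3) by (auto simp: prefix_def)
  then show ?case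
    using Suc(1)[of "g @ [b]" cs1 cs2] b b' Suc(2,6) g by auto
qed

lemma R_accepts_from:
  assumes "length h = length x" "set h \<subseteq> Bs" "R x h" "prefix g h"
  shows "\<exists>cs. accepts_from (0, proj (pre x g)) cs"
  using assms(4)
proof (induction "length x - length g" arbitrary: g)
  case 0
  then have "length h \<le> length g" "prefix g h"
    using assms(1) by simp_all
  then have g: "g = h"
    by (metis append_Nil2 append_eq_append_conv le_antisym prefix_def prefix_length_le)
  obtain ds where "accepts_from (1, proj (begin_store x h)) ds"
    using run_chain[OF assms(1,2)] assms(3) by blast
  then have "accepts_from (0, proj (pre x g)) ((1, proj (begin_store x h)) # ds)"
    using step_left[OF assms(1)] by (simp add: g accepts_from_def)
  then show ?case by blast
next
  case (Suc k)
  then obtain b zs where h: "h = g @ b # zs"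
    using assms(1) by (metis append_Nil2 diff_self_eq_0 nat.distinct(1) neq_Nil_conv prefix_def)
  then have b: "prefix (g @ [b]) h" and g: "length g < length x"
    using assms(1) by (auto simp: prefix_def)
  have "b \<in> Bs"
    using assms(2) h by auto
  obtain cs where "accepts_from (0, proj (pre x (g @ [b]))) cs"
    using Suc(1)[OF _ b] Suc(2) by (metis Suc_diff_Suc g length_append_singleton nat.inject)
  moreover have "step M (0, proj (pre x g)) (0, proj (pre x (g @ [b])))"
    using step_guess[OF g] \<open>b \<in> Bs\<close> by blast
  ultimately have "accepts_from (0, proj (pre x g)) ((0, proj (pre x (g @ [b]))) # cs)"
    by (simp add: accepts_from_def)
  then show ?case by blast
qed

lemma lang_M: "lang M = {x. \<exists>g. length g = length x \<and> set g \<subseteq> Bs \<and> R x g}"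
  using accepts_from_R[of _ "[]"] R_accepts_from[of _ _ "[]"]
  by (fastforce simp: lang_def accepting_path_iff)

lemma lang_in_UP:
  assumes "\<And>x g g'. length g = length x \<Longrightarrow> length g' = length x \<Longrightarrow> set g \<subseteq> Bs \<Longrightarrow>
      set g' \<subseteq> Bs \<Longrightarrow> R x g \<Longrightarrow> R x g' \<Longrightarrow> g = g'"
  shows "{x. \<exists>g. length g = length x \<and> set g \<subseteq> Bs \<and> R x g} \<in> class_UP"
proof -
  have "\<exists>\<^sub>\<le>\<^sub>1 cs. accepting_path M x cs" for x
    unfolding Uniq_def accepting_path_iff
    using accepts_from_unique[of x "[]"] assms by fastforce
  then show ?thesis
    using poly_time_M lang_M unfolding class_UP_def by blast
qed

end

section \<open>Deterministic machines and their output\<close>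

context compiled
begin

lemma deterministic_M:
  assumes "Bs = {b}"
  shows "deterministic M"
  unfolding deterministic_def
proof (intro allI impI, goal_cases)
  case (1 q rs q1 as1 q2 as2)
  then have 2: "(q, rs, q1, as1) \<in> machine_instrs" "(q, rs, q2, as2) \<in> machine_instrs"
    by (simp_all add: M_def)
  show ?case
  proof (cases "q = 0")
    case True
    then show ?thesis
      using 2 assms instrs_guess[of rs] instrs_left[of rs] by (cases "hd rs = Blank") auto
  next
    case False
    then show ?thesis
      using 2 instrs_line[of q rs] by simp
  qed
qed

lemma guess_chain:
  assumes "set g \<subseteq> Bs" "length g \<le> length x"
  shows "\<exists>cs. cs \<noteq> [] \<and> hd cs = (0, proj (pre x [])) \<and> last cs = (0, proj (pre x g)) \<and>
    successively (step M) cs"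
  using assms
proof (induction g rule: rev_induct)
  case Nil
  show ?case by (intro exI[of _ "[_]"]) auto
next
  case (snoc b g)
  then obtain cs where cs: "cs \<noteq> []" "hd cs = (0, proj (pre x []))" "last cs = (0, proj (pre x g))"
      "successively (step M) cs"
    by auto
  then show ?case
    using snoc.prems step_guess[of g x]
    by (intro exI[of _ "cs @ [(0, proj (pre x (g @ [b])))]"]) (auto simp: successively_append_iff)
qed

text \<open>For computing functions only the final tapes count, so the final state \<open>q\<close>
  may be either of the two exits.\<close>

lemma output_path:
  assumes "set g \<subseteq> Bs" "length g = length x" "exec p (begin_store x g) t s'"
  shows "\<exists>cs q. path M x cs \<and> halted M (last cs) \<and> last cs = (q, proj s')"
proof -
  obtain cs where cs: "cs \<noteq> []" "hd cs = (0, proj (pre x []))" "last cs = (0, proj (pre x g))"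
      "successively (step M) cs"
    using guess_chain assms by (metis order_refl)
  let ?q = "if scanned (s' v) = Blank then csize p + 2 else csize p + 3"
  have "length lines \<le> ?q"
    by simp
  from lsteps_chain[OF exec_final[OF assms(3)] over_begin this]
  obtain ds where ds: "last ((1, proj (begin_store x g)) # ds) = (?q, proj s')"
      "successively (step M) ((1, proj (begin_store x g)) # ds)"
    by blast
  have "path M x (cs @ (1, proj (begin_store x g)) # ds)"
    using cs ds step_left[OF assms(2)] by (auto simp: path_def initial_pre successively_append_iff)
  moreover have "last (cs @ (1, proj (begin_store x g)) # ds) = (?q, proj s')"
    using ds(1) by simp
  ultimately show ?thesis
    using halted_end[OF \<open>length lines \<le> ?q\<close>] by metis
qed

end

section \<open>Programs on stacks\<close>

text \<open>The bottom of a stack lies in cell \<open>0\<close> and the head scans its top; for the empty stack the head is in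
  cell \<open>-1\<close>.\<close>

definition stk :: "symbol list \<Rightarrow> tape" where
  "stk w = (\<lambda>i. if 0 \<le> i \<and> i < int (length w) then rev w ! nat i else Blank, int (length w) - 1)"

definition peek :: "symbol list \<Rightarrow> symbol" where
  "peek w = (case w of [] \<Rightarrow> Blank | a # _ \<Rightarrow> a)"

lemma peek_simps [simp]: "peek [] = Blank" "peek (a # w) = a"
  by (simp_all add: peek_def)

lemma peek_Blank: "Blank \<notin> set w \<Longrightarrow> peek w = Blank \<longleftrightarrow> w = []"
  by (cases w) auto

lemma scanned_stk [simp]: "scanned (stk w) = peek w"
  by (cases w) (auto simp: stk_def nth_append)

lemma stk_keep [simp]: "act (peek w, Stay) (stk w) = stk w"
  by (metis act_scanned_Stay scanned_stk)

lemma stk_push: "act (a, Stay) (act (peek w, MoveRight) (stk w)) = stk (a # w)"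
  by (cases w) (auto simp: stk_def nth_append fun_eq_iff nat_eq_iff)

lemma stk_replace: "act (b, Stay) (stk (a # w)) = stk (b # w)"
  by (auto simp: stk_def nth_append fun_eq_iff nat_eq_iff)

lemma stk_pop: "act (Blank, MoveLeft) (stk (a # w)) = stk w"
  by (auto simp: stk_def nth_append fun_eq_iff)

lemma stk_pop_safe:
  assumes "Blank \<notin> set w"
  shows "act (Blank, if peek w = Blank then Stay else MoveLeft) (stk w) = stk (tl w)"
proof (cases w)
  case Nil
  then show ?thesis
    using stk_keep[of "[]"] by simp
next
  case (Cons a v)
  then show ?thesis
    using assms stk_pop[of a v] by auto
qed

definition skip :: com where
  "skip = Act keep"

definition on :: "nat \<Rightarrow> (reading \<Rightarrow> symbol \<times> move) \<Rightarrow> com" where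
  "on i g = Act (\<lambda>r. (keep r)(i := g r))"

text \<open>An action writes before it moves. Pushing must move first and hence takes two actions,
  whereas erasing the top and moving left is a single one.\<close>

definition push :: "nat \<Rightarrow> symbol \<Rightarrow> com" where
  "push i a = on i (\<lambda>r. (r i, MoveRight)) ;; on i (\<lambda>r. (a, Stay))"

text \<open>With \<open>J = {}\<close> this pops, with a singleton it moves a symbol, with two
  targets it copies. The blank test makes it harmless on an empty stack, which \<open>decode\<close>
  needs for malformed words.\<close>

definition transfer :: "nat \<Rightarrow> nat set \<Rightarrow> com" where
  "transfer i J =
     Act (\<lambda>r. if r i = Blank then keep r else (\<lambda>m. (r m, if m \<in> J then MoveRight else Stay))) ;;
     Act (\<lambda>r. if r i = Blank then keep r else
       (\<lambda>m. if m \<in> J then (r i, Stay) else if m = i then (Blank, MoveLeft) else (r m, Stay)))"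

definition drain :: "nat \<Rightarrow> nat set \<Rightarrow> com" where
  "drain i J = While (\<lambda>r. r i \<noteq> Blank) (transfer i J)"

text \<open>Each drain reverses the word, so the second one restores the order in both
  copies.\<close>

definition duplicate :: "nat \<Rightarrow> nat \<Rightarrow> nat \<Rightarrow> com" where
  "duplicate i j k = drain i {k} ;; drain k {i, j}"

text \<open>A finite automaton that reads and consumes two words in parallel. Its state is the only
  symbol on stack \<open>c\<close>, and the shorter word is continued by blanks.\<close>

definition scan :: "nat \<Rightarrow> nat \<Rightarrow> nat \<Rightarrow> (symbol \<Rightarrow> symbol \<Rightarrow> symbol \<Rightarrow> symbol) \<Rightarrow> com" where
  "scan c i j d = While (\<lambda>r. r i \<noteq> Blank \<or> r j \<noteq> Blank)
     (Act (\<lambda>r m. if m = c then (d (r c) (r i) (r j), Stay)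
       else if m = i \<or> m = j then (Blank, if r m = Blank then Stay else MoveLeft) else (r m, Stay)))"

fun pairfold :: "('a \<Rightarrow> symbol \<Rightarrow> symbol \<Rightarrow> 'a) \<Rightarrow> 'a \<Rightarrow> symbol list \<Rightarrow> symbol list \<Rightarrow> 'a" where
  "pairfold d q [] [] = q"
| "pairfold d q (a # u) [] = pairfold d (d q a Blank) u []"
| "pairfold d q [] (b # v) = pairfold d (d q Blank b) [] v"
| "pairfold d q (a # u) (b # v) = pairfold d (d q a b) u v"

definition fail_if :: "nat \<Rightarrow> (reading \<Rightarrow> bool) \<Rightarrow> com" where
  "fail_if i b = Cond b (push i (Bit True)) skip"

text \<open>A self-delimiting code: \<open>True\<close> announces a further letter and
  \<open>False\<close> ends the word, so codes can be concatenated and followed by padding.\<close>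

fun code :: "bits \<Rightarrow> bits" where
  "code [] = [False]"
| "code (b # w) = True # b # code w"

fun dec :: "bits \<Rightarrow> bits \<times> bits" where
  "dec [] = ([], [])"
| "dec (False # u) = ([], u)"
| "dec [True] = ([], [])"
| "dec (True # b # u) = (b # fst (dec u), snd (dec u))"

text \<open>The first transfer of the loop drops the announcing \<open>True\<close>, the last
  transfer drops the terminating \<open>False\<close>. Letters arrive on \<open>j\<close> in reverse
  order.\<close>

definition decode :: "nat \<Rightarrow> nat \<Rightarrow> com" where
  "decode i j = While (\<lambda>r. r i = Bit True) (transfer i {} ;; transfer i {j}) ;; transfer i {}"

text \<open>The code is built from its end, which fits a stack whose top is the last letter of the
  word. The copy on \<open>k\<close> restores the word afterwards.\<close>

definition encode :: "nat \<Rightarrow> nat \<Rightarrow> nat \<Rightarrow> com" where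
  "encode i j k = push j (Bit False) ;;
     While (\<lambda>r. r i \<noteq> Blank) (transfer i {j, k} ;; push j (Bit True)) ;; drain k {i}"

definition add_length :: "nat \<Rightarrow> nat \<Rightarrow> nat \<Rightarrow> com" where
  "add_length x w k = While (\<lambda>r. r x \<noteq> Blank) (transfer x {k} ;; push w (Bit False)) ;; drain k {x}"

definition mult_length :: "nat \<Rightarrow> nat \<Rightarrow> nat \<Rightarrow> nat \<Rightarrow> com" where
  "mult_length x w k l = drain w {l} ;;
     While (\<lambda>r. r l \<noteq> Blank) (transfer l {} ;; add_length x w k)"

fun push_many :: "nat \<Rightarrow> nat \<Rightarrow> com" where
  "push_many w 0 = skip"
| "push_many w (Suc n) = push w (Bit False) ;; push_many w n"

text \<open>Horner's rule in unary, evaluated at the length of stack \<open>x\<close>;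
  \<open>k\<close> and \<open>l\<close> are auxiliary stacks. Unary is affordable because the value
  is the length of a padding that is written out or read anyway.\<close>

fun horner :: "nat \<Rightarrow> nat \<Rightarrow> nat \<Rightarrow> nat \<Rightarrow> nat list \<Rightarrow> com" where
  "horner x w k l [] = skip"
| "horner x w k l (a # as) = horner x w k l as ;; mult_length x w k l ;; push_many w a"

fun horner_value :: "nat list \<Rightarrow> nat \<Rightarrow> nat" where
  "horner_value [] n = 0"
| "horner_value (a # as) n = a + n * horner_value as n"

fun horner_time :: "nat list \<Rightarrow> nat \<Rightarrow> nat" where
  "horner_time [] n = 1"
| "horner_time (a # as) n = horner_time as n + (horner_value as n * (10 * n + 10) + 2) + (2 * a + 1)"

lemma horner_value_poly: "\<exists>as. \<forall>n. horner_value as n = poly p n" for p :: "nat poly"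
proof (induction p)
  case 0
  then show ?case by (auto intro: exI[of _ "[]"])
next
  case (pCons a p)
  then obtain as where "\<forall>n. horner_value as n = poly p n" by blast
  then show ?case by (auto intro!: exI[of _ "a # as"])
qed

lemma dec_code [simp]: "dec (code w @ r) = (w, r)"
  by (induction w) auto

text \<open>A malformed code is noticed only when the word is exhausted, and then nothing remains. A
  nonempty rest therefore proves that the decoded part was a genuine code.\<close>

lemma dec_complete: "snd (dec u) \<noteq> [] \<Longrightarrow> u = code (fst (dec u)) @ snd (dec u)"
  by (induction u rule: dec.induct) auto

lemma length_code [simp]: "length (code w) = 2 * length w + 1"
  by (induction w) auto

lemma length_dec: "length (fst (dec u)) + length (snd (dec u)) \<le> length u"
  by (induction u rule: dec.induct) auto

lemma com_ok_skip [simp]: "com_ok K G skip"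
  by (simp add: skip_def)

lemma com_ok_push [simp]: "i < K \<Longrightarrow> a \<in> G \<Longrightarrow> com_ok K G (push i a)"
  by (auto simp: push_def on_def acts_ok_def keep_def local_to_def)

lemma com_ok_transfer [simp]: "i < K \<Longrightarrow> Blank \<in> G \<Longrightarrow> com_ok K G (transfer i J)"
  by (auto simp: transfer_def acts_ok_def keep_def local_to_def)

lemma local_to_top [simp]:
  "i < K \<Longrightarrow> local_to K (\<lambda>r. r i = a)"
  "i < K \<Longrightarrow> local_to K (\<lambda>r. r i \<noteq> a)"
  "i < K \<Longrightarrow> local_to K (\<lambda>r. r i \<in> A)"
  "i < K \<Longrightarrow> j < K \<Longrightarrow> local_to K (\<lambda>r. r i \<noteq> a \<or> r j \<noteq> b)"
  by (auto simp: local_to_def)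

lemma com_ok_drain [simp]: "i < K \<Longrightarrow> Blank \<in> G \<Longrightarrow> com_ok K G (drain i J)"
  by (simp add: drain_def)

lemma com_ok_duplicate [simp]: "i < K \<Longrightarrow> k < K \<Longrightarrow> Blank \<in> G \<Longrightarrow> com_ok K G (duplicate i j k)"
  by (simp add: duplicate_def)

lemma com_ok_scan [simp]: "c < K \<Longrightarrow> i < K \<Longrightarrow> j < K \<Longrightarrow> Blank \<in> G \<Longrightarrow> (\<forall>q a b. d q a b \<in> G) \<Longrightarrow>
    com_ok K G (scan c i j d)"
  by (auto simp: scan_def acts_ok_def local_to_def)

lemma com_ok_fail_if [simp]: "i < K \<Longrightarrow> local_to K b \<Longrightarrow> Bit True \<in> G \<Longrightarrow> com_ok K G (fail_if i b)"
  by (simp add: fail_if_def)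

lemma com_ok_decode [simp]: "i < K \<Longrightarrow> Blank \<in> G \<Longrightarrow> com_ok K G (decode i j)"
  by (simp add: decode_def)

lemma com_ok_encode [simp]: "i < K \<Longrightarrow> j < K \<Longrightarrow> k < K \<Longrightarrow> Blank \<in> G \<Longrightarrow> Bit True \<in> G \<Longrightarrow> Bit False \<in> G \<Longrightarrow>
    com_ok K G (encode i j k)"
  by (simp add: encode_def)

lemma com_ok_add_length [simp]: "x < K \<Longrightarrow> w < K \<Longrightarrow> k < K \<Longrightarrow> Blank \<in> G \<Longrightarrow> Bit False \<in> G \<Longrightarrow>
    com_ok K G (add_length x w k)"
  by (simp add: add_length_def)

lemma com_ok_mult_length [simp]: "x < K \<Longrightarrow> w < K \<Longrightarrow> k < K \<Longrightarrow> l < K \<Longrightarrow> Blank \<in> G \<Longrightarrow> Bit False \<in> G \<Longrightarrow>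
    com_ok K G (mult_length x w k l)"
  by (simp add: mult_length_def)

lemma com_ok_push_many [simp]: "w < K \<Longrightarrow> Bit False \<in> G \<Longrightarrow> com_ok K G (push_many w n)"
  by (induction n) auto

lemma com_ok_horner [simp]: "x < K \<Longrightarrow> w < K \<Longrightarrow> k < K \<Longrightarrow> l < K \<Longrightarrow> Blank \<in> G \<Longrightarrow> Bit False \<in> G \<Longrightarrow>
    com_ok K G (horner x w k l as)"
  by (induction as) auto

section \<open>Effect and running time of the stack programs\<close>

type_synonym stacks = "nat \<Rightarrow> symbol list"

text \<open>The tapes in \<open>S\<close> serve for the simulation of machines. Between simulations they are blank, but
  their heads may be anywhere.\<close>

locale stack_programs =
  fixes S :: "nat set"
begin

definition rep :: "stacks \<Rightarrow> store \<Rightarrow> bool" where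
  "rep st s \<longleftrightarrow> (\<forall>i. if i \<in> S then fst (s i) = (\<lambda>_. Blank) else s i = stk (st i) \<and> Blank \<notin> set (st i))"

text \<open>In contrast to \<open>exec\<close>, the time is only an upper bound. All representing
  stores are considered, because the head positions on the tapes in \<open>S\<close> are
  unknown.\<close>

definition runs :: "com \<Rightarrow> stacks \<Rightarrow> nat \<Rightarrow> stacks \<Rightarrow> bool" where
  "runs p st T st' \<longleftrightarrow> (\<forall>s. rep st s \<longrightarrow> (\<exists>t s'. t \<le> T \<and> exec p s t s' \<and> rep st' s'))"

lemma rep_reads: "rep st s \<Longrightarrow> i \<notin> S \<Longrightarrow> reads s i = peek (st i)"
  by (auto simp: rep_def reads_def)

lemma rep_tape: "rep st s \<Longrightarrow> i \<notin> S \<Longrightarrow> s i = stk (st i)"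
  by (auto simp: rep_def)

lemma rep_nonblank: "rep st s \<Longrightarrow> i \<notin> S \<Longrightarrow> a \<in> set (st i) \<Longrightarrow> a \<noteq> Blank"
  by (auto simp: rep_def)

lemma runs_weaken: "runs p st T st' \<Longrightarrow> T \<le> T' \<Longrightarrow> runs p st T' st'"
  unfolding runs_def by (meson order_trans)

lemma runs_seq: "runs p st T st' \<Longrightarrow> runs q st' T' st'' \<Longrightarrow> runs (p ;; q) st (T + T') st''"
  unfolding runs_def by (meson add_mono exec_Seq)

lemma runs_cond_True:
  assumes "\<And>s. rep st s \<Longrightarrow> b (reads s)" "runs p st T st'"
  shows "runs (Cond b p q) st (T + 2) st'"
  using assms unfolding runs_def by (meson add_le_mono1 exec_Cond_True)

lemma runs_cond_False:
  assumes "\<And>s. rep st s \<Longrightarrow> \<not> b (reads s)" "runs q st T st'"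
  shows "runs (Cond b p q) st (T + 1) st'"
  using assms unfolding runs_def by (meson add_le_mono1 exec_Cond_False)

lemma runs_while_False:
  assumes "\<And>s. rep st s \<Longrightarrow> \<not> b (reads s)"
  shows "runs (While b p) st 1 st"
  using assms unfolding runs_def by (meson order_refl exec_While_False)

lemma runs_while_True:
  assumes "\<And>s. rep st s \<Longrightarrow> b (reads s)" "runs p st T st1" "runs (While b p) st1 T' st2"
  shows "runs (While b p) st (T + T' + 2) st2"
  using assms unfolding runs_def by (meson add_le_mono1 add_mono exec_While_True)

lemma runs_Act:
  assumes "\<And>s. rep st s \<Longrightarrow> rep st' (acts (f (reads s)) s)"
  shows "runs (Act f) st 1 st'"
  using assms exec_Act unfolding runs_def by blast

lemma runs_skip: "runs skip st 1 st"
  unfolding skip_def by (rule runs_Act) simp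

lemma runs_Act2:
  assumes "\<And>s. rep st s \<Longrightarrow> \<exists>s1. s1 = acts (f (reads s)) s \<and> rep st' (acts (g (reads s1)) s1)"
  shows "runs (Act f ;; Act g) st 2 st'"
  using assms exec_Seq[OF exec_Act exec_Act] unfolding runs_def
  by (metis one_add_one order_refl)

lemma runs_push:
  assumes "i \<notin> S" "a \<noteq> Blank"
  shows "runs (push i a) st 2 (st(i := a # st i))"
  unfolding push_def on_def
proof (rule runs_Act2)
  fix s assume s: "rep st s"
  show "\<exists>s1. s1 = acts ((keep (reads s))(i := (reads s i, MoveRight))) s \<and>
      rep (st(i := a # st i)) (acts ((keep (reads s1))(i := (a, Stay))) s1)"
    using s assms stk_push[of a "st i"]
    by (auto simp: rep_def acts_def keep_def reads_def)
qed

lemma runs_transfer: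
  assumes "i \<notin> S" "J \<inter> S = {}" "i \<notin> J" "st i = a # w"
  shows "runs (transfer i J) st 2 (\<lambda>m. if m \<in> J then a # st m else if m = i then w else st m)"
  unfolding transfer_def
proof (rule runs_Act2)
  fix s assume s: "rep st s"
  have i: "reads s i = a" and a: "a \<noteq> Blank"
    using rep_reads[OF s assms(1)] rep_nonblank[OF s assms(1)] assms(4) by auto
  define s1 where "s1 = acts (\<lambda>m. (reads s m, if m \<in> J then MoveRight else Stay)) s"
  have 1: "reads s1 i = a"
  proof -
    have "s1 i = s i"
      using assms(3) by (simp add: s1_def acts_def reads_def)
    then show ?thesis
      using i by (simp add: reads_def)
  qed
  have 2: "rep (\<lambda>m. if m \<in> J then a # st m else if m = i then w else st m)
     (acts (\<lambda>m. if m \<in> J then (a, Stay) else if m = i then (Blank, MoveLeft) else (reads s1 m, Stay)) s1)"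
    unfolding rep_def
  proof
    fix m
    have m: "if m \<in> S then fst (s m) = (\<lambda>_. Blank) else s m = stk (st m) \<and> Blank \<notin> set (st m)"
      using s unfolding rep_def by blast
    consider "m \<in> J" "m \<notin> S" | "m = i" "m \<notin> J" "m \<notin> S" | "m \<noteq> i" "m \<notin> J"
      using assms by blast
    then show "if m \<in> S
      then fst (acts (\<lambda>m. if m \<in> J then (a, Stay) else if m = i then (Blank, MoveLeft) else (reads s1 m, Stay)) s1 m) = (\<lambda>_. Blank)
      else acts (\<lambda>m. if m \<in> J then (a, Stay) else if m = i then (Blank, MoveLeft) else (reads s1 m, Stay)) s1 m =
        stk (if m \<in> J then a # st m else if m = i then w else st m) \<and>
        Blank \<notin> set (if m \<in> J then a # st m else if m = i then w else st m)"
    proof cases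
      case 1
      then show ?thesis
        using m a stk_push[of a "st m"] by (simp add: s1_def acts_def reads_def)
    next
      case 2
      then show ?thesis
        using m assms(4) stk_pop[of a w] stk_keep[of "st i"] by (simp add: s1_def acts_def reads_def)
    next
      case 3
      then show ?thesis
        using m by (simp add: s1_def acts_def reads_def)
    qed
  qed
  show "\<exists>s1. s1 = acts (if reads s i = Blank then keep (reads s)
        else (\<lambda>m. (reads s m, if m \<in> J then MoveRight else Stay))) s \<and>
      rep (\<lambda>m. if m \<in> J then a # st m else if m = i then w else st m)
        (acts (if reads s1 i = Blank then keep (reads s1) else
          (\<lambda>m. if m \<in> J then (reads s1 i, Stay) else if m = i then (Blank, MoveLeft)
            else (reads s1 m, Stay))) s1)"
  proof (intro exI[of _ s1] conjI)
    show "s1 = acts (if reads s i = Blank then keep (reads s)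
        else (\<lambda>m. (reads s m, if m \<in> J then MoveRight else Stay))) s"
      by (simp add: s1_def i a)
  qed (use 2 in \<open>unfold 1, simp add: a\<close>)
qed

lemma runs_transfer_Nil:
  assumes "i \<notin> S" "st i = []"
  shows "runs (transfer i J) st 2 st"
  unfolding transfer_def
  by (rule runs_Act2) (simp add: rep_reads[OF _ assms(1)] assms(2))

lemma runs_pop: "i \<notin> S \<Longrightarrow> st i = a # w \<Longrightarrow> runs (transfer i {}) st 2 (st(i := w))"
  using runs_transfer[of i "{}" st a w] by (simp add: fun_upd_def)

lemma runs_move: "i \<notin> S \<Longrightarrow> j \<notin> S \<Longrightarrow> i \<noteq> j \<Longrightarrow> st i = a # w \<Longrightarrow>
    runs (transfer i {j}) st 2 (st(i := w, j := a # st j))"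
  by (rule subst[where P = "runs _ _ _", OF _ runs_transfer[of i "{j}" st a w]]) auto

lemma runs_drain_set:
  assumes "i \<notin> S" "J \<inter> S = {}" "i \<notin> J" "st i = w"
  shows "runs (drain i J) st (4 * length w + 1)
    (\<lambda>m. if m \<in> J then rev w @ st m else if m = i then [] else st m)"
  using assms(4)
proof (induction w arbitrary: st)
  case Nil
  have "(\<lambda>m. if m \<in> J then rev [] @ st m else if m = i then [] else st m) = st"
    using Nil by auto
  then show ?case
    unfolding drain_def using runs_while_False[of st "\<lambda>r. r i \<noteq> Blank"] assms(1) Nil
    by (simp add: rep_reads)
next
  case (Cons a w)
  let ?st = "\<lambda>m. if m \<in> J then a # st m else if m = i then w else st m"
  have *: "\<And>s. rep st s \<Longrightarrow> reads s i \<noteq> Blank"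
    using rep_reads[OF _ assms(1)] rep_nonblank[OF _ assms(1)] Cons.prems
    by (metis list.set_intros(1) peek_simps(2))
  have "?st i = w" using assms(3) by simp
  from runs_while_True[of st "\<lambda>r. r i \<noteq> Blank", OF * runs_transfer[OF assms(1-3), of st a w, OF Cons.prems]
      Cons.IH[of ?st, OF this, unfolded drain_def]]
  show ?case
    unfolding drain_def
    by (rule runs_weaken[THEN subst[where P = "runs _ _ _", rotated]]) (use assms(3) in auto)
qed

lemma runs_drain: "i \<notin> S \<Longrightarrow> j \<notin> S \<Longrightarrow> i \<noteq> j \<Longrightarrow> st i = w \<Longrightarrow>
    runs (drain i {j}) st (4 * length w + 1) (st(i := [], j := rev w @ st j))"
  by (rule subst[where P = "runs _ _ _", OF _ runs_drain_set[of i "{j}" st w]]) auto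

lemma runs_duplicate:
  assumes "i \<notin> S" "j \<notin> S" "k \<notin> S" "distinct [i, j, k]" "st k = []" "st i = w"
  shows "runs (duplicate i j k) st (8 * length w + 2) (st(j := w @ st j))"
proof -
  have 1: "runs (drain i {k}) st (4 * length w + 1) (st(i := [], k := rev w))"
    using runs_drain[of i k st w] assms by simp
  have "runs (drain k {i, j}) (st(i := [], k := rev w)) (4 * length (rev w) + 1) (st(j := w @ st j))"
    by (rule subst[where P = "runs _ _ _", OF _ runs_drain_set[of k "{i, j}"]])
      (use assms in \<open>auto simp: fun_eq_iff\<close>)
  from runs_seq[OF 1 this] show ?thesis
    unfolding duplicate_def by (rule runs_weaken) simp
qed

lemma runs_scan:
  assumes "c \<notin> S" "i \<notin> S" "j \<notin> S" "distinct [c, i, j]" "\<And>q a b. d q a b \<noteq> Blank"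
    "st c = [q]" "st i = u" "st j = w"
  shows "runs (scan c i j d) st (3 * (length u + length w) + 1)
    (st(c := [pairfold d q u w], i := [], j := []))"
  using assms(6-)
proof (induction "length u + length w" arbitrary: st q u w rule: less_induct)
  case less
  let ?b = "\<lambda>r :: reading. r i \<noteq> Blank \<or> r j \<noteq> Blank"
  show ?case
  proof (cases "u = [] \<and> w = []")
    case True
    have "st(c := [pairfold d q u w], i := [], j := []) = st"
      using True less.prems by auto
    then show ?thesis
      using runs_while_False[of st ?b] True less.prems assms(1-3)
      unfolding scan_def by (simp add: rep_reads)
  next
    case False
    let ?st = "st(c := [d q (peek u) (peek w)], i := tl u, j := tl w)"
    have 1: "pairfold d (d q (peek u) (peek w)) (tl u) (tl w) = pairfold d q u w"
      using False by (cases u; cases w) auto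
    have nb: "Blank \<notin> set u" "Blank \<notin> set w" if "rep st s" for s
      using rep_nonblank[OF that] assms(2,3) less.prems by metis+
    have 2: "?b (reads s)" if "rep st s" for s
      using False nb[OF that] less.prems assms(2,3) by (simp add: rep_reads[OF that] peek_Blank)
    have body: "runs (Act (\<lambda>r m. if m = c then (d (r c) (r i) (r j), Stay)
       else if m = i \<or> m = j then (Blank, if r m = Blank then Stay else MoveLeft)
       else (r m, Stay))) st 1 ?st"
    proof (rule runs_Act)
      fix s assume s: "rep st s"
      have r: "reads s c = q" "reads s i = peek u" "reads s j = peek w"
        using s less.prems assms(1-3) by (simp_all add: rep_reads)
      have pop: "act (Blank, if peek u = Blank then Stay else MoveLeft) (stk u) = stk (tl u)"
        "act (Blank, if peek w = Blank then Stay else MoveLeft) (stk w) = stk (tl w)"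
        using stk_pop_safe nb[OF s] by blast+
      have tl: "Blank \<notin> set (tl u)" "Blank \<notin> set (tl w)"
        using nb[OF s] by (cases u; cases w; simp)+
      show "rep ?st (acts (\<lambda>m. if m = c then (d (reads s c) (reads s i) (reads s j), Stay)
         else if m = i \<or> m = j then (Blank, if reads s m = Blank then Stay else MoveLeft)
         else (reads s m, Stay)) s)"
        unfolding rep_def
      proof
        fix m
        have m: "if m \<in> S then fst (s m) = (\<lambda>_. Blank) else s m = stk (st m) \<and> Blank \<notin> set (st m)"
          using s unfolding rep_def by blast
        consider "m = c" | "m = i" | "m = j" | "m \<noteq> c" "m \<noteq> i" "m \<noteq> j" by blast
        then show "if m \<in> S then fst (acts (\<lambda>m. if m = c then (d (reads s c) (reads s i) (reads s j), Stay)
           else if m = i \<or> m = j then (Blank, if reads s m = Blank then Stay else MoveLeft)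
           else (reads s m, Stay)) s m) = (\<lambda>_. Blank)
           else acts (\<lambda>m. if m = c then (d (reads s c) (reads s i) (reads s j), Stay)
           else if m = i \<or> m = j then (Blank, if reads s m = Blank then Stay else MoveLeft)
           else (reads s m, Stay)) s m = stk (?st m) \<and> Blank \<notin> set (?st m)"
        proof cases
          case 1
          then show ?thesis
            using m r assms(1,4,5) less.prems stk_replace[of _ q "[]"] assms(5)[symmetric] by (simp add: acts_def)
        next
          case 2
          then show ?thesis
            using m r assms(2,4) less.prems pop tl by (simp add: acts_def)
        next
          case 3
          then show ?thesis
            using m r assms(3,4) less.prems pop tl by (simp add: acts_def)
        next
          case 4
          then show ?thesis
            using m by (simp add: acts_def reads_def)
        qed
      qed
    qed
    have "length (tl u) + length (tl w) < length u + length w"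
      using False by (cases u; cases w) auto
    from less.hyps[OF this, of ?st "d q (peek u) (peek w)"]
    have "runs (scan c i j d) ?st (3 * (length (tl u) + length (tl w)) + 1)
        (?st(c := [pairfold d q u w], i := [], j := []))"
      using assms(4) by (simp add: 1)
    from runs_while_True[of st ?b, OF 2 body this[unfolded scan_def]]
    have "runs (scan c i j d) st (1 + (3 * (length (tl u) + length (tl w)) + 1) + 2)
        (?st(c := [pairfold d q u w], i := [], j := []))"
      unfolding scan_def .
    moreover have "?st(c := [pairfold d q u w], i := [], j := []) =
        st(c := [pairfold d q u w], i := [], j := [])"
      using assms(4) by (auto simp: fun_eq_iff)
    moreover have "1 + (3 * (length (tl u) + length (tl w)) + 1) + 2 \<le> 3 * (length u + length w) + 1"
      using False by (cases u; cases w) auto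
    ultimately show ?thesis
      using runs_weaken by simp
  qed
qed

lemma runs_fail_if:
  assumes "i \<notin> S" "\<And>s. rep st s \<Longrightarrow> b (reads s) \<longleftrightarrow> c"
  shows "runs (fail_if i b) st 4 (if c then st(i := Bit True # st i) else st)"
proof (cases c)
  case True
  then show ?thesis
    unfolding fail_if_def using runs_cond_True[of st b, OF _ runs_push[OF assms(1), of "Bit True"]] assms(2)
    by simp
next
  case False
  then have "runs (fail_if i b) st 2 st"
    unfolding fail_if_def using runs_cond_False[of st b, OF _ runs_skip] assms(2) by (simp add: numeral_2_eq_2)
  then show ?thesis
    using False runs_weaken[of _ st 2] by simp
qed

lemma runs_decode:
  assumes "i \<notin> S" "j \<notin> S" "i \<noteq> j" "st i = map Bit u"
  shows "runs (decode i j) st (6 * length u + 3)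
    (st(i := map Bit (snd (dec u)), j := rev (map Bit (fst (dec u))) @ st j))"
proof -
  let ?b = "\<lambda>r :: reading. r i = Bit True" and ?p = "transfer i {} ;; transfer i {j}"
  have stop: "runs (While ?b ?p ;; transfer i {}) st 3 (st(i := map Bit (tl u)))"
    if "st i = map Bit u" "u = [] \<or> \<not> hd u" for st u
  proof -
    have "runs (While ?b ?p) st 1 st"
      by (rule runs_while_False) (use that assms(1) in \<open>cases u; auto simp: rep_reads\<close>)
    moreover have "runs (transfer i {}) st 2 (st(i := map Bit (tl u)))"
      using runs_pop[OF assms(1), of st] runs_transfer_Nil[OF assms(1), of st] that(1)
      by (cases u) (auto simp: fun_upd_idem)
    ultimately show ?thesis
      using runs_seq by fastforce
  qed
  \<comment> \<open>One iteration is put in front of the whole program, including the final pop. In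
    this form the induction can follow the recursion of \<open>dec\<close>, whose equations account
    for the terminator as well.\<close>
  have seq: "runs (While ?b ?p ;; transfer i {}) st (4 + T + 2) st''"
    if body: "runs ?p st 4 st'" and rest: "runs (While ?b ?p ;; transfer i {}) st' T st''"
      and b: "\<And>s. rep st s \<Longrightarrow> ?b (reads s)" for st st' st'' T
    unfolding runs_def
  proof (intro allI impI)
    fix s assume s: "rep st s"
    obtain t1 s1 where 1: "t1 \<le> 4" "exec ?p s t1 s1" "rep st' s1"
      using body s unfolding runs_def by blast
    obtain t2 s2 where 2: "t2 \<le> T" "exec (While ?b ?p ;; transfer i {}) s1 t2 s2" "rep st'' s2"
      using rest 1(3) unfolding runs_def by blast
    from 2(2) obtain t3 t4 s3 where 3: "t2 = t3 + t4" "exec (While ?b ?p) s1 t3 s3" "exec (transfer i {}) s3 t4 s2"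
      by (auto elim: exec.cases)
    show "\<exists>t s'. t \<le> 4 + T + 2 \<and> exec (While ?b ?p ;; transfer i {}) s t s' \<and> rep st'' s'"
      using exec_Seq[OF exec_While_True[of ?b, OF b[OF s] 1(2) 3(2)] 3(3)] 1(1) 2(1,3) 3(1)
      by (intro exI[of _ "t1 + t3 + 2 + t4"] exI[of _ s2]) auto
  qed
  show ?thesis
    using assms(4) unfolding decode_def
  proof (induction u arbitrary: st rule: dec.induct)
    case 1
    have "st(i := map Bit (snd (dec [])), j := rev (map Bit (fst (dec []))) @ st j) = st(i := map Bit [])"
      using assms(3) 1 by (auto simp: fun_eq_iff)
    then show ?case using stop[of st "[]"] 1 by (simp del: fun_upd_apply)
  next
    case (2 u)
    have "st(i := map Bit (snd (dec (False # u))), j := rev (map Bit (fst (dec (False # u)))) @ st j) =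
        st(i := map Bit u)"
      using assms(3) by (auto simp: fun_eq_iff)
    then show ?case using runs_weaken[OF stop[of st "False # u"]] 2 by (simp del: fun_upd_apply)
  next
    case 3
    have "runs ?p st (2 + 2) (st(i := []))"
      using runs_seq[OF runs_pop[OF assms(1), of st, OF 3[unfolded list.map]] runs_transfer_Nil[OF assms(1)]] by simp
    then have "runs ?p st 4 (st(i := []))"
      by simp
    moreover have "runs (While ?b ?p ;; transfer i {}) (st(i := [])) 3 (st(i := []))"
      using stop[of "st(i := [])" "[]"] by simp
    moreover have "?b (reads s)" if "rep st s" for s
      using 3 by (simp add: rep_reads[OF that assms(1)])
    ultimately have "runs (While ?b ?p ;; transfer i {}) st (4 + 3 + 2) (st(i := []))"
      by (rule seq)
    moreover have "st(i := map Bit (snd (dec [True])), j := rev (map Bit (fst (dec [True]))) @ st j) = st(i := [])"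
      using assms(3) by (auto simp: fun_eq_iff)
    ultimately show ?case
      by (simp del: fun_upd_apply)
  next
    case (4 b u)
    let ?st = "st(i := map Bit u, j := Bit b # st j)"
    have "runs ?p st (2 + 2) ?st"
      using runs_seq[OF runs_pop[OF assms(1), of st, OF 4(3)[unfolded list.map]] runs_move[OF assms(1-3)], of "Bit b" "map Bit u"]
        assms(3) by (simp add: fun_upd_twist)
    then have "runs ?p st 4 ?st"
      by simp
    moreover have "?st i = map Bit u"
      using assms(3) by simp
    note 4(2)[of ?st, OF this]
    moreover have "?b (reads s)" if "rep st s" for s
      using 4(3) by (simp add: rep_reads[OF that assms(1)])
    ultimately have "runs (While ?b ?p ;; transfer i {}) st (4 + (6 * length u + 3) + 2)
        (?st(i := map Bit (snd (dec u)), j := rev (map Bit (fst (dec u))) @ ?st j))"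
      by (rule seq)
    moreover have "?st(i := map Bit (snd (dec u)), j := rev (map Bit (fst (dec u))) @ ?st j) =
        st(i := map Bit (snd (dec (True # b # u))), j := rev (map Bit (fst (dec (True # b # u)))) @ st j)"
      using assms(3) by (auto simp: fun_eq_iff)
    ultimately show ?case
      using runs_weaken by (simp del: fun_upd_apply)
  qed
qed

lemma runs_encode_loop:
  assumes "i \<notin> S" "j \<notin> S" "k \<notin> S" "distinct [i, j, k]" "st i = w"
  shows "runs (While (\<lambda>r. r i \<noteq> Blank) (transfer i {j, k} ;; push j (Bit True))) st (6 * length w + 1)
    (st(i := [], j := concat (map (\<lambda>a. [Bit True, a]) (rev w)) @ st j, k := rev w @ st k))"
  using assms(5)
proof (induction w arbitrary: st)
  case Nil
  have *: "st(i := [], j := concat (map (\<lambda>a. [Bit True, a]) (rev [])) @ st j, k := rev [] @ st k) = st"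
    using Nil by (auto simp: fun_eq_iff)
  show ?case unfolding *
    using runs_while_False[of st "\<lambda>r. r i \<noteq> Blank"] assms(1) Nil by (simp add: rep_reads)
next
  case (Cons a w)
  let ?st1 = "\<lambda>m. if m \<in> {j, k} then a # st m else if m = i then w else st m"
  let ?st2 = "?st1(j := Bit True # ?st1 j)"
  have *: "reads s i \<noteq> Blank" if "rep st s" for s
    using rep_reads[OF that assms(1)] rep_nonblank[OF that assms(1)] Cons.prems by force
  have 1: "runs (transfer i {j, k} ;; push j (Bit True)) st (2 + 2) ?st2"
    by (rule runs_seq[OF runs_transfer runs_push]) (use assms Cons.prems in auto)
  have 2: "?st2 i = w"
    using assms(4) by simp
  have 3: "?st2(i := [], j := concat (map (\<lambda>a. [Bit True, a]) (rev w)) @ ?st2 j, k := rev w @ ?st2 k) =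
    st(i := [], j := concat (map (\<lambda>a. [Bit True, a]) (rev (a # w))) @ st j, k := rev (a # w) @ st k)"
    using assms(4) by (auto simp: fun_eq_iff)
  from runs_while_True[of st "\<lambda>r. r i \<noteq> Blank", OF * 1 Cons.IH[of ?st2, OF 2, unfolded 3]]
  show ?case
    by (rule runs_weaken) auto
qed

lemma concat_code: "concat (map (\<lambda>a. [Bit True, a]) (map Bit x)) @ [Bit False] = map Bit (code x)"
  by (induction x) auto

lemma runs_encode:
  assumes "i \<notin> S" "j \<notin> S" "k \<notin> S" "distinct [i, j, k]" "st i = map Bit (rev x)" "st k = []"
  shows "runs (encode i j k) st (10 * length x + 4) (st(j := map Bit (code x) @ st j))"
proof -
  let ?st1 = "st(j := Bit False # st j)"
  let ?w = "concat (map (\<lambda>a. [Bit True, a]) (map Bit x)) @ Bit False # st j"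
  have w: "?w = map Bit (code x) @ st j"
    using concat_code[of x] by (metis append_Cons append_Nil append_assoc)
  have 1: "runs (push j (Bit False)) st 2 ?st1"
    using assms by (intro runs_push) auto
  have 2: "runs (While (\<lambda>r. r i \<noteq> Blank) (transfer i {j, k} ;; push j (Bit True))) ?st1
      (6 * length (map Bit (rev x)) + 1)
      (?st1(i := [], j := ?w, k := map Bit x))"
    using runs_encode_loop[OF assms(1-4), of ?st1 "map Bit (rev x)"] assms concat_code[of x]
    by (simp add: rev_map)
  have 3: "runs (drain k {i}) (?st1(i := [], j := ?w, k := map Bit x)) (4 * length (map Bit x) + 1)
      (st(j := map Bit (code x) @ st j))"
    by (rule subst[where P = "runs _ _ _", OF _ runs_drain])
      (use assms in \<open>auto simp: fun_eq_iff rev_map concat_code[simplified]\<close>)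
  show ?thesis
    unfolding encode_def by (rule runs_weaken[OF runs_seq[OF 1 runs_seq[OF 2 3]]]) simp
qed

lemma runs_add_length:
  assumes "x \<notin> S" "w \<notin> S" "k \<notin> S" "distinct [x, w, k]" "st k = []" "length (st x) = n"
  shows "runs (add_length x w k) st (10 * n + 2) (st(w := replicate n (Bit False) @ st w))"
proof -
  have loop: "runs (While (\<lambda>r. r x \<noteq> Blank) (transfer x {k} ;; push w (Bit False))) st (6 * length u + 1)
      (st(x := [], k := rev u @ st k, w := replicate (length u) (Bit False) @ st w))"
    if "st x = u" for u st
    using that
  proof (induction u arbitrary: st)
    case Nil
    have *: "st(x := [], k := rev [] @ st k, w := replicate (length ([] :: symbol list)) (Bit False) @ st w) = st"
      using Nil by (auto simp: fun_eq_iff)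
    show ?case unfolding *
      using runs_while_False[of st "\<lambda>r. r x \<noteq> Blank"] assms(1) Nil by (simp add: rep_reads)
  next
    case (Cons a u)
    let ?st1 = "st(x := u, k := a # st k)"
    let ?st2 = "?st1(w := Bit False # ?st1 w)"
    have *: "reads s x \<noteq> Blank" if "rep st s" for s
      using rep_reads[OF that assms(1)] rep_nonblank[OF that assms(1)] Cons.prems by force
    have 1: "runs (transfer x {k} ;; push w (Bit False)) st (2 + 2) ?st2"
      by (rule runs_seq[OF runs_move runs_push]) (use assms Cons.prems in auto)
    have 2: "?st2 x = u"
      using assms(4) by simp
    have 3: "?st2(x := [], k := rev u @ ?st2 k, w := replicate (length u) (Bit False) @ ?st2 w) =
      st(x := [], k := rev (a # u) @ st k, w := replicate (length (a # u)) (Bit False) @ st w)"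
      using assms(4) by (auto simp: fun_eq_iff replicate_app_Cons_same)
    from runs_while_True[of st "\<lambda>r. r x \<noteq> Blank", OF * 1 Cons.IH[of ?st2, OF 2, unfolded 3]]
    show ?case
      by (rule runs_weaken) auto
  qed
  have "runs (drain k {x}) (st(x := [], k := rev (st x) @ st k, w := replicate n (Bit False) @ st w))
      (4 * length (rev (st x)) + 1) (st(w := replicate n (Bit False) @ st w))"
    by (rule subst[where P = "runs _ _ _", OF _ runs_drain])
      (use assms in \<open>auto simp: fun_eq_iff\<close>)
  from runs_seq[OF loop[of st "st x", OF refl, unfolded assms(6)] this] show ?thesis
    unfolding add_length_def by (rule runs_weaken) (simp add: assms(6))
qed

lemma runs_mult_length:
  assumes "x \<notin> S" "w \<notin> S" "k \<notin> S" "l \<notin> S" "distinct [x, w, k, l]" "st k = []" "st l = []"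
    "length (st x) = n" "st w = replicate m (Bit False)"
  shows "runs (mult_length x w k l) st (m * (10 * n + 10) + 2) (st(w := replicate (n * m) (Bit False)))"
proof -
  have loop: "runs (While (\<lambda>r. r l \<noteq> Blank) (transfer l {} ;; add_length x w k)) st (m * (10 * n + 6) + 1)
      (st(l := [], w := replicate (n * m) (Bit False) @ st w))"
    if "st l = replicate m (Bit False)" "st k = []" "length (st x) = n" for m st
    using that
  proof (induction m arbitrary: st)
    case 0
    have *: "st(l := [], w := replicate (n * 0) (Bit False) @ st w) = st"
      using 0 by (auto simp: fun_eq_iff)
    show ?case unfolding *
      using runs_while_False[of st "\<lambda>r. r l \<noteq> Blank"] assms(4) 0 by (simp add: rep_reads)
  next
    case (Suc m)
    let ?st1 = "st(l := replicate m (Bit False))"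
    let ?st2 = "?st1(w := replicate n (Bit False) @ ?st1 w)"
    have *: "reads s l \<noteq> Blank" if "rep st s" for s
      using rep_reads[OF that assms(4)] Suc.prems by simp
    have 1: "runs (transfer l {} ;; add_length x w k) st (2 + (10 * n + 2)) ?st2"
      by (rule runs_seq[OF runs_pop runs_add_length]) (use assms Suc.prems in auto)
    have 2: "?st2 l = replicate m (Bit False)" "?st2 k = []" "length (?st2 x) = n"
      using assms(5) Suc.prems by simp_all
    have 3: "?st2(l := [], w := replicate (n * m) (Bit False) @ ?st2 w) =
      st(l := [], w := replicate (n * Suc m) (Bit False) @ st w)"
      using assms(5) by (auto simp: fun_eq_iff replicate_add[symmetric] add.commute simp flip: append_assoc)
    from runs_while_True[of st "\<lambda>r. r l \<noteq> Blank", OF * 1 Suc.IH[of ?st2, OF 2, unfolded 3]]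
    show ?case
      by (rule runs_weaken) auto
  qed
  have 1: "runs (drain w {l}) st (4 * m + 1) (st(w := [], l := replicate m (Bit False)))"
    using runs_drain[of w l st "replicate m (Bit False)"] assms by auto
  have 2: "runs (While (\<lambda>r. r l \<noteq> Blank) (transfer l {} ;; add_length x w k))
      (st(w := [], l := replicate m (Bit False))) (m * (10 * n + 6) + 1)
      (st(w := replicate (n * m) (Bit False)))"
    by (rule subst[where P = "runs _ _ _", OF _ loop]) (use assms in \<open>auto simp: fun_eq_iff\<close>)
  from runs_seq[OF 1 2] show ?thesis
    unfolding mult_length_def by (rule runs_weaken) (simp add: algebra_simps)
qed

lemma runs_push_many:
  assumes "w \<notin> S"
  shows "runs (push_many w n) st (2 * n + 1) (st(w := replicate n (Bit False) @ st w))"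
proof (induction n arbitrary: st)
  case 0
  then show ?case using runs_skip by simp
next
  case (Suc n)
  have "runs (push_many w (Suc n)) st (2 + (2 * n + 1))
      (st(w := Bit False # st w, w := replicate n (Bit False) @ (st(w := Bit False # st w)) w))"
    unfolding push_many.simps by (rule runs_seq[OF runs_push Suc.IH]) (use assms in auto)
  moreover have "st(w := Bit False # st w, w := replicate n (Bit False) @ (st(w := Bit False # st w)) w) =
      st(w := replicate (Suc n) (Bit False) @ st w)"
    by (auto simp: fun_eq_iff replicate_app_Cons_same)
  ultimately show ?case
    by (simp del: fun_upd_apply replicate.simps)
qed

lemma runs_horner:
  assumes "x \<notin> S" "w \<notin> S" "k \<notin> S" "l \<notin> S" "distinct [x, w, k, l]" "st k = []" "st l = []"
    "length (st x) = n" "st w = []"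
  shows "runs (horner x w k l as) st (horner_time as n)
    (st(w := replicate (horner_value as n) (Bit False)))"
proof (induction as)
  case Nil
  then show ?case using runs_skip[of st] assms by (simp add: fun_upd_idem)
next
  case (Cons a as)
  let ?h = "horner_value as n"
  have "runs (mult_length x w k l) (st(w := replicate ?h (Bit False))) (?h * (10 * n + 10) + 2)
      (st(w := replicate ?h (Bit False), w := replicate (n * ?h) (Bit False)))"
    by (rule runs_mult_length) (use assms in auto)
  then have 1: "runs (mult_length x w k l) (st(w := replicate ?h (Bit False))) (?h * (10 * n + 10) + 2)
      (st(w := replicate (n * ?h) (Bit False)))"
    by simp
  have 2: "runs (push_many w a) (st(w := replicate (n * ?h) (Bit False))) (2 * a + 1)
      (st(w := replicate (horner_value (a # as) n) (Bit False)))"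
    using runs_push_many[OF assms(2), of a "st(w := replicate (n * ?h) (Bit False))"]
    by (simp add: replicate_add)
  from runs_seq[OF Cons.IH runs_seq[OF 1 2]] show ?case
    by (rule runs_weaken[THEN subst[where P = "\<lambda>p. runs p _ _ _", rotated]]) auto
qed

end

section \<open>Simulation of machines\<close>

lemma acts_upd: "acts ((keep (reads s))(i := x)) s = s(i := act x (s i))"
  by (auto simp: acts_def keep_def reads_def)

lemma acts_upd2: "i \<noteq> j \<Longrightarrow>
  acts ((keep (reads s))(i := x, j := y)) s = s(i := act x (s i), j := act y (s j))"
  by (auto simp: acts_def keep_def reads_def)

lemma exec_on: "exec (on i g) s 1 (s(i := act (g (reads s)) (s i)))"
  unfolding on_def using exec_Act[of "\<lambda>r. (keep r)(i := g r)" s] by (simp add: acts_upd)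

lemma exec_While_Act:
  assumes "b (reads s)" "exec (While b (Act f)) (acts (f (reads s)) s) t s'"
  shows "exec (While b (Act f)) s (t + 3) s'"
  using exec_While_True[OF assms(1) exec_Act assms(2)] by (simp add: eval_nat_numeral)

lemma exec_While_Act2:
  assumes "b (reads s)" "s1 = acts (f (reads s)) s"
    "exec (While b (Act f ;; Act g)) (acts (g (reads s1)) s1) t s'"
  shows "exec (While b (Act f ;; Act g)) s (t + 4) s'"
  using exec_While_True[OF assms(1) exec_Seq[OF exec_Act exec_Act] assms(3)[unfolded assms(2)]]
  by (simp add: eval_nat_numeral)

text \<open>A simulated machine writes \<open>Mark b\<close> instead of a blank, so that the visited cells can be
  recognized when the tape is wiped.\<close>

definition enc_blank :: "nat \<Rightarrow> symbol \<Rightarrow> symbol" where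
  "enc_blank b a = (if a = Blank then Mark b else a)"

definition dec_blank :: "nat \<Rightarrow> symbol \<Rightarrow> symbol" where
  "dec_blank b a = (if a = Mark b then Blank else a)"

lemma enc_blank_neq [simp]: "enc_blank b a \<noteq> Blank"
  by (simp add: enc_blank_def)

lemma dec_enc: "a \<noteq> Mark b \<Longrightarrow> dec_blank b (enc_blank b a) = a"
  by (simp add: enc_blank_def dec_blank_def)

lemma enc_dec: "enc_blank b (dec_blank b a) = enc_blank b a"
  by (simp add: enc_blank_def dec_blank_def)

lemma dec_neq_Mark: "dec_blank b a \<noteq> Mark b"
  by (simp add: dec_blank_def)

text \<open>Cells are compared relative to the two heads, since the simulating head starts wherever
  the previous wiping left it.\<close>

fun tape_rel :: "nat \<Rightarrow> tape \<Rightarrow> tape \<Rightarrow> bool" where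
  "tape_rel b (t, h) (t', h') \<longleftrightarrow> (\<forall>j. t (h + j) = dec_blank b (t' (h' + j)))"

text \<open>The nonblank cells form an interval, and the head is inside it or next to it. From such
  a position a program can find and erase everything without knowing the bounds.\<close>

fun segment :: "nat \<Rightarrow> tape \<Rightarrow> bool" where
  "segment n (t, h) \<longleftrightarrow> (\<exists>a c. a \<le> c \<and> c - a \<le> int n \<and> a - 1 \<le> h \<and> h \<le> c \<and> (\<forall>j. t j \<noteq> Blank \<longleftrightarrow> a \<le> j \<and> j < c))"

lemma tape_rel_scanned: "tape_rel b t t' \<Longrightarrow> scanned t = dec_blank b (scanned t')"
  by (cases t; cases t') (auto dest: spec[of _ 0])

lemma tape_rel_act:
  assumes "tape_rel b t t'" "a \<noteq> Mark b"
  shows "tape_rel b (act (a, m) t) (act (enc_blank b a, m) t')"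
proof (cases t; cases t')
  fix u h u' h' assume [simp]: "t = (u, h)" "t' = (u', h')"
  have "(u(h := a)) (h + j) = dec_blank b ((u'(h' := enc_blank b a)) (h' + j))" for j
    using assms by (simp add: dec_enc)
  from this[of "offset m + _"] show ?thesis
    by (simp add: add.assoc)
qed

lemma tape_rel_move:
  assumes "tape_rel b t t'"
  shows "tape_rel b (fst t, snd t + offset m) (act (enc_blank b (scanned t'), m) t')"
proof -
  have "scanned t \<noteq> Mark b" "enc_blank b (scanned t') = enc_blank b (scanned t)"
    using tape_rel_scanned[OF assms] by (simp_all add: dec_neq_Mark enc_dec)
  with tape_rel_act[OF assms, of "scanned t" m] show ?thesis
    by (cases t) simp
qed

text \<open>As the written symbol is not blank, no hole can arise, and the interval grows only if
  the head stood next to it. A simulated machine satisfies this because it writes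
  \<open>enc_blank b a\<close>.\<close>

lemma segment_act:
  assumes "segment n t" "a \<noteq> Blank"
  shows "segment (n + 1) (act (a, m) t)"
proof (cases t)
  case (Pair u h)
  then obtain p q where pq: "p \<le> q" "q - p \<le> int n" "p - 1 \<le> h" "h \<le> q"
    and u: "\<And>j. u j \<noteq> Blank \<longleftrightarrow> p \<le> j \<and> j < q"
    using assms(1) by auto
  have "-1 \<le> offset m" "offset m \<le> 1"
    by (cases m; simp)+
  moreover have "(u(h := a)) j \<noteq> Blank \<longleftrightarrow> min p h \<le> j \<and> j < max q (h + 1)" for j
    using u[of j] pq assms(2) by (cases "j = h") (simp, simp, linarith)
  ultimately have "segment (n + 1) (u(h := a), h + offset m)"
    unfolding segment.simps using pq
    by (intro exI[of _ "min p h"] exI[of _ "max q (h + 1)"] conjI allI) linarith+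
  then show ?thesis
    using Pair by simp
qed

lemma segment_mono: "segment n t \<Longrightarrow> n \<le> m \<Longrightarrow> segment m t"
proof (cases t)
  case (Pair u h)
  assume "segment n t" "n \<le> m"
  then obtain p q where "p \<le> q" "q - p \<le> int n" "p - 1 \<le> h" "h \<le> q"
      "\<forall>j. u j \<noteq> Blank \<longleftrightarrow> p \<le> j \<and> j < q"
    using Pair by auto
  moreover have "q - p \<le> int m"
    using calculation(2) \<open>n \<le> m\<close> by simp
  ultimately show ?thesis
    unfolding Pair segment.simps by blast
qed

text \<open>The initial \<open>Mark 0\<close> puts the head onto the nonblank interval even if it
  stood to its left. Then the right end is found, and the interval is erased from there.\<close>

definition wipe :: "nat \<Rightarrow> com" where
  "wipe i = on i (\<lambda>r. (Mark 0, Stay)) ;;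
     While (\<lambda>r. r i \<noteq> Blank) (on i (\<lambda>r. (r i, MoveRight))) ;;
     on i (\<lambda>r. (Blank, MoveLeft)) ;;
     While (\<lambda>r. r i \<noteq> Blank) (on i (\<lambda>r. (Blank, MoveLeft)))"

fun wipe_all :: "nat list \<Rightarrow> com" where
  "wipe_all [] = skip"
| "wipe_all (i # is) = wipe i ;; wipe_all is"

lemma exec_run_right:
  assumes "\<forall>j. t j \<noteq> Blank \<longleftrightarrow> a \<le> j \<and> j < c" "a \<le> h" "h \<le> c" "s i = (t, h)"
  shows "exec (While (\<lambda>r. r i \<noteq> Blank) (on i (\<lambda>r. (r i, MoveRight)))) s (3 * nat (c - h) + 1)
    (s(i := (t, c)))"
  using assms(2-)
proof (induction "nat (c - h)" arbitrary: h s)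
  case 0
  then have "h = c" by simp
  moreover have "reads s i = Blank"
    using 0 assms(1) by (auto simp: reads_def)
  ultimately show ?case
    using exec_While_False[of "\<lambda>r. r i \<noteq> Blank" s] 0 by (simp add: fun_upd_idem)
next
  case (Suc n)
  have r: "reads s i = t h" "t h \<noteq> Blank"
    using Suc assms(1) by (auto simp: reads_def)
  let ?s = "s(i := (t, h + 1))"
  have eq: "acts ((keep (reads s))(i := (reads s i, MoveRight))) s = ?s"
    unfolding acts_upd using r Suc by simp
  have "exec (While (\<lambda>r. r i \<noteq> Blank) (on i (\<lambda>r. (r i, MoveRight)))) ?s (3 * nat (c - (h + 1)) + 1)
      (?s(i := (t, c)))"
    by (rule Suc(1)) (use Suc in auto)
  then have "exec (While (\<lambda>r. r i \<noteq> Blank) (on i (\<lambda>r. (r i, MoveRight)))) s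
      (3 * nat (c - (h + 1)) + 1 + 3) (?s(i := (t, c)))"
    unfolding on_def by (intro exec_While_Act) (use r eq in auto)
  moreover have "3 * nat (c - (h + 1)) + 1 + 3 = 3 * nat (c - h) + 1"
    using Suc by simp
  ultimately show ?case
    by (metis fun_upd_upd)
qed

lemma exec_erase_left:
  assumes "\<forall>j. t j \<noteq> Blank \<longleftrightarrow> a \<le> j \<and> j < c" "a \<le> c" "s i = (t, c - 1)"
  shows "exec (While (\<lambda>r. r i \<noteq> Blank) (on i (\<lambda>r. (Blank, MoveLeft)))) s (3 * nat (c - a) + 1)
    (s(i := (\<lambda>_. Blank, a - 1)))"
  using assms
proof (induction "nat (c - a)" arbitrary: c t s)
  case 0
  then have c: "c = a" by simp
  have "t j = Blank" for j
    using 0(2)[rule_format, of j] c by linarith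
  then have t: "t = (\<lambda>_. Blank)" by blast
  have "reads s i = Blank"
    using 0(4) t by (simp add: reads_def)
  moreover have "s(i := (\<lambda>_. Blank, a - 1)) = s"
    using 0(4) c t by (simp add: fun_upd_idem)
  ultimately show ?case
    using exec_While_False[of "\<lambda>r. r i \<noteq> Blank" s] c by simp
next
  case (Suc n)
  have ac: "a < c"
    using Suc(2) by simp
  have t: "t j \<noteq> Blank \<longleftrightarrow> a \<le> j \<and> j < c" for j
    using Suc(3) by blast
  have r: "reads s i \<noteq> Blank"
    using t[of "c - 1"] ac Suc(5) by (simp add: reads_def)
  let ?t = "t(c - 1 := Blank)"
  let ?s = "s(i := (?t, c - 1 - 1))"
  have eq: "acts ((keep (reads s))(i := (Blank, MoveLeft))) s = ?s"
    unfolding acts_upd using Suc(5) by simp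
  have t': "\<forall>j. ?t j \<noteq> Blank \<longleftrightarrow> a \<le> j \<and> j < c - 1"
  proof
    fix j
    show "?t j \<noteq> Blank \<longleftrightarrow> a \<le> j \<and> j < c - 1"
      using t[of j] by (cases "j = c - 1") (simp, simp, linarith)
  qed
  have si: "?s i = (?t, c - 1 - 1)" and n: "n = nat (c - 1 - a)" and le: "a \<le> c - 1"
    using Suc(2) ac by simp_all
  have "exec (While (\<lambda>r. r i \<noteq> Blank) (on i (\<lambda>r. (Blank, MoveLeft)))) ?s (3 * nat (c - 1 - a) + 1)
      (?s(i := (\<lambda>_. Blank, a - 1)))"
    by (rule Suc(1)[of "c - 1" ?t ?s, OF n t' le si])
  then have "exec (While (\<lambda>r. r i \<noteq> Blank) (on i (\<lambda>r. (Blank, MoveLeft)))) s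
      (3 * nat (c - 1 - a) + 1 + 3) (?s(i := (\<lambda>_. Blank, a - 1)))"
    unfolding on_def by (intro exec_While_Act) (use r eq in auto)
  moreover have "3 * nat (c - 1 - a) + 1 + 3 = 3 * nat (c - a) + 1"
    using ac by simp
  ultimately show ?case
    by (metis fun_upd_upd)
qed

lemma exec_wipe:
  assumes "segment n (s i)"
  shows "\<exists>t h. t \<le> 6 * n + 10 \<and> exec (wipe i) s t (s(i := (\<lambda>_. Blank, h)))"
proof -
  obtain t h where si: "s i = (t, h)" by (cases "s i")
  obtain a c where ac: "a \<le> c" "c - a \<le> int n" "a - 1 \<le> h" "h \<le> c" "\<forall>j. t j \<noteq> Blank \<longleftrightarrow> a \<le> j \<and> j < c"
    using assms si by auto
  \<comment> \<open>Writing under a head that stands next to the interval lengthens it by one cell,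
    on either side.\<close>
  define a' c' t' where "a' = min a h" "c' = max c (h + 1)" "t' = t(h := Mark 0)"
  have t': "\<forall>j. t' j \<noteq> Blank \<longleftrightarrow> a' \<le> j \<and> j < c'"
  proof
    fix j
    show "t' j \<noteq> Blank \<longleftrightarrow> a' \<le> j \<and> j < c'"
      using ac(5)[rule_format, of j] ac(1-4) unfolding a'_c'_t'_def
      by (cases "j = h") (simp, simp, linarith)
  qed
  have b: "a' \<le> h" "h \<le> c'" "a' \<le> c'" "c' - a' \<le> int n + 1"
    using ac(1-4) unfolding a'_c'_t'_def by linarith+
  let ?s1 = "s(i := (t', h))" and ?s2 = "s(i := (t', c'))" and ?s3 = "s(i := (t', c' - 1))"
  have 1: "exec (on i (\<lambda>r. (Mark 0, Stay))) s 1 ?s1"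
    using exec_on[of i "\<lambda>r. (Mark 0, Stay)" s] si by (simp add: a'_c'_t'_def)
  have 2: "exec (While (\<lambda>r. r i \<noteq> Blank) (on i (\<lambda>r. (r i, MoveRight)))) ?s1 (3 * nat (c' - h) + 1) ?s2"
    using exec_run_right[OF t' b(1,2), of ?s1 i] by simp
  have "t' c' = Blank" using t' by blast
  then have 3: "exec (on i (\<lambda>r. (Blank, MoveLeft))) ?s2 1 ?s3"
    using exec_on[of i "\<lambda>r. (Blank, MoveLeft)" ?s2] by (simp add: fun_upd_idem)
  have 4: "exec (While (\<lambda>r. r i \<noteq> Blank) (on i (\<lambda>r. (Blank, MoveLeft)))) ?s3 (3 * nat (c' - a') + 1)
      (s(i := (\<lambda>_. Blank, a' - 1)))"
    using exec_erase_left[OF t' b(3), of ?s3 i] by simp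
  have "1 + (3 * nat (c' - h) + 1 + (1 + (3 * nat (c' - a') + 1))) \<le> 6 * n + 10"
    using b by simp
  with exec_Seq[OF 1 exec_Seq[OF 2 exec_Seq[OF 3 4]]] show ?thesis
    unfolding wipe_def by blast
qed

lemma exec_wipe_all:
  assumes "\<forall>i\<in>set is. segment n (s i)" "distinct is"
  shows "\<exists>t s'. t \<le> length is * (6 * n + 10) + 1 \<and> exec (wipe_all is) s t s' \<and>
    (\<forall>i\<in>set is. fst (s' i) = (\<lambda>_. Blank)) \<and> (\<forall>i. i \<notin> set is \<longrightarrow> s' i = s i)"
  using assms
proof (induction "is" arbitrary: s)
  case Nil
  then show ?case
    using exec_Act[of keep s] by (auto simp: skip_def intro!: exI[of _ 1])
next
  case (Cons i "is")
  obtain t h where 1: "t \<le> 6 * n + 10" "exec (wipe i) s t (s(i := (\<lambda>_. Blank, h)))"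
    using exec_wipe Cons.prems by (metis list.set_intros(1))
  have "\<forall>j\<in>set is. segment n ((s(i := (\<lambda>_. Blank, h))) j)"
    using Cons.prems by auto
  moreover have "distinct is"
    using Cons.prems by simp
  ultimately obtain t' s' where 2: "t' \<le> length is * (6 * n + 10) + 1"
     "exec (wipe_all is) (s(i := (\<lambda>_. Blank, h))) t' s'"
     "\<forall>i\<in>set is. fst (s' i) = (\<lambda>_. Blank)" "\<forall>j. j \<notin> set is \<longrightarrow> s' j = (s(i := (\<lambda>_. Blank, h))) j"
    using Cons.IH by blast
  show ?case
    using exec_Seq[OF 1(2) 2(2)] 1(1) 2(1,3,4) Cons.prems(2)
    by (intro exI[of _ "t + t'"] exI[of _ s']) auto
qed

text \<open>The moves of the last head are recorded so that they can be undone: the output has to be read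
  from cell \<open>0\<close> on.\<close>

fun move_mark :: "move \<Rightarrow> symbol" where
  "move_mark MoveLeft = Mark 0" | "move_mark Stay = Mark 1" | "move_mark MoveRight = Mark 2"

definition undo_move :: "symbol \<Rightarrow> move" where
  "undo_move a = (if a = Mark 0 then MoveRight else if a = Mark 1 then Stay else MoveLeft)"

lemma offset_undo [simp]: "offset (undo_move (move_mark m)) = - offset m"
  by (cases m) (auto simp: undo_move_def)

lemma move_mark_neq [simp]: "move_mark m \<noteq> Blank"
  by (cases m) auto

text \<open>The latest move is the first element of \<open>ms\<close> and lies under the head, so
  reading the tape backwards consumes the list from its front.\<close>

fun history :: "move list \<Rightarrow> tape \<Rightarrow> bool" where
  "history ms (t, h) \<longleftrightarrow>
     (\<forall>j. t (h - j) = (if 0 \<le> j \<and> j < int (length ms) then move_mark (ms ! nat j) else Blank))"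

lemma history_Cons:
  assumes "history ms (t, h - 1)"
  shows "history (m # ms) (t(h := move_mark m), h)"
proof -
  have "(t(h := move_mark m)) (h - j) =
      (if 0 \<le> j \<and> j < int (length (m # ms)) then move_mark ((m # ms) ! nat j) else Blank)" for j
    using assms[unfolded history.simps, rule_format, of "j - 1"]
    by (auto simp: nth_Cons' nat_diff_distrib' algebra_simps split: if_splits)
  then show ?thesis by simp
qed

lemma history_pop:
  assumes "history (m # ms) t"
  shows "scanned t = move_mark m" "history ms (act (Blank, MoveLeft) t)"
proof -
  obtain u h where [simp]: "t = (u, h)" by (cases t)
  have *: "u (h - j) = (if 0 \<le> j \<and> j < int (length (m # ms)) then move_mark ((m # ms) ! nat j) else Blank)" for j
    using assms by simp
  show "scanned t = move_mark m"
    using *[of 0] by simp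
  have "(u(h := Blank)) (h - 1 - j) = (if 0 \<le> j \<and> j < int (length ms) then move_mark (ms ! nat j) else Blank)" for j
    using *[of "j + 1"] by (auto simp: nat_add_distrib algebra_simps)
  then show "history ms (act (Blank, MoveLeft) t)"
    by simp
qed

fun loaded :: "bits \<Rightarrow> tape \<Rightarrow> bool" where
  "loaded y (t, h) \<longleftrightarrow>
     (\<forall>j. t (h + j) = (if 0 \<le> j \<and> j < int (length y) then Bit (y ! nat j) else Blank))"

text \<open>A stack yields the input from its last letter on. Writing from right to left leaves the
  head on the first letter, where the simulated machine starts.\<close>

lemma loaded_Cons:
  assumes "loaded y t"
  shows "loaded (b # y) (act (Bit b, Stay) (act (scanned t, MoveLeft) t))"
proof -
  obtain u h where [simp]: "t = (u, h)" by (cases t)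
  have "(u(h - 1 := Bit b)) (h - 1 + j) =
      (if 0 \<le> j \<and> j < int (length (b # y)) then Bit ((b # y) ! nat j) else Blank)" for j
    using assms[simplified, rule_format, of "j - 1"]
    by (auto simp: nth_Cons' nat_diff_distrib' algebra_simps split: if_splits)
  then show ?thesis by simp
qed

lemma loaded_Nil: "fst t = (\<lambda>_. Blank) \<Longrightarrow> loaded [] t"
  by (cases t) simp

lemma loaded_tape_rel: "loaded x t \<Longrightarrow> tape_rel b (input_tape x) t"
  by (cases t) (auto simp: input_tape_def dec_blank_def)

lemma loaded_segment: "loaded x t \<Longrightarrow> segment (length x) t"
proof (cases t)
  case (Pair u h)
  assume "loaded x t"
  then have "u j = (if 0 \<le> j - h \<and> j - h < int (length x) then Bit (x ! nat (j - h)) else Blank)" for j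
    using Pair by (metis add.commute diff_add_cancel loaded.simps)
  then show ?thesis
    unfolding Pair segment.simps
    by - (rule exI[of _ h], rule exI[of _ "h + int (length x)"], auto)
qed

lemma segment_blank: "fst t = (\<lambda>_. Blank) \<Longrightarrow> segment n t"
proof (cases t)
  case (Pair u h)
  assume "fst t = (\<lambda>_. Blank)"
  then show ?thesis
    unfolding Pair segment.simps by - (rule exI[of _ h], rule exI[of _ h], auto)
qed

text \<open>Tape \<open>20\<close> holds the simulated state, tape \<open>21\<close> the recorded
  moves, and the tapes from \<open>22\<close> on are those of \<open>M\<close>. By
  \<open>fresh\<close> the symbol \<open>Mark b\<close> is free to stand for a written blank. As
  \<open>S\<close> may be larger than required, machines with different numbers of tapes can share
  it.\<close>

locale simulation = stack_programs +
  fixes M :: machine and b :: nat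
  assumes wf: "machine_wf M" and det: "deterministic M"
    and fresh: "\<And>q rs q' as a. (q, rs, q', as) \<in> instrs M \<Longrightarrow> a \<in> set as \<Longrightarrow> fst a \<noteq> Mark b"
    and scratch: "{20..<22 + n_tapes M} \<subseteq> S"
begin

abbreviation k :: nat where "k \<equiv> n_tapes M"

abbreviation last_tape :: nat where "last_tape \<equiv> 21 + k"

lemma k: "1 \<le> k"
  using wf by (simp add: machine_wf_def)

lemma instr_length: "(q, rs, q', as) \<in> instrs M \<Longrightarrow> length rs = k \<and> length as = k"
  using wf by (auto simp: machine_wf_def)

definition sim_reads :: "reading \<Rightarrow> symbol list" where
  "sim_reads r = map (\<lambda>m. dec_blank b (r (22 + m))) [0..<k]"

definition applicable :: "reading \<Rightarrow> nat \<times> (symbol \<times> move) list \<Rightarrow> bool" where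
  "applicable r x \<longleftrightarrow> (\<exists>q. r 20 = Mark q \<and> (q, sim_reads r, fst x, snd x) \<in> instrs M)"

text \<open>By \<open>det\<close> at most one instruction applies, so \<open>SOME\<close> does not
  really choose. Only the moves of the last tape are recorded, since only its head has to be brought
  back.\<close>

definition sim_acts :: "reading \<Rightarrow> actions" where
  "sim_acts r = (if \<nexists>x. applicable r x then keep r else let (q', as) = (SOME x. applicable r x) in
     (\<lambda>i. if i = 20 then (Mark q', Stay)
       else if i = 21 then (move_mark (snd (as ! (k - 1))), MoveRight)
       else if 22 \<le> i \<and> i < 22 + k then (enc_blank b (fst (as ! (i - 22))), snd (as ! (i - 22)))
       else (r i, Stay)))"

definition load_loop :: "nat \<Rightarrow> com" where
  "load_loop i = While (\<lambda>r. r i \<noteq> Blank) (Act (\<lambda>r. (keep r)(22 := (r 22, MoveLeft))) ;;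
     Act (\<lambda>r. (keep r)(22 := (r i, Stay), i := (Blank, MoveLeft))))"

definition load :: "nat \<Rightarrow> com" where
  "load i = load_loop i ;;
    on 20 (\<lambda>r. (Mark (start M), Stay))"

definition main_loop :: com where
  "main_loop = While (\<lambda>r. \<exists>x. applicable r x) (Act sim_acts)"

text \<open>On the way back the scanned cells are encoded again, so that even a head that leaves the
  visited interval cannot break the invariant \<open>segment\<close>.\<close>

definition undo_loop :: com where
  "undo_loop = While (\<lambda>r. r 21 \<noteq> Blank) (Act (\<lambda>r. (keep r)(21 := (Blank, MoveLeft),
     last_tape := (enc_blank b (r last_tape), undo_move (r 21)))))"

definition undo :: com where
  "undo = on 21 (\<lambda>r. (r 21, MoveLeft)) ;;
     undo_loop"

definition read_word :: "nat \<Rightarrow> com" where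
  "read_word j = While (\<lambda>r. dec_blank b (r last_tape) \<noteq> Blank)
     (Act (\<lambda>r. (keep r)(j := (r j, MoveRight))) ;;
      Act (\<lambda>r. (keep r)(j := (dec_blank b (r last_tape), Stay),
        last_tape := (enc_blank b (r last_tape), MoveRight))))"

definition verdict :: "nat \<Rightarrow> com" where
  "verdict j = Cond (\<lambda>r. r 20 \<in> Mark ` accepting M) (push j (Bit True)) skip"

text \<open>\<open>post\<close> fetches the result, either a verdict or an output word, while state
  and tapes are still present. Tape \<open>21\<close> needs no wiping, as \<open>undo\<close> has
  emptied it.\<close>

definition simulate :: "nat \<Rightarrow> com \<Rightarrow> com" where
  "simulate i post = load i ;; main_loop ;; undo ;; post ;; on 20 (\<lambda>r. (Blank, Stay)) ;;
     wipe_all [22..<22 + k]"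

definition frame :: "stacks \<Rightarrow> store \<Rightarrow> bool" where
  "frame st s \<longleftrightarrow> (\<forall>i. i \<notin> {20..<22 + k} \<longrightarrow>
     (if i \<in> S then fst (s i) = (\<lambda>_. Blank) else s i = stk (st i) \<and> Blank \<notin> set (st i)))"

definition state_tape :: "nat \<Rightarrow> tape \<Rightarrow> bool" where
  "state_tape q t \<longleftrightarrow> fst t = (\<lambda>_. Blank)(snd t := Mark q)"

text \<open>The head of tape \<open>21\<close> stands one cell to the right of the latest mark,
  hence the \<open>- 1\<close>. The last conjunct guarantees that undoing the moves in
  \<open>ms\<close> leads to cell \<open>0\<close>.\<close>

definition sim_rel :: "nat \<Rightarrow> move list \<Rightarrow> config \<Rightarrow> store \<Rightarrow> bool" where
  "sim_rel n ms c s \<longleftrightarrow> length (snd c) = k \<and> state_tape (fst c) (s 20) \<and>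
     (\<forall>m<k. tape_rel b (snd c ! m) (s (22 + m)) \<and> segment n (s (22 + m))) \<and>
     history ms (fst (s 21), snd (s 21) - 1) \<and> snd (snd c ! (k - 1)) = sum_list (map offset ms)"

lemma rep_frame: "rep st s \<longleftrightarrow> frame st s \<and> (\<forall>i\<in>{20..<22 + k}. fst (s i) = (\<lambda>_. Blank))"
  using scratch unfolding rep_def frame_def by (smt (verit, best) subset_eq)

lemma state_tape_scanned: "state_tape q t \<Longrightarrow> scanned t = Mark q"
  by (cases t) (auto simp: state_tape_def)

lemma state_tape_write: "state_tape q t \<Longrightarrow> state_tape q' (act (Mark q', Stay) t)"
  by (cases t) (auto simp: state_tape_def)

lemma sim_reads_eq:
  assumes "sim_rel n ms (q, ts) s"
  shows "reads s 20 = Mark q" "sim_reads (reads s) = map scanned ts"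
proof -
  show "reads s 20 = Mark q"
    using assms state_tape_scanned by (simp add: sim_rel_def reads_def)
  show "sim_reads (reads s) = map scanned ts"
    using assms by (intro nth_equalityI)
      (auto simp: sim_rel_def sim_reads_def reads_def tape_rel_scanned)
qed

lemma applicable_iff:
  assumes "sim_rel n ms (q, ts) s"
  shows "applicable (reads s) (q', as) \<longleftrightarrow> (q, map scanned ts, q', as) \<in> instrs M"
  using sim_reads_eq[OF assms] by (simp add: applicable_def)

lemma sim_step:
  assumes rel: "sim_rel n ms c s" and fr: "frame st s" and st: "step M c c'"
  shows "(\<exists>x. applicable (reads s) x) \<and> frame st (acts (sim_acts (reads s)) s) \<and>
    (\<exists>m. sim_rel (n + 1) (m # ms) c' (acts (sim_acts (reads s)) s))"
proof -
  obtain q ts where c: "c = (q, ts)" by (cases c)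
  obtain q' as where i: "(q, map scanned ts, q', as) \<in> instrs M" and c': "c' = (q', map2 act as ts)"
    using st unfolding c by (auto elim: step.cases)
  note rel = rel[unfolded c]
  have ap: "applicable (reads s) x \<longleftrightarrow> x = (q', as)" for x
    using applicable_iff[OF rel] i det unfolding deterministic_def by (metis surj_pair)
  then have some: "(SOME x. applicable (reads s) x) = (q', as)"
    by simp
  have len: "length as = k" "length ts = k"
    using instr_length[OF i] rel by (simp_all add: sim_rel_def)
  let ?s = "acts (sim_acts (reads s)) s"
  have s20: "?s 20 = act (Mark q', Stay) (s 20)"
    by (simp add: acts_def sim_acts_def some ap)
  have s21: "?s 21 = act (move_mark (snd (as ! (k - 1))), MoveRight) (s 21)"
    by (simp add: acts_def sim_acts_def some ap)
  have sm: "?s (22 + m) = act (enc_blank b (fst (as ! m)), snd (as ! m)) (s (22 + m))" if "m < k" for m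
    using that by (simp add: acts_def sim_acts_def some ap)
  have other: "?s i = s i" if "i \<notin> {20..<22 + k}" for i
  proof -
    have "?s i = act (reads s i, Stay) (s i)"
    proof -
      have "i \<noteq> 20" "i \<noteq> 21" "\<not> (22 \<le> i \<and> i < 22 + k)"
        using that k by auto
      then show ?thesis
        by (auto simp: acts_def sim_acts_def some ap)
    qed
    then show ?thesis
      by (simp add: reads_def)
  qed
  have fr': "frame st ?s"
    using fr other by (simp add: frame_def)
  have tapes: "tape_rel b (map2 act as ts ! m) (?s (22 + m)) \<and> segment (n + 1) (?s (22 + m))" if m: "m < k" for m
  proof -
    have "fst (as ! m) \<noteq> Mark b"
      using fresh[OF i] m len by simp
    then have "tape_rel b (act (as ! m) (ts ! m)) (?s (22 + m))"
      using tape_rel_act[of b "ts ! m" "s (22 + m)" "fst (as ! m)" "snd (as ! m)"] rel m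
      unfolding sm[OF m] by (simp add: sim_rel_def)
    then show ?thesis
      using segment_act rel m len unfolding sm[OF m] by (simp add: sim_rel_def)
  qed
  let ?m = "snd (as ! (k - 1))"
  obtain u h where uh: "s 21 = (u, h)" by (cases "s 21")
  have hist: "history (?m # ms) (fst (?s 21), snd (?s 21) - 1)"
    using history_Cons[of ms u h ?m] rel uh unfolding s21 by (simp add: sim_rel_def)
  have pos: "snd (map2 act as ts ! (k - 1)) = sum_list (map offset (?m # ms))"
    using rel len k by (cases "ts ! (k - 1)"; cases "as ! (k - 1)") (simp add: sim_rel_def)
  have st20: "state_tape q' (?s 20)"
    using state_tape_write[of q "s 20" q'] rel by (simp add: s20 sim_rel_def)
  have "sim_rel (n + 1) (?m # ms) c' ?s"
    unfolding sim_rel_def c'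
    using st20 tapes hist pos len by (simp del: history.simps)
  then show ?thesis
    using fr' ap by blast
qed

lemma sim_halted:
  assumes "sim_rel n ms c s" "halted M c"
  shows "\<nexists>x. applicable (reads s) x"
proof
  obtain q ts where c: "c = (q, ts)" by (cases c)
  assume "\<exists>x. applicable (reads s) x"
  then obtain q' as where "(q, map scanned ts, q', as) \<in> instrs M"
    using applicable_iff assms(1) c by auto
  then show False
    using assms(2) c step.intros unfolding halted_def by blast
qed

lemma exec_main_loop:
  assumes "(step M ^^ t) c c'" "halted M c'" "sim_rel n ms c s" "frame st s"
  shows "\<exists>s' ms'. exec main_loop s (3 * t + 1) s' \<and> length ms' = length ms + t \<and>
    sim_rel (n + t) ms' c' s' \<and> frame st s'"
  using assms
proof (induction t arbitrary: c n ms s)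
  case 0
  then show ?case
    using exec_While_False[of "\<lambda>r. \<exists>x. applicable r x" s] sim_halted[of n ms c' s]
    unfolding main_loop_def by auto
next
  case (Suc t)
  obtain c1 where c1: "step M c c1" "(step M ^^ t) c1 c'"
    using Suc.prems(1) by (metis relpowp_Suc_D2)
  let ?s = "acts (sim_acts (reads s)) s"
  obtain m where m: "sim_rel (n + 1) (m # ms) c1 ?s" "frame st ?s" "\<exists>x. applicable (reads s) x"
    using sim_step[OF Suc.prems(3,4) c1(1)] by blast
  obtain s' ms' where s': "exec main_loop ?s (3 * t + 1) s'" "length ms' = length (m # ms) + t"
     "sim_rel (n + 1 + t) ms' c' s'" "frame st s'"
    using Suc.IH[OF c1(2) Suc.prems(2) m(1,2)] by blast
  have "exec main_loop s (3 * t + 1 + 3) s'"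
    using s'(1) m(3) unfolding main_loop_def by (intro exec_While_Act) auto
  then show ?case
    using s'(2-) by (intro exI[of _ s'] exI[of _ ms']) (simp add: add.commute)
qed

lemma exec_load_loop:
  assumes "i \<notin> S" "st i = map Bit u" "loaded y (s 22)" "frame st s"
    "\<forall>m\<in>{20..<22 + k} - {22}. fst (s m) = (\<lambda>_. Blank)"
  shows "\<exists>s'. exec (load_loop i) s (4 * length u + 1) s' \<and>
    loaded (rev u @ y) (s' 22) \<and> frame (st(i := [])) s' \<and>
    (\<forall>m\<in>{20..<22 + k} - {22}. fst (s' m) = (\<lambda>_. Blank))"
  using assms(2-)
proof (induction u arbitrary: st y s)
  case Nil
  have "i \<notin> {20..<22 + k}"
    using scratch assms(1) by blast
  then have "s i = stk []"
    using Nil assms(1) by (auto simp: frame_def)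
  moreover have "st(i := []) = st"
    using Nil by auto
  ultimately show ?case
    using exec_While_False[of "\<lambda>r. r i \<noteq> Blank" s] Nil by (auto simp: load_loop_def reads_def)
next
  case (Cons a u)
  have i: "i \<notin> {20..<22 + k}"
    using scratch assms(1) by blast
  then have i22: "i \<noteq> 22"
    using k by auto
  have si: "s i = stk (Bit a # map Bit u)"
    using Cons.prems i assms(1) by (auto simp: frame_def)
  let ?s1 = "s(22 := act (reads s 22, MoveLeft) (s 22))"
  let ?s2 = "?s1(22 := act (Bit a, Stay) (act (reads s 22, MoveLeft) (s 22)), i := stk (map Bit u))"
  have 1: "?s1 = acts ((keep (reads s))(22 := (reads s 22, MoveLeft))) s"
    by (simp add: acts_upd)
  have r: "reads ?s1 i = Bit a"
    using si i22 by (simp add: reads_def)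
  have 2: "acts ((keep (reads ?s1))(22 := (reads ?s1 i, Stay), i := (Blank, MoveLeft))) ?s1 = ?s2"
    using i22 unfolding r by (subst acts_upd2) (simp_all add: si stk_pop)
  have l: "loaded (a # y) (?s2 22)"
    using loaded_Cons[OF Cons.prems(2)] i22 by (simp add: reads_def)
  have f: "frame (st(i := map Bit u)) ?s2"
    using Cons.prems(1,3) i assms(1) k unfolding frame_def by auto
  have bl: "\<forall>m\<in>{20..<22 + k} - {22}. fst (?s2 m) = (\<lambda>_. Blank)"
    using Cons.prems(4) i by auto
  obtain s' where s': "exec (load_loop i) ?s2 (4 * length u + 1) s'"
    "loaded (rev u @ a # y) (s' 22)" "frame (st(i := [])) s'"
    "\<forall>m\<in>{20..<22 + k} - {22}. fst (s' m) = (\<lambda>_. Blank)"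
    using Cons.IH[of "st(i := map Bit u)" "a # y" ?s2, OF fun_upd_same l f bl] unfolding fun_upd_upd by blast
  have "reads s i \<noteq> Blank"
    using si by (simp add: reads_def)
  from exec_While_Act2[of "\<lambda>r. r i \<noteq> Blank", OF this 1 s'(1)[folded 2, unfolded load_loop_def], folded load_loop_def] show ?case
    using s'(2-) by (intro exI[of _ s']) (simp add: add.commute del: fun_upd_apply)
qed

lemma exec_load:
  assumes "i \<notin> S" "st i = map Bit (rev x)" "rep st s"
  shows "\<exists>s'. exec (load i) s (4 * length x + 2) s' \<and> sim_rel (length x) [] (initial M x) s' \<and>
    frame (st(i := [])) s'"
proof -
  have bl: "\<forall>m\<in>{20..<22 + k}. fst (s m) = (\<lambda>_. Blank)" and fr: "frame st s"
    using assms(3) rep_frame by blast+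
  have "fst (s 22) = (\<lambda>_. Blank)"
    using bl k by simp
  then have "loaded [] (s 22)"
    by (rule loaded_Nil)
  from exec_load_loop[OF assms(1,2) this fr] bl
  obtain s1 where s1: "exec (load_loop i) s (4 * length (rev x) + 1) s1"
    "loaded (rev (rev x) @ []) (s1 22)" "frame (st(i := [])) s1"
    "\<forall>m\<in>{20..<22 + k} - {22}. fst (s1 m) = (\<lambda>_. Blank)"
    by blast
  let ?s2 = "s1(20 := act (Mark (start M), Stay) (s1 20))"
  have ex: "exec (load i) s (4 * length x + 2) ?s2"
    using exec_Seq[OF s1(1) exec_on] unfolding load_def by (simp add: numeral_2_eq_2)
  have fr2: "frame (st(i := [])) ?s2"
  proof -
    have "?s2 j = s1 j" if "j \<notin> {20..<22 + k}" for j
      using that by auto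
    then show ?thesis
      using s1(3) unfolding frame_def by metis
  qed
  have bl1: "fst (s1 m) = (\<lambda>_. Blank)" if "m = 20 \<or> m = 21 \<or> (m \<in> {23..<22 + k})" for m
    using s1(4) that by auto
  have tapes: "tape_rel b (snd (initial M x) ! m) (?s2 (22 + m)) \<and> segment (length x) (?s2 (22 + m))"
    if "m < k" for m
  proof (cases m)
    case 0
    then show ?thesis
      using s1(2) loaded_tape_rel loaded_segment by (simp add: initial_def)
  next
    case (Suc j)
    then have "fst (s1 (22 + m)) = (\<lambda>_. Blank)"
      using bl1 that by simp
    moreover have "snd (initial M x) ! m = blank_tape"
      using Suc that by (simp add: initial_def)
    ultimately show ?thesis
      using segment_blank[of "s1 (22 + m)" "length x"]
      using Suc by (cases "s1 (22 + m)") (simp add: blank_tape_def dec_blank_def del: segment.simps)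
  qed
  have st20: "state_tape (start M) (?s2 20)"
    using bl1[of 20] by (cases "s1 20") (simp add: state_tape_def)
  have h: "history [] (fst (?s2 21), snd (?s2 21) - 1)"
    using bl1[of 21] by auto
  have "snd (snd (initial M x) ! (k - 1)) = 0"
    by (simp add: initial_def input_tape_def blank_tape_def nth_Cons')
  then have "sim_rel (length x) [] (initial M x) ?s2"
    using tapes st20 h k unfolding sim_rel_def by (simp add: initial_def del: history.simps)
  then show ?thesis
    using ex fr2 by blast
qed

lemma exec_undo_loop:
  assumes "history ms (s 21)" "tape_rel b (u, sum_list (map offset ms)) (s last_tape)" "segment n (s last_tape)"
  shows "\<exists>s'. exec undo_loop s (3 * length ms + 1) s' \<and>
    fst (s' 21) = (\<lambda>_. Blank) \<and> tape_rel b (u, 0) (s' last_tape) \<and> segment (n + length ms) (s' last_tape) \<and>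
    (\<forall>i. i \<noteq> 21 \<longrightarrow> i \<noteq> last_tape \<longrightarrow> s' i = s i)"
  using assms
proof (induction ms arbitrary: s n)
  case Nil
  obtain v h where v: "s 21 = (v, h)" by (cases "s 21")
  have "v j = Blank" for j
    using Nil(1)[unfolded v history.simps, rule_format, of "h - j"] by simp
  then have "fst (s 21) = (\<lambda>_. Blank)" "reads s 21 = Blank"
    using v by (auto simp: reads_def)
  then show ?case
    using exec_While_False[of "\<lambda>r. r 21 \<noteq> Blank" s] Nil by (auto simp: undo_loop_def)
next
  case (Cons m ms)
  have r21: "reads s 21 = move_mark m"
    using history_pop(1)[OF Cons.prems(1)] by (simp add: reads_def)
  have ne: "21 \<noteq> last_tape"
    using k by simp
  let ?s = "s(21 := act (Blank, MoveLeft) (s 21),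
    last_tape := act (enc_blank b (reads s last_tape), undo_move (reads s 21)) (s last_tape))"
  have eq: "acts ((keep (reads s))(21 := (Blank, MoveLeft),
       last_tape := (enc_blank b (reads s last_tape), undo_move (reads s 21)))) s = ?s"
    by (rule acts_upd2[OF ne])
  have 1: "history ms (?s 21)"
    using history_pop(2)[OF Cons.prems(1)] ne by simp
  have 2: "tape_rel b (u, sum_list (map offset ms)) (?s last_tape)"
    using tape_rel_move[OF Cons.prems(2), of "undo_move (move_mark m)"] r21 by (simp add: reads_def)
  have 3: "segment (n + 1) (?s last_tape)"
    using segment_act[OF Cons.prems(3)] by simp
  obtain s' where s': "exec undo_loop ?s (3 * length ms + 1) s'"
    "fst (s' 21) = (\<lambda>_. Blank)" "tape_rel b (u, 0) (s' last_tape)" "segment (n + 1 + length ms) (s' last_tape)"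
    "\<forall>i. i \<noteq> 21 \<longrightarrow> i \<noteq> last_tape \<longrightarrow> s' i = ?s i"
    using Cons.IH[OF 1 2 3] by blast
  have other: "\<forall>i. i \<noteq> 21 \<longrightarrow> i \<noteq> last_tape \<longrightarrow> s' i = s i"
    using s'(5) by simp
  have "reads s 21 \<noteq> Blank"
    using r21 by simp
  from exec_While_Act[of "\<lambda>r. r 21 \<noteq> Blank", OF this s'(1)[folded eq, unfolded undo_loop_def],
      folded undo_loop_def] show ?case
    using s'(2-4) other by (intro exI[of _ s']) (simp add: add.commute del: fun_upd_apply)
qed

lemma exec_undo:
  assumes "sim_rel n ms c s" "frame st s"
  shows "\<exists>s'. exec undo s (3 * length ms + 2) s' \<and> fst (s' 21) = (\<lambda>_. Blank) \<and>
    tape_rel b (fst (last (snd c)), 0) (s' last_tape) \<and>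
    (\<forall>i\<in>{22..<22 + k}. segment (n + length ms) (s' i)) \<and> s' 20 = s 20 \<and> frame st s'"
proof -
  let ?s = "s(21 := (fst (s 21), snd (s 21) - 1))"
  have len: "length (snd c) = k"
    using assms(1) by (simp add: sim_rel_def)
  then have last: "last (snd c) = snd c ! (k - 1)"
    using k by (metis last_conv_nth length_0_conv not_one_le_zero)
  have ex: "exec (on 21 (\<lambda>r. (r 21, MoveLeft))) s 1 ?s"
    using exec_on[of 21 "\<lambda>r. (r 21, MoveLeft)" s] by (cases "s 21") (simp add: reads_def)
  have l: "22 + (k - 1) = last_tape" "k - 1 < k"
    using k by simp_all
  have t: "tape_rel b (fst (last (snd c)), sum_list (map offset ms)) (?s last_tape)"
    and seg: "segment n (?s last_tape)"
    using assms(1) l k unfolding sim_rel_def last by (metis fun_upd_apply prod.collapse add_left_imp_eq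
      add.commute numeral_Bit0 add_eq_self_zero not_one_le_zero)+
  have h: "history ms (?s 21)"
    using assms(1) by (simp add: sim_rel_def)
  obtain s' where s': "exec undo_loop ?s (3 * length ms + 1) s'"
    "fst (s' 21) = (\<lambda>_. Blank)" "tape_rel b (fst (last (snd c)), 0) (s' last_tape)"
    "segment (n + length ms) (s' last_tape)"
    "\<forall>i. i \<noteq> 21 \<longrightarrow> i \<noteq> last_tape \<longrightarrow> s' i = ?s i"
    using exec_undo_loop[OF h t seg] by blast
  have "segment (n + length ms) (s' i)" if i: "i \<in> {22..<22 + k}" for i
  proof (cases "i = last_tape")
    case False
    then have "s' i = s (22 + (i - 22))" "i - 22 < k"
      using s'(5) i by auto
    then show ?thesis
      using assms(1) segment_mono[of n] unfolding sim_rel_def by (metis le_add1)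
  qed (use s'(4) in simp)
  moreover have "s' 20 = s 20"
    using s'(5) k by simp
  moreover have "frame st s'"
    using s'(5) assms(2) k unfolding frame_def by auto
  moreover have "exec undo s (3 * length ms + 2) s'"
    using exec_Seq[OF ex s'(1)] unfolding undo_def by simp
  ultimately show ?thesis
    using s'(2,3) by blast
qed

lemma exec_read_word:
  assumes "j \<notin> S" "tape_rel b (u, p) (s last_tape)" "segment n (s last_tape)" "s j = stk v"
    "\<forall>i<length w. u (p + int i) = w ! i \<and> w ! i \<noteq> Blank" "u (p + int (length w)) = Blank"
  shows "\<exists>s'. exec (read_word j) s (4 * length w + 1) s' \<and> segment (n + length w) (s' last_tape) \<and>
    s' j = stk (rev w @ v) \<and> (\<forall>i. i \<noteq> j \<longrightarrow> i \<noteq> last_tape \<longrightarrow> s' i = s i)"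
  using assms(2-)
proof (induction w arbitrary: p s n v)
  case Nil
  have "dec_blank b (reads s last_tape) = Blank"
    using tape_rel_scanned[OF Nil(1)] Nil(5) by (simp add: reads_def)
  then show ?case
    using exec_While_False[of "\<lambda>r. dec_blank b (r last_tape) \<noteq> Blank" s] Nil unfolding read_word_def by auto
next
  case (Cons a w)
  have ne: "j \<noteq> last_tape"
  proof -
    have "last_tape \<in> S"
      using scratch by (rule subsetD) simp
    then show ?thesis
      using assms(1) by blast
  qed
  have a: "u p = a" "a \<noteq> Blank"
    using Cons.prems(4) by (auto dest: spec[of _ 0])
  then have r: "dec_blank b (reads s last_tape) = a"
    using tape_rel_scanned[OF Cons.prems(1)] by (simp add: reads_def)
  let ?s1 = "s(j := act (reads s j, MoveRight) (s j))"
  let ?s2 = "s(j := stk (a # v), last_tape := act (enc_blank b (reads s last_tape), MoveRight) (s last_tape))"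
  have 1: "?s1 = acts ((keep (reads s))(j := (reads s j, MoveRight))) s"
    by (simp add: acts_upd)
  have r1: "reads ?s1 last_tape = reads s last_tape"
    using ne by (simp add: reads_def)
  have 2: "acts ((keep (reads ?s1))(j := (dec_blank b (reads ?s1 last_tape), Stay),
        last_tape := (enc_blank b (reads ?s1 last_tape), MoveRight))) ?s1 = ?s2"
    unfolding r1 r using ne stk_push[of a v] Cons.prems(3) by (subst acts_upd2) (simp_all add: reads_def)
  have t: "tape_rel b (u, p + 1) (?s2 last_tape)"
    using tape_rel_move[OF Cons.prems(1), of MoveRight] by (simp add: reads_def)
  have sg: "segment (n + 1) (?s2 last_tape)"
    using segment_act[OF Cons.prems(2)] by simp
  have w: "\<forall>i<length w. u (p + 1 + int i) = w ! i \<and> w ! i \<noteq> Blank"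
  proof (intro allI impI)
    fix i assume "i < length w"
    then show "u (p + 1 + int i) = w ! i \<and> w ! i \<noteq> Blank"
      using Cons.prems(4)[rule_format, of "Suc i"] by (simp add: algebra_simps)
  qed
  have e: "u (p + 1 + int (length w)) = Blank"
    using Cons.prems(5) by (simp add: add.assoc)
  have sj: "?s2 j = stk (a # v)"
    using ne by simp
  obtain s' where s': "exec (read_word j) ?s2 (4 * length w + 1) s'" "segment (n + 1 + length w) (s' last_tape)"
    "s' j = stk (rev w @ a # v)" "\<forall>i. i \<noteq> j \<longrightarrow> i \<noteq> last_tape \<longrightarrow> s' i = ?s2 i"
    using Cons.IH[OF t sg sj w e] by blast
  have other: "\<forall>i. i \<noteq> j \<longrightarrow> i \<noteq> last_tape \<longrightarrow> s' i = s i"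
    using s'(4) by simp
  have "dec_blank b (reads s last_tape) \<noteq> Blank"
    using r a by simp
  from exec_While_Act2[of "\<lambda>r. dec_blank b (r last_tape) \<noteq> Blank", OF this 1
      s'(1)[folded 2, unfolded read_word_def]]
  show ?case
    using s'(2,3) other unfolding read_word_def by (intro exI[of _ s']) (simp add: add.commute del: fun_upd_apply)
qed

text \<open>Nonblank simulated cells are nonblank on the simulating tape, hence the output lies in
  the visited interval. This bounds the time for reading it.\<close>

lemma output_length:
  assumes rel: "tape_rel b (u, 0) t'" and seg: "segment n t'" and w: "\<forall>i<length w. u (int i) \<noteq> Blank"
  shows "length w \<le> n"
proof (cases w)
  case (Cons a v)
  obtain t h where t': "t' = (t, h)"
    by (cases t')
  obtain p q where pq: "q - p \<le> int n" "\<forall>j. t j \<noteq> Blank \<longleftrightarrow> p \<le> j \<and> j < q"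
    using seg unfolding t' segment.simps by blast
  have nb: "t (h + int i) \<noteq> Blank" if "i < length w" for i
  proof -
    have "dec_blank b (t (h + int i)) = u (int i)"
      using rel t' by simp
    then show ?thesis
      using w that by (auto simp: dec_blank_def)
  qed
  have "t (h + int 0) \<noteq> Blank" "t (h + int (length w - 1)) \<noteq> Blank"
    using nb[of 0] nb[of "length w - 1"] by (simp_all add: Cons)
  then have "p \<le> h" "h + int (length w - 1) < q"
    using pq(2)[rule_format, of "h + int 0"] pq(2)[rule_format, of "h + int (length w - 1)"] by simp_all
  then show ?thesis
    using pq(1) Cons by simp
qed simp

lemma exec_cleanup:
  assumes "frame st s" "fst (s 21) = (\<lambda>_. Blank)" "\<forall>i\<in>{22..<22 + k}. segment n (s i)" "state_tape q (s 20)"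
  shows "\<exists>t s'. t \<le> k * (6 * n + 10) + 2 \<and>
    exec (on 20 (\<lambda>r. (Blank, Stay)) ;; wipe_all [22..<22 + k]) s t s' \<and> rep st s'"
proof -
  let ?s = "s(20 := act (Blank, Stay) (s 20))"
  have "\<forall>i\<in>set [22..<22 + k]. segment n (?s i)"
    using assms(3) by auto
  from exec_wipe_all[OF this distinct_upt, unfolded set_upt length_upt add_diff_cancel_left'] obtain t s' where s': "t \<le> k * (6 * n + 10) + 1"
     "exec (wipe_all [22..<22 + k]) ?s t s'"
     "\<forall>i\<in>{22..<22 + k}. fst (s' i) = (\<lambda>_. Blank)" "\<forall>i. i \<notin> {22..<22 + k} \<longrightarrow> s' i = ?s i"
    by blast
  have ex: "exec (on 20 (\<lambda>r. (Blank, Stay))) s 1 ?s"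
    using exec_on[of 20 "\<lambda>r. (Blank, Stay)" s] by simp
  have "fst (?s 20) = (\<lambda>_. Blank)"
    using assms(4) by (cases "s 20") (auto simp: state_tape_def fun_eq_iff)
  then have bl: "fst (s' i) = (\<lambda>_. Blank)" if "i \<in> {20..<22 + k}" for i
  proof -
    have "i = 20 \<or> i = 21 \<or> i \<in> {22..<22 + k}"
      using that by auto
    then show ?thesis
      using s'(3,4) assms(2) \<open>fst (?s 20) = (\<lambda>_. Blank)\<close> by fastforce
  qed
  have "frame st s'"
    using assms(1) s'(4) unfolding frame_def by auto
  then have "rep st s'"
    using bl rep_frame by blast
  then show ?thesis
    using exec_Seq[OF ex s'(2)] s'(1) by (intro exI[of _ "1 + t"] exI[of _ s']) auto
qed

text \<open>At the end a tape has at most \<open>2 * (length x + 2 * t)\<close> visited cells, and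
  wiping takes six steps per cell; this gives the factor \<open>24\<close> for each of the
  \<open>k\<close> tapes. The additional share of \<open>k + 1\<close> pays for loading, running,
  undoing and reading.\<close>

definition sim_time :: "nat \<Rightarrow> nat" where
  "sim_time n = (k + 1) * (24 * n + 20)"

text \<open>Before \<open>post\<close>, up to \<open>t\<close> simulated and \<open>t\<close> undone
  moves have enlarged the interval of the input, whence \<open>length x + 2 * t\<close>;
  \<open>post\<close> is allowed to double it.\<close>

lemma exec_simulate:
  assumes "i \<notin> S" "st i = map Bit (rev x)" "rep st s"
    and halt: "(step M ^^ t) (initial M x) c" "halted M c"
    and post: "\<And>s. frame (st(i := [])) s \<Longrightarrow> fst (s 21) = (\<lambda>_. Blank) \<Longrightarrow>
      tape_rel b (fst (last (snd c)), 0) (s last_tape) \<Longrightarrow>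
      \<forall>i\<in>{22..<22 + k}. segment (length x + 2 * t) (s i) \<Longrightarrow> state_tape (fst c) (s 20) \<Longrightarrow>
      \<exists>t' s'. t' \<le> 4 * (length x + 2 * t) + 4 \<and> exec post s t' s' \<and> frame st' s' \<and> fst (s' 21) = (\<lambda>_. Blank) \<and>
        (\<forall>i\<in>{22..<22 + k}. segment (2 * (length x + 2 * t)) (s' i)) \<and> state_tape (fst c) (s' 20)"
  shows "\<exists>t' s'. t' \<le> sim_time (length x + t) \<and> exec (simulate i post) s t' s' \<and> rep st' s'"
proof -
  obtain s1 where 1: "exec (load i) s (4 * length x + 2) s1" "sim_rel (length x) [] (initial M x) s1"
      "frame (st(i := [])) s1"
    using exec_load[OF assms(1-3)] by blast
  obtain s2 ms where 2: "exec main_loop s1 (3 * t + 1) s2" "length ms = t"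
    "sim_rel (length x + t) ms c s2" "frame (st(i := [])) s2"
    using exec_main_loop[OF halt 1(2,3)] by auto
  obtain s3 where 3: "exec undo s2 (3 * length ms + 2) s3" "fst (s3 21) = (\<lambda>_. Blank)"
    "tape_rel b (fst (last (snd c)), 0) (s3 last_tape)"
    "\<forall>i\<in>{22..<22 + k}. segment (length x + t + length ms) (s3 i)" "s3 20 = s2 20" "frame (st(i := [])) s3"
    using exec_undo[OF 2(3,4)] by blast
  have "state_tape (fst c) (s3 20)"
    using 3(5) 2(3) by (simp add: sim_rel_def)
  moreover have "\<forall>i\<in>{22..<22 + k}. segment (length x + 2 * t) (s3 i)"
    using 3(4) 2(2) by (simp add: mult_2 add.assoc)
  ultimately obtain t4 s4 where 4: "t4 \<le> 4 * (length x + 2 * t) + 4" "exec post s3 t4 s4" "frame st' s4"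
      "fst (s4 21) = (\<lambda>_. Blank)" "\<forall>i\<in>{22..<22 + k}. segment (2 * (length x + 2 * t)) (s4 i)"
      "state_tape (fst c) (s4 20)"
    using post[OF 3(6,2,3)] by blast
  obtain t5 s5 where 5: "t5 \<le> k * (6 * (2 * (length x + 2 * t)) + 10) + 2"
      "exec (on 20 (\<lambda>r. (Blank, Stay)) ;; wipe_all [22..<22 + k]) s4 t5 s5" "rep st' s5"
    using exec_cleanup[OF 4(3-6)] by blast
  have ex: "exec (simulate i post) s (4 * length x + 2 + (3 * t + 1 + (3 * t + 2 + (t4 + t5)))) s5"
    unfolding simulate_def using exec_Seq[OF 1(1) exec_Seq[OF 2(1) exec_Seq[OF 3(1) exec_Seq[OF 4(2) 5(2)]]]]
    by (simp add: 2(2))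
  have "k * (6 * (2 * (length x + 2 * t)) + 10) \<le> k * (24 * (length x + t) + 20)"
    by (intro mult_le_mono2) simp
  with 5(1) have "t5 \<le> k * (24 * (length x + t) + 20) + 2"
    by linarith
  moreover have "sim_time (length x + t) = k * (24 * (length x + t) + 20) + (24 * (length x + t) + 20)"
    by (simp add: sim_time_def)
  moreover have "4 * length x + 2 + (3 * t + 1 + (3 * t + 2 + (t4 + t5))) \<le>
      A + (24 * (length x + t) + 20)" if "t5 \<le> A + 2" for A
    using that 4(1) by simp
  ultimately have "4 * length x + 2 + (3 * t + 1 + (3 * t + 2 + (t4 + t5))) \<le> sim_time (length x + t)"
    by metis
  then show ?thesis
    using ex 5(3) by blast
qed

lemma runs_verdict:
  assumes "i \<notin> S" "j \<notin> S" "i \<noteq> j" "st i = map Bit (rev x)"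
    "(step M ^^ t) (initial M x) c" "halted M c"
  shows "runs (simulate i (verdict j)) st (sim_time (length x + t))
    (st(i := [], j := (if fst c \<in> accepting M then Bit True # st j else st j)))"
  unfolding runs_def
proof (intro allI impI)
  fix s assume "rep st s"
  show "\<exists>t' s'. t' \<le> sim_time (length x + t) \<and> exec (simulate i (verdict j)) s t' s' \<and>
      rep (st(i := [], j := (if fst c \<in> accepting M then Bit True # st j else st j))) s'"
  proof (rule exec_simulate[OF assms(1,4) \<open>rep st s\<close> assms(5,6)])
    fix s assume s: "frame (st(i := [])) s" "fst (s 21) = (\<lambda>_. Blank)"
      "\<forall>i\<in>{22..<22 + k}. segment (length x + 2 * t) (s i)" "state_tape (fst c) (s 20)"
    let ?s' = "if fst c \<in> accepting M then s(j := stk (Bit True # st j)) else s"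
    have r: "reads s 20 = Mark (fst c)"
      using state_tape_scanned[OF s(4)] by (simp add: reads_def)
    have j: "j \<notin> {20..<22 + k}"
      using assms(2) scratch by auto
    then have sj: "s j = stk (st j)" "Blank \<notin> set (st j)"
      using s(1) assms(2,3) by (auto simp: frame_def)
    have p: "exec (push j (Bit True)) s 2 (s(j := stk (Bit True # st j)))"
      using exec_Seq[OF exec_on[of j "\<lambda>r. (r j, MoveRight)" s] exec_on[of j "\<lambda>r. (Bit True, Stay)"]]
        stk_push[of "Bit True" "st j"] sj unfolding push_def by (simp add: reads_def numeral_2_eq_2)
    have "\<exists>t'\<le>4. exec (verdict j) s t' ?s'"
    proof (cases "fst c \<in> accepting M")
      case True
      then show ?thesis
        using exec_Cond_True[OF _ p, of "\<lambda>r. r 20 \<in> Mark ` accepting M" skip] r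
        unfolding verdict_def by (intro exI[of _ 4]) auto
    next
      case False
      have "exec skip s 1 s"
        using exec_Act[of keep s] by (simp add: skip_def)
      from exec_Cond_False[OF _ this, of "\<lambda>r. r 20 \<in> Mark ` accepting M"] show ?thesis
        using False r unfolding verdict_def by (intro exI[of _ 2]) (auto simp: numeral_2_eq_2)
    qed
    then obtain t' where t': "t' \<le> 4" "exec (verdict j) s t' ?s'"
      by blast
    have "\<forall>i\<in>{22..<22 + k}. segment (2 * (length x + 2 * t)) (?s' i)"
    proof
      fix i assume "i \<in> {22..<22 + k}"
      then have "segment (2 * (length x + 2 * t)) (s i)" "i \<noteq> j"
        using s(3) j segment_mono[of "length x + 2 * t" "s i" "2 * (length x + 2 * t)"] by auto
      then show "segment (2 * (length x + 2 * t)) (?s' i)"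
        by simp
    qed
    moreover have "frame (st(i := [], j := (if fst c \<in> accepting M then Bit True # st j else st j))) ?s'"
      using s(1) sj j assms(2,3) by (auto simp: frame_def)
    moreover have "fst (?s' 21) = (\<lambda>_. Blank)" "state_tape (fst c) (?s' 20)"
      using s(2,4) j k by auto
    ultimately show "\<exists>t' s'. t' \<le> 4 * (length x + 2 * t) + 4 \<and> exec (verdict j) s t' s' \<and>
        frame (st(i := [], j := (if fst c \<in> accepting M then Bit True # st j else st j))) s' \<and>
        fst (s' 21) = (\<lambda>_. Blank) \<and>
        (\<forall>i\<in>{22..<22 + k}. segment (2 * (length x + 2 * t)) (s' i)) \<and> state_tape (fst c) (s' 20)"
      using t' by (intro exI[of _ t'] exI[of _ ?s']) (simp del: fun_upd_apply)
  qed
qed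

lemma runs_read_word:
  assumes "i \<notin> S" "j \<notin> S" "i \<noteq> j" "st i = map Bit (rev x)"
    "(step M ^^ t) (initial M x) c" "halted M c" "outputs c w"
  shows "runs (simulate i (read_word j)) st (sim_time (length x + t)) (st(i := [], j := rev w @ st j))"
  unfolding runs_def
proof (intro allI impI)
  fix s assume "rep st s"
  show "\<exists>t' s'. t' \<le> sim_time (length x + t) \<and> exec (simulate i (read_word j)) s t' s' \<and>
      rep (st(i := [], j := rev w @ st j)) s'"
  proof (rule exec_simulate[OF assms(1,4) \<open>rep st s\<close> assms(5,6)])
    fix s assume s: "frame (st(i := [])) s" "fst (s 21) = (\<lambda>_. Blank)"
      "tape_rel b (fst (last (snd c)), 0) (s last_tape)"
      "\<forall>i\<in>{22..<22 + k}. segment (length x + 2 * t) (s i)" "state_tape (fst c) (s 20)"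
    have j: "j \<notin> {20..<22 + k}"
      using assms(2) scratch by auto
    then have sj: "s j = stk (st j)" "Blank \<notin> set (st j)"
      using s(1) assms(2,3) by (auto simp: frame_def)
    have seg: "segment (length x + 2 * t) (s last_tape)"
      using s(4) k by auto
    have w: "\<forall>i<length w. fst (last (snd c)) (0 + int i) = w ! i \<and> w ! i \<noteq> Blank"
        "fst (last (snd c)) (0 + int (length w)) = Blank"
      using assms(7) by (auto simp: outputs_def Let_def)
    have len: "length w \<le> length x + 2 * t"
    proof (rule output_length[OF s(3) seg])
      show "\<forall>i<length w. fst (last (snd c)) (int i) \<noteq> Blank"
        using w(1) by auto
    qed
    obtain s' where s': "exec (read_word j) s (4 * length w + 1) s'"
      "segment (length x + 2 * t + length w) (s' last_tape)"
      "s' j = stk (rev w @ st j)" "\<forall>i. i \<noteq> j \<longrightarrow> i \<noteq> last_tape \<longrightarrow> s' i = s i"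
      using exec_read_word[OF assms(2) s(3) seg sj(1) w] by blast
    have "segment (2 * (length x + 2 * t)) (s' i)" if "i \<in> {22..<22 + k}" for i
      using s'(2,4) s(4) that j len segment_mono[of "length x + 2 * t + length w" "s' i" "2 * (length x + 2 * t)"]
        segment_mono[of "length x + 2 * t" "s i" "2 * (length x + 2 * t)"]
      by (cases "i = last_tape"; cases "i = j") auto
    moreover have "Blank \<notin> set w"
      using w(1) by (auto simp: in_set_conv_nth)
    then have "frame (st(i := [], j := rev w @ st j)) s'"
      using s(1) sj s'(3,4) k assms(2) unfolding frame_def by auto
    moreover have "fst (s' 21) = (\<lambda>_. Blank)" "state_tape (fst c) (s' 20)"
      using s(2,5) s'(4) j k by auto
    ultimately show "\<exists>t' s'. t' \<le> 4 * (length x + 2 * t) + 4 \<and> exec (read_word j) s t' s' \<and>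
        frame (st(i := [], j := rev w @ st j)) s' \<and> fst (s' 21) = (\<lambda>_. Blank) \<and>
        (\<forall>i\<in>{22..<22 + k}. segment (2 * (length x + 2 * t)) (s' i)) \<and> state_tape (fst c) (s' 20)"
      using s'(1) len by (intro exI[of _ "4 * length w + 1"] exI[of _ s']) (simp del: fun_upd_apply)
  qed
qed

section \<open>Alphabet and locality of the simulating programs\<close>

definition sim_symbols :: "symbol set" where
  "sim_symbols = {Blank, Bit True, Mark 0, Mark 1, Mark 2, Mark b, Mark (start M)} \<union>
     (\<Union>(q, rs, q', as)\<in>instrs M. insert (Mark q') (fst ` set as))"

lemma finite_sim_symbols: "finite sim_symbols"
  using wf by (auto simp: sim_symbols_def machine_wf_def)

lemma local_to_sim_reads: "22 + k \<le> K \<Longrightarrow> local_to K sim_reads"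
  by (auto simp: local_to_def sim_reads_def)

lemma local_to_applicable: "22 + k \<le> K \<Longrightarrow> local_to K applicable"
  unfolding local_to_def
proof (intro allI impI)
  fix r r' :: reading assume "22 + k \<le> K" and r: "\<forall>i<K. r i = r' i"
  then have "sim_reads r = sim_reads r'" "r 20 = r' 20"
    using local_to_sim_reads[of K] unfolding local_to_def by auto
  then show "applicable r = applicable r'"
    by (simp add: applicable_def fun_eq_iff)
qed

lemma com_ok_on: "i < K \<Longrightarrow> local_to K g \<Longrightarrow> (\<And>r. (\<forall>m<K. r m \<in> G) \<Longrightarrow> fst (g r) \<in> G) \<Longrightarrow>
    com_ok K G (on i g)"
  by (auto simp: on_def acts_ok_def keep_def local_to_def)

lemma dec_blank_in: "a \<in> G \<Longrightarrow> Blank \<in> G \<Longrightarrow> dec_blank b a \<in> G"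
  by (simp add: dec_blank_def)

lemma enc_blank_in: "a \<in> G \<Longrightarrow> Mark b \<in> G \<Longrightarrow> enc_blank b a \<in> G"
  by (simp add: enc_blank_def)

lemma sim_symbolsI:
  assumes "sim_symbols \<subseteq> G"
  shows "Blank \<in> G" "Bit True \<in> G" "Mark b \<in> G" "Mark (start M) \<in> G" "Mark 0 \<in> G" "move_mark m \<in> G"
  using assms by (cases m; auto simp: sim_symbols_def)+

lemma com_ok_load:
  assumes "22 + k \<le> K" "i < K" "sim_symbols \<subseteq> G"
  shows "com_ok K G (load i)"
  using assms k sim_symbolsI[OF assms(3)]
  by (auto simp: load_def load_loop_def acts_ok_def keep_def local_to_def on_def)

lemma com_ok_main_loop:
  assumes "22 + k \<le> K" "sim_symbols \<subseteq> G"
  shows "com_ok K G main_loop"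
proof -
  have "local_to K (\<lambda>r. \<exists>x. applicable r x)"
    using local_to_applicable[OF assms(1)] by (rule local_to_comp)
  moreover have "local_to K (\<lambda>r. sim_acts r i)" if i: "i < K" for i
    unfolding local_to_def
  proof (intro allI impI)
    fix r r' :: reading assume r: "\<forall>i<K. r i = r' i"
    then have "applicable r = applicable r'"
      using local_to_applicable[OF assms(1)] unfolding local_to_def by blast
    then show "sim_acts r i = sim_acts r' i"
      using r i unfolding sim_acts_def by (auto simp: keep_def split: prod.splits)
  qed
  moreover have "fst (sim_acts r i) \<in> G" if i: "i < K" and r: "\<forall>i<K. r i \<in> G" for r i
  proof (cases "\<exists>x. applicable r x")
    case True
    obtain q' as where x: "(SOME x. applicable r x) = (q', as)"
      by (metis surj_pair)
    then have "applicable r (q', as)"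
      using True by (metis someI_ex)
    then obtain q where q: "(q, sim_reads r, q', as) \<in> instrs M"
      by (auto simp: applicable_def)
    have "Mark q' \<in> G"
      using q assms(2) unfolding sim_symbols_def by fastforce
    moreover have "fst (as ! m) \<in> G" if "m < k" for m
    proof -
      have "as ! m \<in> set as"
        using that instr_length[OF q] by simp
      then show ?thesis
        using q assms(2) unfolding sim_symbols_def by fastforce
    qed
    ultimately show ?thesis
      using True x i r sim_symbolsI[OF assms(2)] by (auto simp: sim_acts_def intro: enc_blank_in)
  next
    case False
    then show ?thesis
      using i r by (simp add: sim_acts_def keep_def)
  qed
  ultimately show ?thesis
    by (simp add: main_loop_def acts_ok_def)
qed

lemma com_ok_undo:
  assumes "22 + k \<le> K" "sim_symbols \<subseteq> G"
  shows "com_ok K G undo"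
  using assms k sim_symbolsI[OF assms(2)]
  by (auto simp: undo_def undo_loop_def acts_ok_def keep_def local_to_def on_def intro: enc_blank_in)

lemma com_ok_read_word:
  assumes "22 + k \<le> K" "j < K" "sim_symbols \<subseteq> G"
  shows "com_ok K G (read_word j)"
proof -
  have "local_to K (\<lambda>r. dec_blank b (r last_tape) \<noteq> Blank)"
    using assms(1) by (auto simp: local_to_def)
  then show ?thesis
    using assms sim_symbolsI[OF assms(3)]
    by (auto simp: read_word_def acts_ok_def keep_def local_to_def on_def intro: enc_blank_in dec_blank_in)
qed

lemma com_ok_verdict:
  assumes "22 + k \<le> K" "j < K" "sim_symbols \<subseteq> G"
  shows "com_ok K G (verdict j)"
  using assms sim_symbolsI[OF assms(3)] by (simp add: verdict_def)

lemma com_ok_wipe: "i < K \<Longrightarrow> Blank \<in> G \<Longrightarrow> Mark 0 \<in> G \<Longrightarrow> com_ok K G (wipe i)"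
  by (auto simp: wipe_def acts_ok_def keep_def local_to_def on_def)

lemma com_ok_wipe_all: "\<forall>i\<in>set is. i < K \<Longrightarrow> Blank \<in> G \<Longrightarrow> Mark 0 \<in> G \<Longrightarrow> com_ok K G (wipe_all is)"
  by (induction "is") (auto intro: com_ok_wipe)

lemma com_ok_simulate:
  assumes "22 + k \<le> K" "i < K" "sim_symbols \<subseteq> G" "com_ok K G post"
  shows "com_ok K G (simulate i post)"
  unfolding simulate_def
  using assms com_ok_load com_ok_main_loop com_ok_undo sim_symbolsI[OF assms(3)]
  by (auto intro!: com_ok_on com_ok_wipe_all)

end

section \<open>Ranks and certificates\<close>

text \<open>The position in length-lexicographic order, see \<open>llex_iff\<close>. It turns
  comparisons of strings into arithmetic.\<close>

definition val :: "bits \<Rightarrow> nat" where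
  "val x = bits_nat_rev (rev x)"

lemma val_inject: "val x = val y \<longleftrightarrow> x = y"
  unfolding val_def by (metis bits_nat_rev_inverse)

lemma val_nat_bits [simp]: "val (nat_bits n) = n"
  by (simp add: val_def nat_bits_inverse)

lemma rank_val: "rank A y = card {z \<in> A. val z \<le> val y}"
  unfolding rank_def llex_iff val_def[symmetric]
  by (rule arg_cong[of _ _ card]) (auto simp: val_inject[symmetric])

lemma finite_val_le: "finite {z. val z \<le> n}"
proof -
  have "{z. val z \<le> n} \<subseteq> nat_bits ` {..n}"
    by (auto simp: val_def image_iff) (metis atMost_iff bits_nat_rev_inverse)
  then show ?thesis
    by (rule finite_subset) simp
qed

text \<open>Strings of length \<open>n\<close> occupy the positions from \<open>2 ^ n - 1\<close> to
  \<open>2 ^ (n + 1) - 2\<close>; the inequalities avoid truncated subtraction.\<close>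

lemma val_bounds: "2 ^ length x \<le> val x + 1" "val x + 2 \<le> 2 ^ (length x + 1)"
proof -
  have "2 ^ length u \<le> bits_nat_rev u + 1 \<and> bits_nat_rev u + 2 \<le> 2 ^ (length u + 1)" for u
    by (induction u) auto
  from this[of "rev x"] show "2 ^ length x \<le> val x + 1" "val x + 2 \<le> 2 ^ (length x + 1)"
    by (simp_all add: val_def)
qed

lemma length_less_val_less: "length x < length y \<Longrightarrow> val x < val y"
proof -
  assume "length x < length y"
  then have "(2 :: nat) ^ (length x + 1) \<le> 2 ^ length y"
    by (intro power_increasing) auto
  with val_bounds[of x] val_bounds[of y] show ?thesis
    by linarith
qed

lemma val_le_length_le: "val y \<le> val x \<Longrightarrow> length y \<le> length x"
  using length_less_val_less by (metis leD leI)

lemma rank_mono: "val x \<le> val y \<Longrightarrow> rank A x \<le> rank A y"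
  unfolding rank_val by (rule card_mono) (auto intro: finite_subset[OF _ finite_val_le[of "val y"]])

lemma rank_less:
  assumes "val x < val y" "y \<in> A"
  shows "rank A x < rank A y"
  unfolding rank_val
proof (rule psubset_card_mono)
  show "finite {z \<in> A. val z \<le> val y}"
    by (rule finite_subset[OF _ finite_val_le[of "val y"]]) auto
  have "y \<in> {z \<in> A. val z \<le> val y}" "y \<notin> {z \<in> A. val z \<le> val x}"
    using assms by auto
  moreover have "{z \<in> A. val z \<le> val x} \<subseteq> {z \<in> A. val z \<le> val y}"
    using assms by auto
  ultimately show "{z \<in> A. val z \<le> val x} \<subset> {z \<in> A. val z \<le> val y}"
    by blast
qed

lemma rank_le_val: "rank A y \<le> val y + 1"
proof -
  have "rank A y \<le> card (nat_bits ` {..val y})"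
    unfolding rank_val
    by (rule card_mono) (auto simp: image_iff val_def, metis atMost_iff bits_nat_rev_inverse)
  also have "\<dots> \<le> val y + 1"
    using card_image_le[of "{..val y}" nat_bits] by simp
  finally show ?thesis .
qed

text \<open>The rank is at most \<open>val y + 1\<close>, which is less than
  \<open>2 ^ (length y + 1)\<close>, whereas a word of length \<open>length y + 2\<close> stands for
  a number of at least \<open>2 ^ (length y + 2) - 1\<close>.\<close>

lemma length_rank: "length (nat_bits (rank A y)) \<le> length y + 1"
proof (rule ccontr)
  assume "\<not> ?thesis"
  then have "(2 :: nat) ^ (length y + 2) \<le> 2 ^ length (nat_bits (rank A y))"
    by (intro power_increasing) auto
  then show False
    using val_bounds(1)[of "nat_bits (rank A y)"] val_bounds(2)[of y] rank_le_val[of A y] by simp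
qed

text \<open>A certificate for the rank of \<open>x\<close> consists of the neighbours of \<open>x\<close> in \<open>A\<close>; if nothing in \<open>A\<close> lies
  below \<open>x\<close>, then the empty string takes the place of the lower neighbour.\<close>

definition cert :: "bits set \<Rightarrow> bits \<Rightarrow> bits \<Rightarrow> bits \<Rightarrow> bool" where
  "cert A x y z \<longleftrightarrow> (y \<in> A \<or> y = []) \<and> z \<in> A \<and> val y \<le> val x \<and> val x < val z \<and> rank A z = rank A y + 1"

text \<open>Since \<open>z\<close> is in \<open>A\<close> and lies above \<open>x\<close>, the rank
  of \<open>x\<close> is less than \<open>rank A y + 1\<close>; by monotonicity it is at least
  \<open>rank A y\<close>.\<close>

lemma cert_rank: "cert A x y z \<Longrightarrow> rank A y = rank A x"
  using rank_mono[of y x A] rank_less[of x z A] by (auto simp: cert_def)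

lemma rank_Nil: "[] \<notin> A \<Longrightarrow> rank A [] = 0"
proof -
  have "val z \<le> val [] \<longleftrightarrow> z = []" for z
    using val_inject[of z "[]"] by (auto simp: val_def)
  then show "[] \<notin> A \<Longrightarrow> rank A [] = 0"
    by (auto simp: rank_val)
qed

lemma rank_pos: "y \<in> A \<Longrightarrow> 0 < rank A y"
  unfolding rank_val card_gt_0_iff
  by (auto intro: finite_subset[OF _ finite_val_le[of "val y"]])

lemma rank_inject:
  assumes "y \<in> A" "z \<in> A" "rank A y = rank A z"
  shows "y = z"
  using rank_less[of y z A] rank_less[of z y A] assms
  by (metis less_irrefl linorder_neqE_nat val_inject)

text \<open>The rank of \<open>x\<close> determines the ranks of \<open>y\<close> and
  \<open>z\<close>, and ranks determine elements of \<open>A\<close>. If \<open>y\<close> is the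
  substitute \<open>[]\<close> outside of \<open>A\<close>, its rank is \<open>0\<close>, which no
  element of \<open>A\<close> has; so the other lower neighbour is the substitute too.\<close>

lemma cert_unique:
  assumes "cert A x y z" "cert A x y' z'"
  shows "y = y'" "z = z'"
proof -
  have r: "rank A y = rank A y'"
    using assms cert_rank by metis
  then show "z = z'"
    using assms by (intro rank_inject[of z A z']) (auto simp: cert_def)
  show "y = y'"
  proof (cases "y \<in> A \<and> y' \<in> A")
    case True
    then show ?thesis
      using r rank_inject by blast
  next
    case False
    then show ?thesis
      using assms r rank_Nil[of A] rank_pos[of y A] rank_pos[of y' A] by (auto simp: cert_def)
  qed
qed

text \<open>The element \<open>z0\<close> bounds the search for the upper neighbour and thus its
  length. It is required to be longer than \<open>x\<close>, which puts it above
  \<open>x\<close>.\<close>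

lemma cert_exists:
  assumes "z0 \<in> A" "length x + 1 \<le> length z0"
  shows "\<exists>y z. cert A x y z \<and> length y \<le> length x \<and> length z \<le> length z0"
proof -
  have "z0 \<in> A \<and> val x < val z0"
    using assms length_less_val_less by simp
  then obtain z where z: "z \<in> A" "val x < val z" and least: "\<And>w. w \<in> A \<Longrightarrow> val x < val w \<Longrightarrow> val z \<le> val w"
    using ex_has_least_nat[of "\<lambda>z. z \<in> A \<and> val x < val z" z0 val] by blast
  obtain y where y: "y \<in> A \<or> y = []" "val y \<le> val x"
    and greatest: "\<And>w. w \<in> A \<Longrightarrow> val w \<le> val x \<Longrightarrow> val w \<le> val y"
  proof (cases "\<exists>w\<in>A. val w \<le> val x")
    case True
    then obtain w where "w \<in> A \<and> val w \<le> val x" by blast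
    \<comment> \<open>\<open>ex_has_greatest_nat\<close> asks for a strict bound, hence
      \<open>val x + 1\<close>.\<close>
    then obtain y where "y \<in> A \<and> val y \<le> val x" "\<forall>w. w \<in> A \<and> val w \<le> val x \<longrightarrow> val w \<le> val y"
      using ex_has_greatest_nat[of "\<lambda>w. w \<in> A \<and> val w \<le> val x" w val "val x + 1"] by auto
    then show ?thesis
      using that by blast
  next
    case False
    \<comment> \<open>Nothing in \<open>A\<close> is below \<open>x\<close>, so maximality is
      vacuous for \<open>[]\<close>, whose position is \<open>0\<close>.\<close>
    then show ?thesis
      using that[of "[]"] by (auto simp: val_def)
  qed
  \<comment> \<open>No element of \<open>A\<close> lies strictly between \<open>y\<close> and
    \<open>z\<close>: it would be at most \<open>y\<close> or at least \<open>z\<close>, depending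
    on its position relative to \<open>x\<close>.\<close>
  have "{w \<in> A. val w \<le> val z} = insert z {w \<in> A. val w \<le> val y}"
  proof -
    have "w = z \<or> val w \<le> val y" if "w \<in> A" "val w \<le> val z" for w
      using that least[of w] greatest[of w] val_inject[of w z] by linarith
    then show ?thesis
      using z y by auto
  qed
  moreover have "finite {w \<in> A. val w \<le> val y}"
    by (rule finite_subset[OF _ finite_val_le[of "val y"]]) auto
  ultimately have "rank A z = rank A y + 1"
    using z y unfolding rank_val by simp
  moreover have "val z \<le> val z0"
    using least assms length_less_val_less by simp
  ultimately show ?thesis
    using z y val_le_length_le unfolding cert_def by blast
qed

section \<open>Finite-state comparisons, least significant digit first\<close>

text \<open>Digits of bijective base-2 notation. A blank beyond the end of the shorter word counts
  as \<open>0\<close>, so words of different lengths can be compared digit by digit.\<close>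

fun digit :: "symbol \<Rightarrow> nat" where
  "digit (Bit b) = (if b then 2 else 1)"
| "digit a = 0"

text \<open>Digits come least significant first, so the last difference decides and overwrites the
  state: \<open>Mark 1\<close> for less, \<open>Mark 2\<close> for greater, \<open>Mark 0\<close>
  for equal so far.\<close>

definition cmp_step :: "symbol \<Rightarrow> symbol \<Rightarrow> symbol \<Rightarrow> symbol" where
  "cmp_step q a b = (if digit a < digit b then Mark 1 else if digit b < digit a then Mark 2
     else if q = Mark 1 \<or> q = Mark 2 then q else Mark 0)"

text \<open>\<open>Mark 1\<close> means that a \<open>1\<close> has still to be added,
  \<open>Mark 0\<close> that the remaining digits must agree, \<open>Mark 2\<close> failure. A carry
  turns the digit \<open>2\<close> into \<open>1\<close>, as
  \<open>2 + 1 = 1 + 2 * 1\<close>.\<close>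

definition succ_step :: "symbol \<Rightarrow> symbol \<Rightarrow> symbol \<Rightarrow> symbol" where
  "succ_step q a b =
     (if q = Mark 1 then
        if digit a + 1 = digit b then Mark 0 else if digit a = 2 \<and> digit b = 1 then Mark 1 else Mark 2
      else if q = Mark 0 \<and> digit a = digit b then Mark 0 else Mark 2)"

definition prefix_step :: "symbol \<Rightarrow> symbol \<Rightarrow> symbol \<Rightarrow> symbol" where
  "prefix_step q a b = (if q = Mark 0 \<and> (a = Blank \<or> a = b) then Mark 0 else Mark 1)"

definition longer_step :: "symbol \<Rightarrow> symbol \<Rightarrow> symbol \<Rightarrow> symbol" where
  "longer_step q a b = (if q = Mark 0 \<and> a \<noteq> Blank then Mark 0 else Mark 1)"

abbreviation bits :: "bits \<Rightarrow> symbol list" where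
  "bits u \<equiv> map Bit u"

lemma pairfold_bits_induct [case_names Nil_Nil Cons_Nil Nil_Cons Cons_Cons]:
  assumes "P [] []" "\<And>a u. P u [] \<Longrightarrow> P (a # u) []" "\<And>b w. P [] w \<Longrightarrow> P [] (b # w)"
    "\<And>a u b w. P u w \<Longrightarrow> P (a # u) (b # w)"
  shows "P u w"
  using assms by induction_schema (pat_completeness, lexicographic_order)

lemma pairfold_cmp:
  "q \<in> {Mark 0, Mark 1, Mark 2} \<Longrightarrow> pairfold cmp_step q (bits u) (bits w) =
    (if bits_nat_rev u < bits_nat_rev w then Mark 1
     else if bits_nat_rev w < bits_nat_rev u then Mark 2 else q)"
  by (induction u w arbitrary: q rule: pairfold_bits_induct) (auto simp: cmp_step_def)

lemma succ_step_simps: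
  "succ_step (Mark 0) a b = (if digit a = digit b then Mark 0 else Mark 2)"
  "succ_step (Mark 1) a b = (if digit a + 1 = digit b then Mark 0
     else if digit a = 2 \<and> digit b = 1 then Mark 1 else Mark 2)"
  "succ_step (Mark 2) a b = Mark 2"
  by (simp_all add: succ_step_def)

lemma prefix_step_simps:
  "prefix_step (Mark 0) a b = (if a = Blank \<or> a = b then Mark 0 else Mark 1)"
  "prefix_step (Mark 1) a b = Mark 1"
  by (simp_all add: prefix_step_def)

lemma longer_step_simps:
  "longer_step (Mark 0) a b = (if a = Blank then Mark 1 else Mark 0)"
  "longer_step (Mark 1) a b = Mark 1"
  by (simp_all add: longer_step_def)

lemma pairfold_succ_bad: "pairfold succ_step (Mark 2) (bits u) (bits w) = Mark 2"
  by (induction u w rule: pairfold_bits_induct) (simp_all add: succ_step_simps)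

text \<open>Both start states are treated together, because adding the pending \<open>1\<close>
  without a carry leads from the second to the first.\<close>

lemma pairfold_succ:
  "(pairfold succ_step (Mark 0) (bits u) (bits w) = Mark 0 \<longleftrightarrow> bits_nat_rev w = bits_nat_rev u) \<and>
   (pairfold succ_step (Mark 1) (bits u) (bits w) = Mark 0 \<longleftrightarrow> bits_nat_rev w = bits_nat_rev u + 1)"
proof (induction u w rule: pairfold_bits_induct)
  case (Cons_Cons a u b w)
  then show ?case
    by (cases a; cases b; (auto simp: succ_step_simps pairfold_succ_bad simp del: One_nat_def); presburger)
next
  case (Cons_Nil a u)
  show ?case
    by (simp add: succ_step_simps pairfold_succ_bad[of _ "[]", simplified] del: One_nat_def)
next
  case (Nil_Cons b w)
  then show ?case
    using pairfold_succ_bad[of "[]"]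
    by (cases b) (auto simp: succ_step_simps simp del: One_nat_def)
qed simp

lemma pairfold_prefix_bad: "pairfold prefix_step (Mark 1) (bits u) (bits w) = Mark 1"
  by (induction u w rule: pairfold_bits_induct) (simp_all add: prefix_step_simps del: One_nat_def)

lemma pairfold_prefix: "pairfold prefix_step (Mark 0) (bits u) (bits w) = Mark 0 \<longleftrightarrow> prefix u w"
  using pairfold_prefix_bad[of _ "[]"] pairfold_prefix_bad[of "[]"]
  by (induction u w rule: pairfold_bits_induct)
    (auto simp: prefix_step_simps pairfold_prefix_bad simp del: One_nat_def)

lemma pairfold_longer_bad: "pairfold longer_step (Mark 1) (bits u) (bits w) = Mark 1"
  by (induction u w rule: pairfold_bits_induct) (simp_all add: longer_step_simps del: One_nat_def)

lemma pairfold_longer: "pairfold longer_step (Mark 0) (bits u) (bits w) = Mark 0 \<longleftrightarrow> length w \<le> length u"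
  using pairfold_longer_bad[of "[]"]
  by (induction u w rule: pairfold_bits_induct)
    (auto simp: longer_step_simps pairfold_longer_bad simp del: One_nat_def)

section \<open>Polynomial bounds\<close>

lemma poly_nat_mono: "m \<le> n \<Longrightarrow> poly q m \<le> poly q n" for q :: "nat poly"
  by (induction q) (auto intro: mult_mono add_mono)

lemma poly_bounded_poly [simp]: "poly_bounded (poly q)"
  by (auto simp: poly_bounded_def)

lemma poly_bounded_const [simp]: "poly_bounded (\<lambda>n. c)"
  unfolding poly_bounded_def by (rule exI[of _ "[:c:]"]) simp

lemma poly_bounded_id [simp]: "poly_bounded (\<lambda>n. n)"
  unfolding poly_bounded_def by (rule exI[of _ "[:0, 1:]"]) simp

lemma poly_bounded_add [simp]:
  "poly_bounded T \<Longrightarrow> poly_bounded U \<Longrightarrow> poly_bounded (\<lambda>n. T n + U n)"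
  unfolding poly_bounded_def by (metis add_mono poly_add)

lemma poly_bounded_mult [simp]:
  "poly_bounded T \<Longrightarrow> poly_bounded U \<Longrightarrow> poly_bounded (\<lambda>n. T n * U n)"
  unfolding poly_bounded_def by (metis mult_mono poly_mult zero_le)

text \<open>\<open>T\<close> need not be monotone, but the polynomial that bounds it is.\<close>

lemma poly_bounded_compose:
  assumes "poly_bounded T" "poly_bounded U"
  shows "poly_bounded (\<lambda>n. T (U n))"
proof -
  obtain q r where q: "\<And>n. T n \<le> poly q n" and r: "\<And>n. U n \<le> poly r n"
    using assms by (auto simp: poly_bounded_def)
  have "T (U n) \<le> poly (pcompose q r) n" for n
    using q[of "U n"] poly_nat_mono[OF r[of n], of q] by (simp add: poly_pcompose)
  then show ?thesis
    unfolding poly_bounded_def by blast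
qed

lemma horner_value_mono: "m \<le> n \<Longrightarrow> horner_value as m \<le> horner_value as n"
  by (induction "as") (auto intro: add_mono mult_mono)

lemma horner_time_mono: "m \<le> n \<Longrightarrow> horner_time as m \<le> horner_time as n"
proof (induction "as")
  case (Cons a "as")
  then show ?case
    using horner_value_mono[OF Cons.prems] by (simp add: add_mono mult_mono)
qed simp

lemma poly_bounded_horner_value [simp]: "poly_bounded (horner_value as)"
proof (induction "as")
  case Nil
  then show ?case using poly_bounded_const[of 0] by simp
next
  case (Cons a "as")
  have "horner_value (a # as) = (\<lambda>n. a + n * horner_value as n)"
    by auto
  then show ?case
    using Cons by simp
qed

lemma poly_bounded_horner_time [simp]: "poly_bounded (horner_time as)"
proof (induction "as")
  case Nil
  have "horner_time [] = (\<lambda>n. 1)" by auto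
  then show ?case by simp
next
  case (Cons a "as")
  have "horner_time (a # as) =
      (\<lambda>n. horner_time as n + (horner_value as n * (10 * n + 10) + 2) + (2 * a + 1))"
    by auto
  then show ?case
    by (simp only:) (intro poly_bounded_add poly_bounded_mult Cons; simp)
qed

lemma path_relpow: "path M x cs \<Longrightarrow> (step M ^^ (length cs - 1)) (initial M x) (last cs)"
proof -
  have "successively (step M) (c # ds) \<Longrightarrow> (step M ^^ length ds) c (last (c # ds))" for c ds
  proof (induction ds arbitrary: c)
    case (Cons d ds)
    then have "step M c d" "(step M ^^ length ds) d (last (d # ds))"
      by simp_all
    from relpowp_Suc_I2[OF this] show ?case
      by simp
  qed simp
  then show "path M x cs \<Longrightarrow> (step M ^^ (length cs - 1)) (initial M x) (last cs)"
    unfolding path_def by (cases cs) auto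
qed

section \<open>Checking certificates\<close>

text \<open>\<open>F\<close> computes the semistrong ranking function of \<open>A\<close>. Tapes
  below \<open>20\<close> are ordinary stacks of the programs.\<close>

locale rank_computer = simulation S F b for S F b +
  fixes A :: "bits set" and q :: "nat poly"
  assumes F_time: "path F x cs \<Longrightarrow> length cs \<le> poly q (length x)"
    and F_output: "\<exists>cs. path F x cs \<and> halted F (last cs) \<and>
      outputs (last cs) (if x \<in> A then number (rank A x) else not_in_set)"
    and scratch20 [simp]: "i < 20 \<Longrightarrow> i \<notin> S"
begin

text \<open>Reading an output onto a stack leaves its last digit on top, so the programs meet ranks
  in this order.\<close>

definition rank_bits :: "bits \<Rightarrow> bits" where
  "rank_bits x = rev (nat_bits (rank A x))"

definition answer :: "bits \<Rightarrow> symbol list" where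
  "answer x = (if x \<in> A then bits (rank_bits x) else [Mark 0])"

definition answer_time :: "nat \<Rightarrow> nat" where
  "answer_time n = sim_time (n + poly q n)"

lemma sim_time_mono: "m \<le> n \<Longrightarrow> sim_time m \<le> sim_time n"
  unfolding sim_time_def by (intro mult_le_mono2) simp

lemma answer_time_mono: "m \<le> n \<Longrightarrow> answer_time m \<le> answer_time n"
  unfolding answer_time_def by (intro sim_time_mono add_mono poly_nat_mono)

lemma runs_answer:
  assumes "i \<notin> S" "j \<notin> S" "i \<noteq> j" "st i = bits (rev x)"
  shows "runs (simulate i (read_word j)) st (answer_time (length x)) (st(i := [], j := answer x @ st j))"
proof -
  let ?w = "if x \<in> A then number (rank A x) else not_in_set"
  obtain cs where cs: "path F x cs" "halted F (last cs)" "outputs (last cs) ?w"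
    using F_output by blast
  have "rev ?w = answer x"
    by (simp add: answer_def rank_bits_def number_def not_in_set_def rev_map)
  with runs_read_word[OF assms(1-3), of st x, OF assms(4) path_relpow[OF cs(1)] cs(2,3)]
  have "runs (simulate i (read_word j)) st (sim_time (length x + (length cs - 1)))
      (st(i := [], j := answer x @ st j))"
    by simp
  then show ?thesis
    by (rule runs_weaken) (use F_time[OF cs(1)] in \<open>simp add: answer_time_def sim_time_mono\<close>)
qed

lemma length_answer: "length (answer x) \<le> length x + 1"
  using length_rank[of A x] by (simp add: answer_def rank_bits_def)

lemma peek_answer: "peek (answer x) = Mark 0 \<longleftrightarrow> x \<notin> A"
  by (cases "rank_bits x") (auto simp: answer_def)

text \<open>Afterwards stack \<open>1\<close> is empty exactly if it held nothing but
  \<open>False\<close>, which is how paddings are tested.\<close>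

definition strip :: com where
  "strip = While (\<lambda>r. r 1 = Bit False) (transfer 1 {})"

lemma runs_strip:
  assumes "st 1 = bits u"
  shows "runs strip st (4 * length u + 1) (st(1 := bits (dropWhile Not u)))"
  using assms
proof (induction u arbitrary: st)
  case Nil
  have "runs strip st 1 st"
    unfolding strip_def by (rule runs_while_False) (use Nil in \<open>simp add: rep_reads scratch20\<close>)
  then show ?case
    using Nil by (simp add: fun_upd_idem)
next
  case (Cons a u)
  show ?case
  proof (cases a)
    case True
    have "runs strip st 1 st"
      unfolding strip_def by (rule runs_while_False) (use Cons.prems True in \<open>simp add: rep_reads scratch20\<close>)
    moreover have "st(1 := bits (dropWhile Not (a # u))) = st"
      using Cons.prems True by (simp add: fun_upd_idem)
    ultimately show ?thesis
      using runs_weaken[of strip st 1 st] by simp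
  next
    case False
    have 1: "runs (transfer 1 {}) st 2 (st(1 := bits u))"
      using runs_pop[of 1 st "Bit a" "bits u"] Cons.prems scratch20 by simp
    have 2: "runs strip (st(1 := bits u)) (4 * length u + 1) (st(1 := bits u, 1 := bits (dropWhile Not u)))"
      by (rule Cons.IH) simp
    have "runs strip st (2 + (4 * length u + 1) + 2) (st(1 := bits u, 1 := bits (dropWhile Not u)))"
      unfolding strip_def
      by (rule runs_while_True[OF _ 1 2[unfolded strip_def]])
        (use Cons.prems False in \<open>simp add: rep_reads scratch20\<close>)
    then show ?thesis
      using False by (simp add: eval_nat_numeral del: fun_upd_apply)
  qed
qed

lemma peek_bits: "peek (bits w) = Blank \<longleftrightarrow> w = []"
  by (cases w) auto

text \<open>Stack \<open>9\<close> collects failures and is empty iff all tests so far have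
  succeeded. A failed test does not abort, so there is a single course of the program to
  analyse.\<close>

definition flag :: "bool \<Rightarrow> symbol list \<Rightarrow> symbol list" where
  "flag c w = (if c then Bit True # w else w)"

lemma flag_Nil [simp]: "flag c w = [] \<longleftrightarrow> \<not> c \<and> w = []"
  by (simp add: flag_def)

lemma runs_flag:
  assumes "\<And>s. rep st s \<Longrightarrow> h (reads s) \<longleftrightarrow> c"
  shows "runs (fail_if 9 h) st 4 (st(9 := flag c (st 9)))"
  using runs_fail_if[of 9 st h c] assms scratch20[of 9] by (cases c) (simp_all add: flag_def)

lemma step_neq_Blank: "cmp_step s c d \<noteq> Blank" "succ_step s c d \<noteq> Blank" "prefix_step s c d \<noteq> Blank"
  "longer_step s c d \<noteq> Blank"
  by (simp_all add: cmp_step_def succ_step_def prefix_step_def longer_step_def)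

definition test :: "nat \<Rightarrow> nat \<Rightarrow> nat \<Rightarrow> (symbol \<Rightarrow> symbol \<Rightarrow> symbol \<Rightarrow> symbol) \<Rightarrow> nat \<Rightarrow> (symbol \<Rightarrow> bool) \<Rightarrow> com" where
  "test c i j d a P = push c (Mark a) ;; scan c i j d ;; fail_if 9 (\<lambda>r. P (r c)) ;; transfer c {}"

lemma runs_test:
  assumes "c < 20" "i < 20" "j < 20" "distinct [9, c, i, j]" "\<And>q a b. d q a b \<noteq> Blank"
    "st c = []" "st i = u" "st j = w"
  shows "runs (test c i j d a P) st (3 * (length u + length w) + 9)
    (st(i := [], j := [], 9 := flag (P (pairfold d (Mark a) u w)) (st 9)))"
proof -
  let ?f = "pairfold d (Mark a) u w"
  let ?s1 = "st(c := [Mark a])" and ?s2 = "st(c := [?f], i := [], j := [])"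
  let ?s3 = "?s2(9 := flag (P ?f) (st 9))"
  have 1: "runs (push c (Mark a)) st 2 ?s1"
    using runs_push[of c "Mark a" st] assms by simp
  have 2: "runs (scan c i j d) ?s1 (3 * (length u + length w) + 1) ?s2"
    using runs_scan[of c i j d ?s1 "Mark a" u w] assms by simp
  have 3: "runs (fail_if 9 (\<lambda>r. P (r c))) ?s2 4 ?s3"
    using runs_flag[of ?s2 "\<lambda>r. P (r c)" "P ?f"] assms by (simp add: rep_reads)
  have 4: "runs (transfer c {}) ?s3 2 (?s3(c := []))"
    using runs_pop[of c ?s3 ?f "[]"] assms by simp
  have "?s3(c := []) = st(i := [], j := [], 9 := flag (P ?f) (st 9))"
    using assms by (auto simp: fun_eq_iff)
  with runs_seq[OF 1 runs_seq[OF 2 runs_seq[OF 3 4]]] show ?thesis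
    unfolding test_def by (simp add: eval_nat_numeral)
qed

text \<open>The simulation consumes its argument, hence the copy on stack \<open>14\<close>.\<close>

definition ask :: "nat \<Rightarrow> nat \<Rightarrow> com" where
  "ask i j = duplicate i 14 15 ;; simulate 14 (read_word j)"

lemma runs_ask:
  assumes "i < 14" "j < 14" "st 14 = []" "st 15 = []" "st i = bits (rev x)"
  shows "runs (ask i j) st (8 * length x + 2 + answer_time (length x)) (st(j := answer x @ st j))"
proof -
  let ?s = "st(14 := bits (rev x))"
  have "runs (duplicate i 14 15) st (8 * length x + 2) ?s"
    using runs_duplicate[of i 14 15 st "bits (rev x)"] assms by simp
  moreover have "runs (simulate 14 (read_word j)) ?s (answer_time (length x)) (?s(14 := [], j := answer x @ ?s j))"
    by (rule runs_answer) (use assms in auto)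
  moreover have "?s(14 := [], j := answer x @ ?s j) = st(j := answer x @ st j)"
    using assms by (auto simp: fun_eq_iff)
  ultimately show ?thesis
    unfolding ask_def by (simp only: runs_seq)
qed

text \<open>Stack \<open>1\<close> holds the guess, \<open>2\<close> the string \<open>x\<close>,
  \<open>4\<close> the candidate prefix; \<open>y\<close> and \<open>z\<close> go to
  \<open>5\<close> and \<open>6\<close>, their ranks to \<open>7\<close> and \<open>8\<close>. If
  \<open>y\<close> is not in \<open>A\<close>, it must be empty; dropping the answer
  \<open>Mark 0\<close> then leaves the empty word, which denotes its rank \<open>0\<close>.\<close>

definition check_certificate :: "bool \<Rightarrow> com" where
  "check_certificate \<beta> =
     decode 1 5 ;; decode 1 6 ;; fail_if 9 (\<lambda>r. r 1 = Blank) ;; strip ;; fail_if 9 (\<lambda>r. r 1 \<noteq> Blank) ;;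
     ask 5 7 ;; ask 6 8 ;;
     Cond (\<lambda>r. r 7 = Mark 0) (fail_if 9 (\<lambda>r. r 5 \<noteq> Blank) ;; transfer 7 {}) skip ;;
     fail_if 9 (\<lambda>r. r 8 = Mark 0) ;;
     duplicate 2 14 15 ;; test 16 5 14 cmp_step 0 (\<lambda>a. a = Mark 2) ;;
     test 16 2 6 cmp_step 0 (\<lambda>a. a \<noteq> Mark 1) ;;
     duplicate 7 14 15 ;; test 16 14 8 succ_step 1 (\<lambda>a. a \<noteq> Mark 0) ;;
     test 16 4 7 prefix_step 0 (\<lambda>a. (a = Mark 0) \<noteq> \<beta>)"

definition certificate_time :: "nat \<Rightarrow> nat" where
  "certificate_time n = 200 * n + 200 + 2 * answer_time n"

lemma runs_check_certificate:
  assumes st: "st 1 = bits g" "st 2 = bits (rev x)" "st 4 = bits v"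
      "\<forall>i\<in>{5, 6, 7, 8, 9, 14, 15, 16}. st i = []"
    and len: "length g \<le> n" "length x \<le> n" "length v \<le> n"
    and y: "dec g = (y, g1)" and z: "dec g1 = (z, g2)"
  shows "\<exists>st'. runs (check_certificate \<beta>) st (certificate_time n) st' \<and>
    (st' 9 = [] \<longleftrightarrow> g2 \<noteq> [] \<and> set g2 \<subseteq> {False} \<and> cert A x y z \<and> (prefix v (rank_bits y) \<longleftrightarrow> \<beta>))"
proof -
  let ?o = "if y \<in> A then bits (rank_bits y) else []"
  have st0: "st 5 = []" "st 6 = []" "st 7 = []" "st 8 = []" "st 9 = []" "st 14 = []" "st 15 = []" "st 16 = []"
    using st(4) by simp_all
  \<comment> \<open>\<open>c1\<close> to \<open>c8\<close> trace the failure stack through the eight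
    tests, \<open>s1\<close> to \<open>s15\<close> all stacks through the fifteen parts of the
    program.\<close>
  define c1 c2 c3 where "c1 = flag (g2 = []) []" and "c2 = flag (dropWhile Not g2 \<noteq> []) c1"
    and "c3 = (if y \<in> A then c2 else flag (y \<noteq> []) c2)"
  define c4 c5 c6 where "c4 = flag (z \<notin> A) c3"
    and "c5 = flag (pairfold cmp_step (Mark 0) (bits (rev y)) (bits (rev x)) = Mark 2) c4"
    and "c6 = flag (pairfold cmp_step (Mark 0) (bits (rev x)) (bits (rev z)) \<noteq> Mark 1) c5"
  define c7 c8 where "c7 = flag (pairfold succ_step (Mark 1) ?o (answer z) \<noteq> Mark 0) c6"
    and "c8 = flag ((pairfold prefix_step (Mark 0) (bits v) ?o = Mark 0) \<noteq> \<beta>) c7"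
  define s1 where "s1 = st(1 := bits g1, 5 := bits (rev y))"
  define s2 where "s2 = s1(1 := bits g2, 6 := bits (rev z))"
  define s3 where "s3 = s2(9 := c1)"
  define s4 where "s4 = s3(1 := bits (dropWhile Not g2))"
  define s5 where "s5 = s4(9 := c2)"
  define s6 where "s6 = s5(7 := answer y)"
  define s7 where "s7 = s6(8 := answer z)"
  define s8 where "s8 = s7(9 := c3, 7 := ?o)"
  define s9 where "s9 = s8(9 := c4)"
  define s10 where "s10 = s9(14 := bits (rev x))"
  define s11 where "s11 = s10(5 := [], 14 := [], 9 := c5)"
  define s12 where "s12 = s11(2 := [], 6 := [], 9 := c6)"
  define s13 where "s13 = s12(14 := ?o)"
  define s14 where "s14 = s13(14 := [], 8 := [], 9 := c7)"
  define s15 where "s15 = s14(4 := [], 7 := [], 9 := c8)"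
  note d = s1_def s2_def s3_def s4_def s5_def s6_def s7_def s8_def s9_def s10_def s11_def s12_def s13_def
    s14_def
  have r1: "runs (decode 1 5) st (6 * length g + 3) s1"
    using runs_decode[of 1 5 st g] st st0 y unfolding s1_def by (simp add: rev_map)
  have r2: "runs (decode 1 6) s1 (6 * length g1 + 3) s2"
    using runs_decode[of 1 6 s1 g1] st0 z unfolding s2_def by (simp add: rev_map s1_def)
  have r3: "runs (fail_if 9 (\<lambda>r. r 1 = Blank)) s2 4 s3"
    using runs_flag[of s2 "\<lambda>r. r 1 = Blank" "g2 = []"] st0 by (simp add: rep_reads peek_bits d c1_def)
  have r4: "runs strip s3 (4 * length g2 + 1) s4"
    using runs_strip[of s3 g2] unfolding s4_def by (simp add: s3_def s2_def)
  have r5: "runs (fail_if 9 (\<lambda>r. r 1 \<noteq> Blank)) s4 4 s5"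
    using runs_flag[of s4 "\<lambda>r. r 1 \<noteq> Blank" "dropWhile Not g2 \<noteq> []"] unfolding s5_def
    by (simp add: rep_reads peek_bits s4_def s3_def c2_def del: dropWhile_eq_Nil_conv)
  have r6: "runs (ask 5 7) s5 (8 * length y + 2 + answer_time (length y)) s6"
    using runs_ask[of 5 7 s5 y] st0 unfolding s6_def by (simp add: d)
  have r7: "runs (ask 6 8) s6 (8 * length z + 2 + answer_time (length z)) s7"
    using runs_ask[of 6 8 s6 z] st0 unfolding s7_def by (simp add: d)
  have a: "s7 7 = answer y" "s7 5 = bits (rev y)" "s7 9 = c2"
    by (simp_all add: d)
  have r8: "runs (Cond (\<lambda>r. r 7 = Mark 0) (fail_if 9 (\<lambda>r. r 5 \<noteq> Blank) ;; transfer 7 {}) skip) s7 8 s8"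
  proof (cases "y \<in> A")
    case True
    have "s8 = s7"
      using a True by (auto simp: s8_def c3_def answer_def fun_eq_iff)
    moreover have "runs (Cond (\<lambda>r. r 7 = Mark 0) (fail_if 9 (\<lambda>r. r 5 \<noteq> Blank) ;; transfer 7 {}) skip) s7 (1 + 1) s7"
      by (rule runs_cond_False[OF _ runs_skip]) (use True a in \<open>simp add: rep_reads peek_answer\<close>)
    ultimately show ?thesis
      using runs_weaken[of _ s7 "1 + 1" s7 8] by simp
  next
    case False
    have "runs (fail_if 9 (\<lambda>r. r 5 \<noteq> Blank)) s7 4 (s7(9 := flag (y \<noteq> []) c2))"
      using runs_flag[of s7 "\<lambda>r. r 5 \<noteq> Blank" "y \<noteq> []"] a by (simp add: rep_reads peek_bits)
    moreover have "runs (transfer 7 {}) (s7(9 := flag (y \<noteq> []) c2)) 2 (s7(9 := flag (y \<noteq> []) c2, 7 := []))"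
      using runs_pop[of 7 "s7(9 := flag (y \<noteq> []) c2)" "Mark 0" "[]"] a False by (simp add: answer_def)
    ultimately have "runs (fail_if 9 (\<lambda>r. r 5 \<noteq> Blank) ;; transfer 7 {}) s7 (4 + 2)
        (s7(9 := flag (y \<noteq> []) c2, 7 := []))"
      by (rule runs_seq)
    moreover have "s8 = s7(9 := flag (y \<noteq> []) c2, 7 := [])"
      using False by (simp add: s8_def c3_def)
    ultimately have "runs (fail_if 9 (\<lambda>r. r 5 \<noteq> Blank) ;; transfer 7 {}) s7 (4 + 2) s8"
      by simp
    from runs_cond_True[OF _ this, of "\<lambda>r. r 7 = Mark 0"] show ?thesis
      using False a by (simp add: rep_reads peek_answer)
  qed
  have r9: "runs (fail_if 9 (\<lambda>r. r 8 = Mark 0)) s8 4 s9"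
    using runs_flag[of s8 "\<lambda>r. r 8 = Mark 0" "z \<notin> A"] unfolding s9_def
    by (simp add: rep_reads peek_answer s8_def s7_def c4_def)
  have r10: "runs (duplicate 2 14 15) s9 (8 * length x + 2) s10"
    using runs_duplicate[of 2 14 15 s9 "bits (rev x)"] st st0 unfolding s10_def by (simp add: d)
  have r11: "runs (test 16 5 14 cmp_step 0 (\<lambda>a. a = Mark 2)) s10 (3 * (length y + length x) + 9) s11"
    using runs_test[of 16 5 14 cmp_step s10 "bits (rev y)" "bits (rev x)" 0 "\<lambda>a. a = Mark 2"] st0
      step_neq_Blank
    unfolding s11_def c5_def by (simp add: d)
  have r12: "runs (test 16 2 6 cmp_step 0 (\<lambda>a. a \<noteq> Mark 1)) s11 (3 * (length x + length z) + 9) s12"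
    using runs_test[of 16 2 6 cmp_step s11 "bits (rev x)" "bits (rev z)" 0 "\<lambda>a. a \<noteq> Mark 1"] st st0
      step_neq_Blank
    unfolding s12_def c6_def by (simp add: d)
  have r13: "runs (duplicate 7 14 15) s12 (8 * length ?o + 2) s13"
    using runs_duplicate[of 7 14 15 s12 ?o] st0 unfolding s13_def by (simp add: d)
  have r14: "runs (test 16 14 8 succ_step 1 (\<lambda>a. a \<noteq> Mark 0)) s13 (3 * (length ?o + length (answer z)) + 9) s14"
    using runs_test[of 16 14 8 succ_step s13 ?o "answer z" 1 "\<lambda>a. a \<noteq> Mark 0"] st0 step_neq_Blank
    unfolding s14_def c7_def by (simp add: d)
  have r15: "runs (test 16 4 7 prefix_step 0 (\<lambda>a. (a = Mark 0) \<noteq> \<beta>)) s14 (3 * (length v + length ?o) + 9) s15"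
    using runs_test[of 16 4 7 prefix_step s14 "bits v" ?o 0 "\<lambda>a. (a = Mark 0) \<noteq> \<beta>"] st st0 step_neq_Blank
    unfolding s15_def c8_def by (simp add: d)
  note run = runs_seq[OF r1 runs_seq[OF r2 runs_seq[OF r3 runs_seq[OF r4 runs_seq[OF r5 runs_seq[OF r6
    runs_seq[OF r7 runs_seq[OF r8 runs_seq[OF r9 runs_seq[OF r10 runs_seq[OF r11 runs_seq[OF r12
    runs_seq[OF r13 runs_seq[OF r14 r15]]]]]]]]]]]]]]
  have lens: "length y \<le> n" "length g1 \<le> n" "length z \<le> n" "length g2 \<le> n"
    using length_dec[of g] length_dec[of g1] y z len(1) by auto
  have o: "length ?o \<le> n + 1" "length (answer z) \<le> n + 1"
    using length_answer[of y] length_answer[of z] lens by (auto simp: answer_def)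
  \<comment> \<open>The total time is bounded over plain variables, so that monotonicity replaces
    every length by \<open>n\<close> before any arithmetic is done.\<close>
  have "6 * l1 + 3 + (6 * l2 + 3 + (4 + (4 * l3 + 1 + (4 + (8 * l4 + 2 + t1 + (8 * l5 + 2 + t2 + (8 + (4 +
      (8 * l6 + 2 + (3 * (l4 + l6) + 9 + (3 * (l6 + l5) + 9 + (8 * l7 + 2 + (3 * (l7 + l8) + 9 +
      (3 * (l9 + l7) + 9)))))))))))))) \<le> 200 * n + 200 + 2 * t" (is "?sum \<le> _")
    if "l1 \<le> n" "l2 \<le> n" "l3 \<le> n" "l4 \<le> n" "l5 \<le> n" "l6 \<le> n" "l7 \<le> n + 1" "l8 \<le> n + 1" "l9 \<le> n"
      "t1 \<le> t" "t2 \<le> t" for l1 l2 l3 l4 l5 l6 l7 l8 l9 t1 t2 t :: nat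
  proof -
    have "?sum \<le> 6 * n + 3 + (6 * n + 3 + (4 + (4 * n + 1 + (4 + (8 * n + 2 + t + (8 * n + 2 + t + (8 + (4 +
      (8 * n + 2 + (3 * (n + n) + 9 + (3 * (n + n) + 9 + (8 * (n + 1) + 2 + (3 * ((n + 1) + (n + 1)) + 9 +
      (3 * (n + (n + 1)) + 9))))))))))))))"
      by (intro add_mono mult_le_mono2 order_refl that)
    then show ?thesis
      by simp
  qed
  from this[OF len(1) lens(2,4,1,3) len(2) o len(3) answer_time_mono[OF lens(1)] answer_time_mono[OF lens(3)]]
  have "runs (check_certificate \<beta>) st (certificate_time n) s15"
    unfolding check_certificate_def certificate_time_def by (rule runs_weaken[OF run])
  moreover have "s15 9 = [] \<longleftrightarrow> g2 \<noteq> [] \<and> set g2 \<subseteq> {False} \<and> cert A x y z \<and> (prefix v (rank_bits y) \<longleftrightarrow> \<beta>)"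
  proof -
    have "dropWhile Not g2 = [] \<longleftrightarrow> set g2 \<subseteq> {False}"
      by (auto simp: dropWhile_eq_Nil_conv)
    moreover have "pairfold cmp_step (Mark 0) (bits (rev y)) (bits (rev x)) = Mark 2 \<longleftrightarrow> val x < val y"
      "pairfold cmp_step (Mark 0) (bits (rev x)) (bits (rev z)) = Mark 1 \<longleftrightarrow> val x < val z"
      by (auto simp: pairfold_cmp val_def)
    \<comment> \<open>On stacks \<open>7\<close> and \<open>8\<close> there are ranks only if the
      membership tests have succeeded. Otherwise the flag is already raised, and these comparisons
      may have any result.\<close>
    moreover have "pairfold succ_step (Mark 1) ?o (answer z) = Mark 0 \<longleftrightarrow> rank A z = rank A y + 1"
      "pairfold prefix_step (Mark 0) (bits v) ?o = Mark 0 \<longleftrightarrow> prefix v (rank_bits y)"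
      if "z \<in> A" "y \<in> A \<or> y = []"
    proof -
      have o: "?o = bits (rank_bits y)"
        using that(2) rank_Nil[of A] by (auto simp: rank_bits_def)
      show "pairfold succ_step (Mark 1) ?o (answer z) = Mark 0 \<longleftrightarrow> rank A z = rank A y + 1"
        unfolding o using that(1) pairfold_succ[of "rank_bits y" "rank_bits z"]
        by (simp add: answer_def rank_bits_def nat_bits_inverse)
      show "pairfold prefix_step (Mark 0) (bits v) ?o = Mark 0 \<longleftrightarrow> prefix v (rank_bits y)"
        unfolding o by (rule pairfold_prefix)
    qed
    ultimately show ?thesis
      unfolding s15_def c8_def c7_def c6_def c5_def c4_def c3_def c2_def c1_def cert_def
      by auto
  qed
  ultimately show ?thesis
    by blast
qed

lemma com_ok_check_certificate:
  assumes "22 + k \<le> K" "sim_symbols \<subseteq> G"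
  shows "com_ok K G (check_certificate \<beta>)"
proof -
  have "Mark 1 \<in> G" "Mark 2 \<in> G"
    using assms(2) by (auto simp: sim_symbols_def)
  moreover have "com_ok K G (simulate 14 (read_word j))" if "j < 20" for j
    using assms that by (intro com_ok_simulate com_ok_read_word) auto
  ultimately show ?thesis
    unfolding check_certificate_def using assms(1) sim_symbolsI[OF assms(2)]
    by (auto simp: strip_def test_def ask_def local_to_def cmp_step_def succ_step_def prefix_step_def
        simp del: One_nat_def)
qed

end

section \<open>Queries, witnesses and the verifier\<close>

lemma stk_input: "stk (bits (rev x)) = (fst (input_tape x), int (length x) - 1)"
  by (auto simp: stk_def input_tape_def rev_map fun_eq_iff)

text \<open>Input and guess appear reversed, because the heads stand on their last letters.\<close>

definition initial_stacks :: "bits \<Rightarrow> bits \<Rightarrow> stacks" where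
  "initial_stacks x g = (\<lambda>i. if i = 0 then bits (rev x) else if i = 1 then bits (rev g) else [])"

lemma (in stack_programs) rep_initial:
  assumes "0 \<notin> S" "1 \<notin> S"
  shows "rep (initial_stacks x g) (begin_store x g)"
proof -
  have "stk [] = (\<lambda>_. Blank, -1)"
    by (auto simp: stk_def fun_eq_iff)
  then show ?thesis
    using assms stk_input[of x] stk_input[of g]
    by (auto simp: rep_def initial_stacks_def begin_store_def)
qed

text \<open>The required padding for a subject of length \<open>n\<close> is the maximal length of a
  certificate: \<open>2 * n + 1\<close> for the code of \<open>y\<close>,
  \<open>2 * poly p (n + 1) + 1\<close> for that of \<open>z\<close>, and one letter to keep the
  rest nonempty. The argument \<open>n + 1\<close> yields an element of \<open>A\<close> longer than
  the subject.\<close>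

locale nongappy_rank_computer = rank_computer +
  fixes p :: "nat poly" and as :: "nat list"
  assumes nongappy: "\<exists>y\<in>A. n \<le> length y \<and> length y \<le> poly p n"
    and pad_length: "horner_value as n = 2 * n + 2 * poly p (n + 1) + 3"
begin

text \<open>A query \<open>u\<close> is the reversal of \<open>code x @ code v @ pad\<close>. It asks whether \<open>v\<close> is a prefix of
  the rank of \<open>x\<close>, written with the least significant digit first. The padding makes room for a
  certificate of the same length as the query.\<close>

definition subject :: "bits \<Rightarrow> bits" where
  "subject u = fst (dec (rev u))"

definition candidate :: "bits \<Rightarrow> bits" where
  "candidate u = fst (dec (snd (dec (rev u))))"

definition padding :: "bits \<Rightarrow> bits" where
  "padding u = snd (dec (snd (dec (rev u))))"

text \<open>Malformed queries fail this test too: their padding is empty, while at least three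
  letters are required.\<close>

definition padded :: "bits \<Rightarrow> bool" where
  "padded u \<longleftrightarrow> horner_value as (length (subject u)) \<le> length (padding u)"

definition prefix_lang :: "bits set" where
  "prefix_lang = {u. padded u \<and> prefix (candidate u) (rank_bits (subject u))}"

text \<open>Insufficiently padded queries lie outside of \<open>prefix_lang\<close>. The complement
  needs exactly one witness for them as well, and the all-\<open>False\<close> word is
  chosen.\<close>

definition witness :: "bool \<Rightarrow> bits \<Rightarrow> bits \<Rightarrow> bool" where
  "witness \<beta> u g \<longleftrightarrow> (if padded u then
     (case dec (rev g) of (y, g1) \<Rightarrow> case dec g1 of (z, g2) \<Rightarrow>
        g2 \<noteq> [] \<and> set g2 \<subseteq> {False} \<and> cert A (subject u) y z \<and> (prefix (candidate u) (rank_bits y) \<longleftrightarrow> \<beta>))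
     else \<not> \<beta> \<and> set g \<subseteq> {False})"

lemma False_replicate: "set w \<subseteq> {False} \<Longrightarrow> w = replicate (length w) False"
  by (induction w) auto

lemma witness_cert:
  assumes "padded u" "witness \<beta> u g"
  obtains y z m where "cert A (subject u) y z" "prefix (candidate u) (rank_bits y) \<longleftrightarrow> \<beta>"
    "rev g = code y @ code z @ replicate m False"
proof -
  obtain y g1 where y: "dec (rev g) = (y, g1)" by fastforce
  obtain z g2 where z: "dec g1 = (z, g2)" by fastforce
  have w: "g2 \<noteq> []" "set g2 \<subseteq> {False}" "cert A (subject u) y z" "prefix (candidate u) (rank_bits y) \<longleftrightarrow> \<beta>"
    using assms y z by (auto simp: witness_def)
  have g1: "g1 = code z @ g2"
    using dec_complete[of g1] z w(1) by simp
  then have "g1 \<noteq> []"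
    by (metis append_is_Nil_conv w(1))
  then have "rev g = code y @ g1"
    using dec_complete[of "rev g"] y by simp
  then show ?thesis
    using that[OF w(3,4)] g1 False_replicate[OF w(2)] by metis
qed

text \<open>\<open>y\<close> and \<open>z\<close> are unique, their codes are fixed, and the number
  of padding letters follows from the prescribed length.\<close>

lemma witness_unique:
  assumes "length g = length u" "length g' = length u" "witness \<beta> u g" "witness \<beta> u g'"
  shows "g = g'"
proof (cases "padded u")
  case True
  obtain y z m where 1: "cert A (subject u) y z" "rev g = code y @ code z @ replicate m False"
    using witness_cert[OF True assms(3)] by metis
  obtain y' z' m' where 2: "cert A (subject u) y' z'" "rev g' = code y' @ code z' @ replicate m' False"
    using witness_cert[OF True assms(4)] by metis
  have yz: "y = y'" "z = z'"
    using cert_unique[OF 1(1) 2(1)] by auto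
  have "length (rev g) = length (rev g')"
    using assms by simp
  then have "m = m'"
    unfolding 1(2) 2(2) yz by simp
  then have "rev g = rev g'"
    using 1(2) 2(2) yz by simp
  then show ?thesis
    by simp
next
  case False
  then have "g = replicate (length u) False" "g' = replicate (length u) False"
    using assms False_replicate[of g] False_replicate[of g'] by (auto simp: witness_def)
  then show ?thesis
    by simp
qed

text \<open>Every witness reveals the rank of the subject, so \<beta> only selects which outcome of
  the prefix test is accepted. This gives both the language and its complement.\<close>

lemma witness_iff: "(\<exists>g. length g = length u \<and> witness \<beta> u g) \<longleftrightarrow> (u \<in> prefix_lang \<longleftrightarrow> \<beta>)"
proof (cases "padded u")
  case True
  have "prefix (candidate u) (rank_bits (subject u)) \<longleftrightarrow> \<beta>" if "witness \<beta> u g" for g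
    using witness_cert[OF True that] cert_rank unfolding rank_bits_def by metis
  moreover have "\<exists>g. length g = length u \<and> witness \<beta> u g"
    if \<beta>: "prefix (candidate u) (rank_bits (subject u)) \<longleftrightarrow> \<beta>"
  proof -
    let ?x = "subject u"
    obtain z0 where "z0 \<in> A" "length ?x + 1 \<le> length z0" "length z0 \<le> poly p (length ?x + 1)"
      using nongappy by blast
    then obtain y z where yz: "cert A ?x y z" "length y \<le> length ?x" "length z \<le> poly p (length ?x + 1)"
      using cert_exists[of z0 A ?x] by fastforce
    have "length (padding u) \<le> length u"
      using length_dec[of "rev u"] length_dec[of "snd (dec (rev u))"] by (simp add: padding_def)
    \<comment> \<open>The left side is at most the required padding, which is at most
      \<open>length (padding u)\<close>.\<close>
    then have "2 * length y + 2 * length z + 3 \<le> length u"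
      using True yz pad_length[of "length ?x"] by (simp add: padded_def)
    then have len: "length (code y @ code z @ replicate m False) = length u" "m \<noteq> 0"
      if "m = length u - (2 * length y + 2 * length z + 2)" for m
      using that by auto
    \<comment> \<open>What remains of \<open>length u\<close> after the two codes; the constant
      \<open>3\<close> above makes it positive.\<close>
    define m where "m = length u - (2 * length y + 2 * length z + 2)"
    let ?g = "rev (code y @ code z @ replicate m False)"
    have "dec (rev ?g) = (y, code z @ replicate m False)"
      unfolding rev_rev_ident by (rule dec_code)
    moreover have "dec (code z @ replicate m False) = (z, replicate m False)"
      by (rule dec_code)
    moreover have "rank_bits y = rank_bits ?x"
      using cert_rank[OF yz(1)] by (simp add: rank_bits_def)
    ultimately have "witness \<beta> u ?g"
      using True yz(1) \<beta> len(2)[OF m_def] by (simp add: witness_def)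
    then show ?thesis
      using len(1)[OF m_def] by (intro exI[of _ ?g]) simp
  qed
  ultimately show ?thesis
    using True by (auto simp: prefix_lang_def)
next
  case False
  have "witness False u (replicate (length u) False)"
    using False by (auto simp: witness_def)
  then show ?thesis
    using False by (auto simp: witness_def prefix_lang_def intro!: exI[of _ "replicate (length u) False"])
qed

text \<open>After decoding, stack \<open>0\<close> holds the padding, which is compared with the
  unary length on stack \<open>11\<close>. Draining \<open>3\<close> to \<open>4\<close> brings the
  first letter of the candidate to the top, as the prefix test requires. In the other branch the
  guess must consist of \<open>False\<close> only, and for \<beta> it is rejected in any
  case.\<close>

definition witness_program :: "bool \<Rightarrow> com" where
  "witness_program \<beta> =
     decode 0 2 ;; decode 0 3 ;; drain 3 {4} ;; horner 2 11 12 13 as ;;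
     push 10 (Mark 0) ;; scan 10 0 11 longer_step ;;
     Cond (\<lambda>r. r 10 = Mark 0) (check_certificate \<beta>)
       (strip ;; fail_if 9 (\<lambda>r. r 1 \<noteq> Blank) ;; (if \<beta> then push 9 (Bit True) else skip))"

definition witness_time :: "nat \<Rightarrow> nat" where
  "witness_time n = 20 * n + 20 + horner_time as n + 3 * horner_value as n + certificate_time n"

lemma runs_witness_program:
  assumes "length g = length u"
  shows "\<exists>st'. runs (witness_program \<beta>) (initial_stacks u g) (witness_time (length u)) st' \<and>
    (st' 9 = [] \<longleftrightarrow> witness \<beta> u g)"
proof -
  let ?n = "length u" and ?x = "subject u" and ?v = "candidate u" and ?pad = "padding u"
  let ?q = "pairfold longer_step (Mark 0) (bits ?pad) (bits (replicate (horner_value as (length ?x)) False))"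
  let ?u1 = "snd (dec (rev u))"
  define s0 where "s0 = initial_stacks u g"
  define s1 where "s1 = s0(0 := bits ?u1, 2 := bits (rev ?x))"
  define s2 where "s2 = s1(0 := bits ?pad, 3 := bits (rev ?v))"
  define s3 where "s3 = s2(3 := [], 4 := bits ?v)"
  define s4 where "s4 = s3(11 := bits (replicate (horner_value as (length ?x)) False))"
  define s5 where "s5 = s4(10 := [Mark 0])"
  define s6 where "s6 = s5(10 := [?q], 0 := [], 11 := [])"
  note d = s0_def s1_def s2_def s3_def s4_def s5_def s6_def initial_stacks_def
  have r1: "runs (decode 0 2) s0 (6 * ?n + 3) s1"
    using runs_decode[of 0 2 s0 "rev u"] unfolding s1_def
    by (simp add: s0_def initial_stacks_def subject_def rev_map)
  have r2: "runs (decode 0 3) s1 (6 * length ?u1 + 3) s2"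
    using runs_decode[of 0 3 s1 ?u1] unfolding s2_def
    by (simp add: s1_def s0_def initial_stacks_def candidate_def padding_def rev_map)
  have r3: "runs (drain 3 {4}) s2 (4 * length ?v + 1) s3"
    using runs_drain[of 3 4 s2 "bits (rev ?v)"] unfolding s3_def
    by (simp add: s2_def s1_def s0_def initial_stacks_def rev_map)
  have r4: "runs (horner 2 11 12 13 as) s3 (horner_time as (length ?x)) s4"
    using runs_horner[of 2 11 12 13 s3 "length ?x" as] unfolding s4_def
    by (simp add: s3_def s2_def s1_def s0_def initial_stacks_def)
  have r5: "runs (push 10 (Mark 0)) s4 2 s5"
    using runs_push[of 10 "Mark 0" s4] unfolding s5_def by (simp add: d)
  have r6: "runs (scan 10 0 11 longer_step) s5 (3 * (length ?pad + horner_value as (length ?x)) + 1) s6"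
    using runs_scan[of 10 0 11 longer_step s5 "Mark 0" "bits ?pad"
        "bits (replicate (horner_value as (length ?x)) False)"] step_neq_Blank
    unfolding s6_def by (simp add: d)
  have q: "?q = Mark 0 \<longleftrightarrow> padded u"
    using pairfold_longer[of ?pad "replicate (horner_value as (length ?x)) False"] by (simp add: padded_def)
  have at: "s6 1 = bits (rev g)" "s6 2 = bits (rev ?x)" "s6 4 = bits ?v" "s6 9 = []"
      "\<forall>i\<in>{5, 6, 7, 8, 9, 14, 15, 16}. s6 i = []" "s6 10 = [?q]"
    by (simp_all add: d)
  have lens: "length ?x \<le> ?n" "length ?v \<le> ?n" "length ?u1 \<le> ?n" "length ?pad \<le> ?n"
    using length_dec[of "rev u"] length_dec[of ?u1]
    by (simp_all add: subject_def candidate_def padding_def)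
  have "\<exists>st'. runs (Cond (\<lambda>r. r 10 = Mark 0) (check_certificate \<beta>)
       (strip ;; fail_if 9 (\<lambda>r. r 1 \<noteq> Blank) ;; (if \<beta> then push 9 (Bit True) else skip)))
     s6 (certificate_time ?n + 2) st' \<and> (st' 9 = [] \<longleftrightarrow> witness \<beta> u g)"
  proof (cases "padded u")
    case True
    obtain y g1 where y: "dec (rev g) = (y, g1)" by fastforce
    obtain z g2 where z: "dec g1 = (z, g2)" by fastforce
    have "length (rev g) \<le> ?n"
      using assms by simp
    from runs_check_certificate[OF at(1,2,3,5) this lens(1,2) y z, of \<beta>] obtain st' where
      st': "runs (check_certificate \<beta>) s6 (certificate_time ?n) st'"
        "st' 9 = [] \<longleftrightarrow> g2 \<noteq> [] \<and> set g2 \<subseteq> {False} \<and> cert A ?x y z \<and> (prefix ?v (rank_bits y) \<longleftrightarrow> \<beta>)"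
      by blast
    have "reads s 10 = Mark 0" if "rep s6 s" for s
      using that True q at(6) by (simp add: rep_reads)
    from runs_cond_True[of s6 "\<lambda>r. r 10 = Mark 0", OF this st'(1)] show ?thesis
      using st'(2) True y z unfolding witness_def by fastforce
  next
    case False
    define s7 where "s7 = s6(1 := bits (dropWhile Not (rev g)))"
    define s8 where "s8 = s7(9 := flag (dropWhile Not (rev g) \<noteq> []) [])"
    define s9 where "s9 = (if \<beta> then s8(9 := Bit True # s8 9) else s8)"
    have r7: "runs strip s6 (4 * length (rev g) + 1) s7"
      unfolding s7_def by (rule runs_strip) (rule at)
    have r8: "runs (fail_if 9 (\<lambda>r. r 1 \<noteq> Blank)) s7 4 s8"
      using runs_flag[of s7 "\<lambda>r. r 1 \<noteq> Blank" "dropWhile Not (rev g) \<noteq> []"] at(4)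
      unfolding s8_def by (simp add: rep_reads peek_bits s7_def del: dropWhile_eq_Nil_conv)
    have r9: "runs (if \<beta> then push 9 (Bit True) else skip) s8 2 s9"
      using runs_push[of 9 "Bit True" s8] runs_weaken[OF runs_skip[of s8], of 2] by (simp add: s9_def)
    have "\<not> reads s 10 = Mark 0" if "rep s6 s" for s
      using that False q at(6) by (simp add: rep_reads)
    from runs_cond_False[of s6 "\<lambda>r. r 10 = Mark 0", OF this runs_seq[OF r7 runs_seq[OF r8 r9]]]
    have "runs (Cond (\<lambda>r. r 10 = Mark 0) (check_certificate \<beta>)
       (strip ;; fail_if 9 (\<lambda>r. r 1 \<noteq> Blank) ;; (if \<beta> then push 9 (Bit True) else skip)))
       s6 (certificate_time ?n + 2) s9"
      by (rule runs_weaken) (use assms in \<open>simp_all add: certificate_time_def\<close>)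
    moreover have "s9 9 = [] \<longleftrightarrow> witness \<beta> u g"
      using False by (auto simp: s9_def s8_def witness_def)
    ultimately show ?thesis
      by blast
  qed
  then obtain st' where st': "runs (Cond (\<lambda>r. r 10 = Mark 0) (check_certificate \<beta>)
       (strip ;; fail_if 9 (\<lambda>r. r 1 \<noteq> Blank) ;; (if \<beta> then push 9 (Bit True) else skip)))
     s6 (certificate_time ?n + 2) st'" "st' 9 = [] \<longleftrightarrow> witness \<beta> u g"
    by blast
  have "runs (witness_program \<beta>) s0 (witness_time ?n) st'"
    unfolding witness_program_def
    by (rule runs_weaken[OF runs_seq[OF r1 runs_seq[OF r2 runs_seq[OF r3 runs_seq[OF r4
        runs_seq[OF r5 runs_seq[OF r6 st'(1)]]]]]]])
      (use lens horner_time_mono[OF lens(1), of as] horner_value_mono[OF lens(1), of as] in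
        \<open>simp add: witness_time_def\<close>)
  then show ?thesis
    using st'(2) unfolding s0_def by blast
qed

lemma poly_bounded_answer_time: "poly_bounded answer_time"
  unfolding answer_time_def sim_time_def by (intro poly_bounded_add poly_bounded_mult) simp_all

lemma poly_bounded_witness_time: "poly_bounded witness_time"
  unfolding witness_time_def certificate_time_def
  by (intro poly_bounded_add poly_bounded_mult poly_bounded_answer_time) simp_all

lemma com_ok_witness_program:
  assumes "22 + k \<le> K" "sim_symbols \<subseteq> G" "Bit False \<in> G"
  shows "com_ok K G (witness_program \<beta>)"
  unfolding witness_program_def
  using assms com_ok_check_certificate[OF assms(1,2)] sim_symbolsI[OF assms(2)]
  by (auto simp: strip_def longer_step_def sim_symbols_def simp del: One_nat_def)

lemma witness_lang_UP: "{u. u \<in> prefix_lang \<longleftrightarrow> \<beta>} \<in> class_UP"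
proof -
  let ?K = "22 + k" and ?G = "insert (Bit False) sim_symbols"
  interpret compiled_decider ?K ?G UNIV 9 "witness_program \<beta>" witness_time "witness \<beta>"
  proof
    show "com_ok ?K ?G (witness_program \<beta>)"
      by (rule com_ok_witness_program) auto
    show "finite ?G"
      using finite_sim_symbols by simp
    show "Blank \<in> ?G" "Bit True \<in> ?G" "Bit False \<in> ?G"
      by (auto simp: sim_symbols_def)
    show "poly_bounded witness_time"
      by (rule poly_bounded_witness_time)
    fix u g :: bits assume "length g = length u"
    then obtain st' where st': "runs (witness_program \<beta>) (initial_stacks u g) (witness_time (length u)) st'"
        "st' 9 = [] \<longleftrightarrow> witness \<beta> u g"
      using runs_witness_program by blast
    have "rep (initial_stacks u g) (begin_store u g)"
      by (rule rep_initial) (simp_all add: scratch20)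
    with st'(1) obtain t s' where "t \<le> witness_time (length u)"
        "exec (witness_program \<beta>) (begin_store u g) t s'" "rep st' s'"
      unfolding runs_def by blast
    moreover from this(3) have "scanned (s' 9) = Blank \<longleftrightarrow> st' 9 = []"
      using rep_tape[of st' s' 9] rep_nonblank[of st' s' 9] scratch20[of 9] by (cases "st' 9") auto
    ultimately show "\<exists>t s'. t \<le> witness_time (length u) \<and>
        exec (witness_program \<beta>) (begin_store u g) t s' \<and> (scanned (s' 9) = Blank \<longleftrightarrow> witness \<beta> u g)"
      using st'(2) by blast
  qed auto
  have "{u. \<exists>g. length g = length u \<and> set g \<subseteq> UNIV \<and> witness \<beta> u g} \<in> class_UP"
    by (rule lang_in_UP) (rule witness_unique)
  then show ?thesis
    by (simp add: witness_iff)
qed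

lemma prefix_lang_UP_coUP: "prefix_lang \<in> class_UP \<inter> class_coUP"
proof -
  have "prefix_lang \<in> class_UP" "- prefix_lang \<in> class_UP"
    using witness_lang_UP[of True] witness_lang_UP[of False] by (simp_all add: Compl_eq)
  then show ?thesis
    unfolding class_coUP_def by (metis (mono_tags, lifting) IntI double_complement mem_Collect_eq)
qed

end

section \<open>Halting computations of deterministic machines\<close>

lemma deterministic_step: "deterministic M \<Longrightarrow> step M c c1 \<Longrightarrow> step M c c2 \<Longrightarrow> c1 = c2"
  unfolding deterministic_def by (auto elim!: step.cases) metis

lemma deterministic_halting:
  assumes "deterministic M"
  shows "(step M ^^ t) c d \<Longrightarrow> halted M d \<Longrightarrow> (step M ^^ t') c d' \<Longrightarrow> halted M d' \<Longrightarrow> d = d'"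
proof (induction t arbitrary: c t')
  case 0
  show ?case
  proof (cases t')
    case (Suc u)
    then obtain c1 where "step M c c1"
      using 0(3) by (metis relpowp_Suc_D2)
    then show ?thesis
      using 0(1,2) by (cases c1) (auto simp: halted_def)
  qed (use 0 in auto)
next
  case (Suc t)
  obtain c1 where c1: "step M c c1" "(step M ^^ t) c1 d"
    using Suc.prems(1) by (metis relpowp_Suc_D2)
  show ?case
  proof (cases t')
    case 0
    then show ?thesis
      using Suc.prems(3,4) c1(1) by (cases c1) (auto simp: halted_def)
  next
    case (Suc u)
    then obtain c2 where c2: "step M c c2" "(step M ^^ u) c2 d'"
      using Suc.prems(3) by (metis relpowp_Suc_D2)
    have "c1 = c2"
      using deterministic_step[OF assms c1(1) c2(1)] .
    then show ?thesis
      using Suc.IH[OF c1(2) Suc.prems(2)] c2(2) Suc.prems(4) by blast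
  qed
qed

text \<open>Polynomial time bounds all partial paths, so a longest path exists, and it cannot be
  continued.\<close>

lemma halting_path:
  assumes "poly_time M"
  shows "\<exists>cs. path M x cs \<and> halted M (last cs)"
proof -
  obtain q :: "nat poly" where q: "\<And>cs. path M x cs \<Longrightarrow> length cs \<le> poly q (length x)"
    using assms by (auto simp: poly_time_def)
  have "path M x [initial M x]"
    by (simp add: path_def)
  \<comment> \<open>The \<open>+ 1\<close> makes the bound strict, as
    \<open>ex_has_greatest_nat\<close> demands.\<close>
  then obtain cs where cs: "path M x cs" "\<And>ds. path M x ds \<Longrightarrow> length ds \<le> length cs"
    using ex_has_greatest_nat[of "path M x" _ length "poly q (length x) + 1"] q
    by (metis add.commute le_imp_less_Suc plus_1_eq_Suc)
  have False if "step M (last cs) c" for c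
  proof -
    have "path M x (cs @ [c])"
      using cs(1) that by (auto simp: path_def successively_append_iff)
    from cs(2)[OF this] show False
      by simp
  qed
  then show ?thesis
    using cs(1) by (auto simp: halted_def)
qed

text \<open>All halted paths of a deterministic machine end in the same configuration, so simulating
  one of them decides membership.\<close>

lemma lang_iff:
  assumes "deterministic M" "path M x cs" "halted M (last cs)"
  shows "x \<in> lang M \<longleftrightarrow> fst (last cs) \<in> accepting M"
proof
  assume "x \<in> lang M"
  then obtain ds where ds: "path M x ds" "halted M (last ds)" "fst (last ds) \<in> accepting M"
    by (auto simp: lang_def accepting_path_def)
  have "last ds = last cs"
    using deterministic_halting[OF assms(1) path_relpow[OF ds(1)] ds(2) path_relpow[OF assms(2)] assms(3)] .
  then show "fst (last cs) \<in> accepting M"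
    using ds(3) by simp
next
  assume "fst (last cs) \<in> accepting M"
  then show "x \<in> lang M"
    using assms by (auto simp: lang_def accepting_path_def)
qed

section \<open>Ranking\<close>

text \<open>\<open>D\<close> is the deterministic decider for \<open>prefix_lang\<close> that the
  collapse provides. \<open>out\<close> lies beyond all scratch tapes, since outputs are read from
  the last tape of a machine.\<close>

locale ranker = nongappy_rank_computer + D: simulation S D c for D c +
  fixes r :: "nat poly" and out :: nat
  assumes D_poly_time: "poly_time D"
    and D_time: "path D x cs \<Longrightarrow> length cs \<le> poly r (length x)"
    and D_lang: "lang D = prefix_lang"
    and out: "i \<in> S \<Longrightarrow> i < out"
begin

lemma out_simps: "out \<notin> S" "21 + D.k < out"
proof -
  show "out \<notin> S"
    using out by blast
  have "21 + D.k \<in> S"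
    using D.scratch by (rule subsetD) simp
  then show "21 + D.k < out"
    by (rule out)
qed

definition decide_time :: "nat \<Rightarrow> nat" where
  "decide_time n = D.sim_time (n + poly r n)"

lemma decide_time_mono: "m \<le> n \<Longrightarrow> decide_time m \<le> decide_time n"
  unfolding decide_time_def D.sim_time_def by (intro mult_le_mono2 add_mono poly_nat_mono) simp_all

lemma runs_decide:
  assumes "i \<notin> S" "j \<notin> S" "i \<noteq> j" "st i = bits (rev u)"
  shows "runs (D.simulate i (D.verdict j)) st (decide_time (length u))
    (st(i := [], j := (if u \<in> prefix_lang then Bit True # st j else st j)))"
proof -
  obtain cs where cs: "path D u cs" "halted D (last cs)"
    using halting_path[OF D_poly_time] by blast
  have "fst (last cs) \<in> accepting D \<longleftrightarrow> u \<in> prefix_lang"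
    using lang_iff[OF D.det cs] D_lang by simp
  with D.runs_verdict[OF assms(1-3), of st u, OF assms(4) path_relpow[OF cs(1)] cs(2)]
  have "runs (D.simulate i (D.verdict j)) st (D.sim_time (length u + (length cs - 1)))
      (st(i := [], j := (if u \<in> prefix_lang then Bit True # st j else st j)))"
    by simp
  moreover have "D.sim_time (length u + (length cs - 1)) \<le> decide_time (length u)"
    unfolding decide_time_def D.sim_time_def using D_time[OF cs(1)] by (intro mult_le_mono2) simp
  ultimately show ?thesis
    by (rule runs_weaken)
qed

text \<open>The query grows from the bottom of stack \<open>5\<close>: padding, candidate, subject.
  The simulation takes the top as the last letter of its input; this is why queries are
  reversals.\<close>

definition attempt :: "bool \<Rightarrow> com" where
  "attempt \<beta> = push 3 (Bit \<beta>) ;; duplicate 2 5 7 ;; encode 3 5 7 ;; encode 0 5 7 ;;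
     D.simulate 5 (D.verdict 6)"

text \<open>The flag on stack \<open>4\<close> is lowered first and raised only after a successful
  extension. It stays down exactly if the prefix is already the whole rank.\<close>

definition extend_prefix :: com where
  "extend_prefix = transfer 4 {} ;; attempt True ;;
     Cond (\<lambda>r. r 6 \<noteq> Blank) (transfer 6 {} ;; push 4 (Bit True))
       (transfer 3 {} ;; attempt False ;;
        Cond (\<lambda>r. r 6 \<noteq> Blank) (transfer 6 {} ;; push 4 (Bit True)) (transfer 3 {}))"

text \<open>At the end stack \<open>3\<close> has the most significant digit on top. The drain puts
  it into cell \<open>0\<close> of the output tape, in the order of \<open>number\<close>.\<close>

definition rank_program :: com where
  "rank_program = horner 0 2 7 8 as ;; push 4 (Bit True) ;;
     While (\<lambda>r. r 4 \<noteq> Blank) extend_prefix ;; drain 3 {out}"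

definition rank_state :: "bits \<Rightarrow> bits \<Rightarrow> bits \<Rightarrow> bool \<Rightarrow> stacks" where
  "rank_state x g v running = (initial_stacks x g)
     (2 := bits (replicate (horner_value as (length x)) False), 3 := bits (rev v),
      4 := (if running then [Bit True] else []))"

text \<open>At most \<open>n + 2\<close> digits occur in an attempt, so the two codes have lengths
  at most \<open>2 * n + 1\<close> and \<open>2 * (n + 2) + 1\<close>; together this is
  \<open>4 * n + 6\<close>.\<close>

definition attempt_time :: "nat \<Rightarrow> nat" where
  "attempt_time n = 8 * horner_value as n + 20 * n + 40 +
     decide_time (4 * n + 6 + horner_value as n)"

lemma runs_attempt:
  assumes "length v \<le> length x + 1"
  shows "runs (attempt \<beta>) (rank_state x g v running) (attempt_time (length x))
    ((rank_state x g (v @ [\<beta>]) running)(6 := (if prefix (v @ [\<beta>]) (rank_bits x) then [Bit True] else [])))"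
proof -
  let ?n = "length x" and ?pad = "replicate (horner_value as (length x)) False" and ?v = "v @ [\<beta>]"
  let ?u = "rev (code x @ code ?v @ ?pad)"
  define s0 where "s0 = rank_state x g v running"
  define s1 where "s1 = s0(3 := bits (rev ?v))"
  define s2 where "s2 = s1(5 := bits ?pad)"
  define s3 where "s3 = s2(5 := bits (code ?v @ ?pad))"
  define s4 where "s4 = s3(5 := bits (code x @ code ?v @ ?pad))"
  define s5 where "s5 = s4(5 := [], 6 := (if ?u \<in> prefix_lang then [Bit True] else []))"
  note d = s0_def s1_def s2_def s3_def s4_def rank_state_def initial_stacks_def
  have r1: "runs (push 3 (Bit \<beta>)) s0 2 s1"
    using runs_push[of 3 "Bit \<beta>" s0] unfolding s1_def by (simp add: s0_def rank_state_def)
  have r2: "runs (duplicate 2 5 7) s1 (8 * length ?pad + 2) s2"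
    using runs_duplicate[of 2 5 7 s1 "bits ?pad"] unfolding s2_def by (simp add: d)
  have r3: "runs (encode 3 5 7) s2 (10 * length ?v + 4) s3"
    using runs_encode[of 3 5 7 s2 ?v] unfolding s3_def by (simp add: d)
  have r4: "runs (encode 0 5 7) s3 (10 * ?n + 4) s4"
    using runs_encode[of 0 5 7 s3 x] unfolding s4_def by (simp add: d)
  have r5: "runs (D.simulate 5 (D.verdict 6)) s4 (decide_time (length ?u)) s5"
  proof -
    have s4: "s4 5 = bits (rev ?u)" "s4 6 = []"
      by (simp_all add: d)
    then have s5: "s5 = s4(5 := [], 6 := (if ?u \<in> prefix_lang then Bit True # s4 6 else s4 6))"
      by (simp add: s5_def)
    show ?thesis
      unfolding s5 by (rule runs_decide) (use s4 in auto)
  qed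
  have "?u \<in> prefix_lang \<longleftrightarrow> prefix ?v (rank_bits x)"
    unfolding prefix_lang_def padded_def subject_def candidate_def padding_def by simp
  then have "s5 = (rank_state x g ?v running)(6 := (if prefix ?v (rank_bits x) then [Bit True] else []))"
    by (auto simp: s5_def d fun_eq_iff)
  moreover have len: "length ?u \<le> 4 * ?n + 6 + horner_value as ?n"
    using assms by simp
  have "2 + (8 * length ?pad + 2 + (10 * length ?v + 4 + (10 * ?n + 4 + decide_time (length ?u))))
      \<le> attempt_time ?n"
    using assms decide_time_mono[OF len] unfolding attempt_time_def by simp
  then have "runs (attempt \<beta>) s0 (attempt_time ?n) s5"
    unfolding attempt_def
    by (rule runs_weaken[OF runs_seq[OF r1 runs_seq[OF r2 runs_seq[OF r3 runs_seq[OF r4 r5]]]]])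
  ultimately show ?thesis
    by (simp add: s0_def)
qed

lemma prefix_snoc:
  assumes "prefix v w" "v \<noteq> w"
  obtains a where "prefix (v @ [a]) w"
proof -
  obtain zs where w: "w = v @ zs"
    using assms(1) by (auto simp: prefix_def)
  with assms(2) obtain a as where "zs = a # as"
    by (cases zs) auto
  then show ?thesis
    using that[of a] w by simp
qed

lemma runs_extend_prefix:
  assumes v: "prefix v (rank_bits x)"
  shows "\<exists>v'. runs extend_prefix (rank_state x g v True) (2 * attempt_time (length x) + 20)
      (rank_state x g v' (v \<noteq> rank_bits x)) \<and> prefix v' (rank_bits x) \<and>
      (if v = rank_bits x then v' = v else length v' = length v + 1)"
proof -
  let ?w = "rank_bits x" and ?T = "attempt_time (length x)"
  have len: "length v \<le> length x + 1"
    using prefix_length_le[OF v] length_rank[of A x] by (simp add: rank_bits_def)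
  let ?s = "\<lambda>v fl. rank_state x g v fl"
  let ?c = "\<lambda>\<beta>. prefix (v @ [\<beta>]) ?w"
  have r1: "runs (transfer 4 {}) (?s v True) 2 (?s v False)"
    using runs_pop[of 4 "?s v True" "Bit True" "[]"] by (simp add: rank_state_def)
  have r2: "runs (attempt \<beta>) (?s v False) ?T ((?s (v @ [\<beta>]) False)(6 := (if ?c \<beta> then [Bit True] else [])))" for \<beta>
    by (rule runs_attempt[OF len])
  have s6: "?s v fl 6 = []" for v fl
    by (simp add: rank_state_def initial_stacks_def)
  have yes: "runs (transfer 6 {} ;; push 4 (Bit True)) ((?s (v @ [\<beta>]) False)(6 := [Bit True])) (2 + 2) (?s (v @ [\<beta>]) True)" for \<beta>
  proof (rule runs_seq)
    show "runs (transfer 6 {}) ((?s (v @ [\<beta>]) False)(6 := [Bit True])) 2 (?s (v @ [\<beta>]) False)"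
      using runs_pop[of 6 "(?s (v @ [\<beta>]) False)(6 := [Bit True])" "Bit True" "[]"] s6[of "v @ [\<beta>]" False]
      by (simp add: fun_upd_idem)
    show "runs (push 4 (Bit True)) (?s (v @ [\<beta>]) False) 2 (?s (v @ [\<beta>]) True)"
      using runs_push[of 4 "Bit True" "?s (v @ [\<beta>]) False"] by (simp add: rank_state_def)
  qed
  have no: "runs (transfer 3 {}) ((?s (v @ [\<beta>]) False)(6 := [])) 2 (?s v False)" for \<beta>
  proof -
    have "(?s (v @ [\<beta>]) False)(6 := [], 3 := bits (rev v)) = ?s v False"
      by (auto simp: rank_state_def initial_stacks_def fun_eq_iff)
    then show ?thesis
      using runs_pop[of 3 "(?s (v @ [\<beta>]) False)(6 := [])" "Bit \<beta>" "bits (rev v)"]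
      by (simp add: rank_state_def)
  qed
  have yes_branch: "runs (Cond (\<lambda>r. r 6 \<noteq> Blank) p q) st (T + 2) st'"
    if "st 6 = [Bit True]" "runs p st T st'" for p q st T st'
    by (rule runs_cond_True[OF _ that(2)]) (simp add: rep_reads that(1))
  have no_branch: "runs (Cond (\<lambda>r. r 6 \<noteq> Blank) p q) st (T + 1) st'"
    if "st 6 = []" "runs q st T st'" for p q st T st'
    by (rule runs_cond_False[OF _ that(2)]) (simp add: rep_reads that(1))
  let ?else = "transfer 3 {} ;; attempt False ;;
        Cond (\<lambda>r. r 6 \<noteq> Blank) (transfer 6 {} ;; push 4 (Bit True)) (transfer 3 {})"
  consider "?c True" | "\<not> ?c True" "?c False" | "\<not> ?c True" "\<not> ?c False" by blast
  then show ?thesis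
  proof cases
    case 1
    note yes_branch[where st = "(?s (v @ [True]) False)(6 := [Bit True])" and q = "?else", OF fun_upd_same yes]
    with r2[of True] 1 have "runs extend_prefix (?s v True) (2 + (?T + (2 + 2 + 2))) (?s (v @ [True]) True)"
      unfolding extend_prefix_def by (intro runs_seq[OF r1] runs_seq) auto
    then have "runs extend_prefix (?s v True) (2 * ?T + 20) (?s (v @ [True]) True)"
      by (rule runs_weaken) simp
    moreover have "v \<noteq> ?w"
      using 1 by (auto simp: prefix_def)
    ultimately show ?thesis
      using 1 by (intro exI[of _ "v @ [True]"]) auto
  next
    case 2
    note y = yes_branch[where st = "(?s (v @ [False]) False)(6 := [Bit True])" and q = "transfer 3 {}", OF fun_upd_same yes]
    have "runs (attempt False ;; Cond (\<lambda>r. r 6 \<noteq> Blank) (transfer 6 {} ;; push 4 (Bit True)) (transfer 3 {}))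
        (?s v False) (?T + (2 + 2 + 2)) (?s (v @ [False]) True)"
      using runs_seq[OF _ y] r2[of False] 2 by simp
    from runs_seq[OF no this, of True] have e: "runs ?else ((?s (v @ [True]) False)(6 := []))
        (2 + (?T + (2 + 2 + 2))) (?s (v @ [False]) True)" .
    have "runs extend_prefix (?s v True) (2 + (?T + (2 + (?T + (2 + 2 + 2)) + 1))) (?s (v @ [False]) True)"
      unfolding extend_prefix_def
      by (rule runs_seq[OF r1 runs_seq[OF _ no_branch[where st = "(?s (v @ [True]) False)(6 := [])", OF fun_upd_same e]]]) (use r2[of True] 2 in auto)
    then have "runs extend_prefix (?s v True) (2 * ?T + 20) (?s (v @ [False]) True)"
      by (rule runs_weaken) simp
    moreover have "v \<noteq> ?w"
      using 2 by (auto simp: prefix_def)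
    ultimately show ?thesis
      using 2 by (intro exI[of _ "v @ [False]"]) auto
  next
    case 3
    note n = no_branch[where st = "(?s (v @ [False]) False)(6 := [])" and p = "transfer 6 {} ;; push 4 (Bit True)", OF fun_upd_same no]
    have "runs (attempt False ;; Cond (\<lambda>r. r 6 \<noteq> Blank) (transfer 6 {} ;; push 4 (Bit True)) (transfer 3 {}))
        (?s v False) (?T + (2 + 1)) (?s v False)"
      using runs_seq[OF _ n] r2[of False] 3 by simp
    from runs_seq[OF no this, of True] have e: "runs ?else ((?s (v @ [True]) False)(6 := []))
        (2 + (?T + (2 + 1))) (?s v False)" .
    have "runs extend_prefix (?s v True) (2 + (?T + (2 + (?T + (2 + 1)) + 1))) (?s v False)"
      unfolding extend_prefix_def
      by (rule runs_seq[OF r1 runs_seq[OF _ no_branch[where st = "(?s (v @ [True]) False)(6 := [])", OF fun_upd_same e]]]) (use r2[of True] 3 in auto)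
    then have "runs extend_prefix (?s v True) (2 * ?T + 20) (?s v False)"
      by (rule runs_weaken) simp
    moreover have "v = ?w"
    proof (rule ccontr)
      assume "v \<noteq> ?w"
      then obtain a where "prefix (v @ [a]) ?w"
        using prefix_snoc[OF v] by blast
      then show False
        using 3 by (cases a) auto
    qed
    ultimately show ?thesis
      using v by (intro exI[of _ v]) auto
  qed
qed

text \<open>One pass for each missing digit and a last one that finds no extension.\<close>

lemma runs_rank_loop:
  assumes "prefix v (rank_bits x)"
  shows "runs (While (\<lambda>r. r 4 \<noteq> Blank) extend_prefix) (rank_state x g v True)
    ((length (rank_bits x) - length v + 1) * (2 * attempt_time (length x) + 22) + 1)
    (rank_state x g (rank_bits x) False)"
  using assms
proof (induction "length (rank_bits x) - length v" arbitrary: v)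
  case 0
  let ?T = "2 * attempt_time (length x) + 20"
  have v: "v = rank_bits x"
    using 0 by (auto simp: prefix_def)
  have run: "runs extend_prefix (rank_state x g v True) ?T (rank_state x g v False)"
    using runs_extend_prefix[OF 0(2), of g] v by auto
  have stop: "runs (While (\<lambda>r. r 4 \<noteq> Blank) extend_prefix) (rank_state x g v False) 1 (rank_state x g v False)"
    by (rule runs_while_False) (simp add: rep_reads scratch20 rank_state_def)
  have "runs (While (\<lambda>r. r 4 \<noteq> Blank) extend_prefix) (rank_state x g v True) (?T + 1 + 2) (rank_state x g v False)"
    by (rule runs_while_True[OF _ run stop]) (simp add: rep_reads scratch20 rank_state_def)
  then show ?case
    using v by (simp add: algebra_simps)
next
  case (Suc n)
  let ?T = "2 * attempt_time (length x) + 20"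
  have "v \<noteq> rank_bits x"
    using Suc(2) by auto
  then obtain v' where v': "runs extend_prefix (rank_state x g v True) ?T (rank_state x g v' True)"
      "prefix v' (rank_bits x)" "length v' = length v + 1"
    using runs_extend_prefix[OF Suc(3), of g] by auto
  have n: "n = length (rank_bits x) - length v'"
    using Suc(2) v'(3) by simp
  have "runs (While (\<lambda>r. r 4 \<noteq> Blank) extend_prefix) (rank_state x g v True)
      (?T + ((length (rank_bits x) - length v' + 1) * (2 * attempt_time (length x) + 22) + 1) + 2)
      (rank_state x g (rank_bits x) False)"
    by (rule runs_while_True[OF _ v'(1) Suc(1)[OF n v'(2)]]) (simp add: rep_reads scratch20 rank_state_def)
  moreover have "?T + ((length (rank_bits x) - length v' + 1) * (2 * attempt_time (length x) + 22) + 1) + 2 =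
      (length (rank_bits x) - length v + 1) * (2 * attempt_time (length x) + 22) + 1"
  proof -
    have "length (rank_bits x) - length v + 1 = (length (rank_bits x) - length v' + 1) + 1"
      using n Suc(2) by simp
    then show ?thesis
      by (simp only: add_mult_distrib) simp
  qed
  ultimately show ?case
    by (simp only:)
qed

text \<open>A rank has at most \<open>n + 1\<close> digits, and the unsuccessful last pass makes
  \<open>n + 2\<close>.\<close>

definition rank_time :: "nat \<Rightarrow> nat" where
  "rank_time n = horner_time as n + (n + 2) * (2 * attempt_time n + 22) + 4 * n + 20"

lemma runs_rank_program:
  "runs rank_program (initial_stacks x g) (rank_time (length x))
    ((rank_state x g [] False)(out := bits (rank_bits x)))"
proof -
  let ?s = "initial_stacks x g" and ?w = "rank_bits x"
  have r1: "runs (horner 0 2 7 8 as) ?s (horner_time as (length x))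
      (?s(2 := bits (replicate (horner_value as (length x)) False)))"
    using runs_horner[of 0 2 7 8 ?s "length x" as] by (simp add: initial_stacks_def)
  have r2: "runs (push 4 (Bit True)) (?s(2 := bits (replicate (horner_value as (length x)) False))) 2
      (rank_state x g [] True)"
  proof -
    have "(?s(2 := bits (replicate (horner_value as (length x)) False)))(4 := [Bit True]) =
        rank_state x g [] True"
      by (auto simp: rank_state_def initial_stacks_def fun_eq_iff)
    then show ?thesis
      using runs_push[of 4 "Bit True" "?s(2 := bits (replicate (horner_value as (length x)) False))"]
      by (simp add: initial_stacks_def)
  qed
  have r3: "runs (While (\<lambda>r. r 4 \<noteq> Blank) extend_prefix) (rank_state x g [] True)
      ((length ?w - length ([] :: bits) + 1) * (2 * attempt_time (length x) + 22) + 1) (rank_state x g ?w False)"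
    by (rule runs_rank_loop) simp
  have o: "out \<noteq> 0" "out \<noteq> 1" "out \<noteq> 2" "out \<noteq> 3" "out \<noteq> 4"
    using out_simps(2) by auto
  have r4: "runs (drain 3 {out}) (rank_state x g ?w False) (4 * length ?w + 1)
      ((rank_state x g [] False)(out := bits ?w))"
  proof -
    have "(rank_state x g ?w False)(3 := [], out := rev (bits (rev ?w)) @ rank_state x g ?w False out) =
        (rank_state x g [] False)(out := bits ?w)"
      using o by (auto simp: rank_state_def initial_stacks_def fun_eq_iff rev_map)
    moreover have "rank_state x g ?w False 3 = bits (rev ?w)"
      by (simp add: rank_state_def)
    ultimately show ?thesis
      using runs_drain[of 3 out "rank_state x g ?w False" "bits (rev ?w)"] o out_simps by simp
  qed
  have len: "length ?w \<le> length x + 1"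
    using length_rank[of A x] by (simp add: rank_bits_def)
  then have "(length ?w - length ([] :: bits) + 1) * (2 * attempt_time (length x) + 22) \<le>
      (length x + 2) * (2 * attempt_time (length x) + 22)"
    by (intro mult_le_mono1) simp
  with len show ?thesis
    unfolding rank_program_def
    by (intro runs_weaken[OF runs_seq[OF r1 runs_seq[OF r2 runs_seq[OF r3 r4]]]])
      (simp add: rank_time_def)
qed

lemma poly_bounded_rank_time: "poly_bounded rank_time"
proof -
  have "poly_bounded (\<lambda>n. decide_time (4 * n + 6 + horner_value as n))"
    by (rule poly_bounded_compose)
      (simp_all add: decide_time_def[abs_def] D.sim_time_def)
  then show ?thesis
    unfolding rank_time_def attempt_time_def
    by (intro poly_bounded_add poly_bounded_mult) simp_all
qed

lemma com_ok_rank_program: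
  assumes "out < K" "D.sim_symbols \<subseteq> G" "Bit False \<in> G"
  shows "com_ok K G rank_program"
proof -
  have K: "22 + D.k \<le> K"
    using assms(1) out_simps by simp
  note G = D.sim_symbolsI[OF assms(2)]
  have "com_ok K G (D.simulate 5 (D.verdict 6))"
    using K assms(2) by (intro D.com_ok_simulate D.com_ok_verdict) auto
  moreover have "Bit \<beta> \<in> G" for \<beta>
    using G assms(3) by (cases \<beta>) auto
  ultimately show ?thesis
    unfolding rank_program_def extend_prefix_def attempt_def using K assms G by auto
qed

lemma strong_P_rankable_A: "strong_P_rankable A"
proof -
  let ?K = "out + 1" and ?G = "insert (Bit False) D.sim_symbols"
  have ranks: "\<exists>t s'. t \<le> rank_time (length x) \<and> exec rank_program (begin_store x g) t s' \<and>
      scanned (s' 6) = Blank \<and> s' out = stk (bits (rank_bits x))" for x g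
  proof -
    have "rep (initial_stacks x g) (begin_store x g)"
      by (rule rep_initial) (simp_all add: scratch20)
    then obtain t s' where "t \<le> rank_time (length x)" "exec rank_program (begin_store x g) t s'"
        and s': "rep ((rank_state x g [] False)(out := bits (rank_bits x))) s'"
      using runs_rank_program unfolding runs_def by blast
    moreover have "s' out = stk (bits (rank_bits x))"
      using rep_tape[OF s' out_simps(1)] by simp
    moreover have "scanned (s' 6) = Blank"
      using rep_tape[OF s', of 6] scratch20[of 6] out_simps(2)
      by (simp add: rank_state_def initial_stacks_def)
    ultimately show ?thesis
      by blast
  qed
  \<comment> \<open>The singleton \<open>{False}\<close> leaves one possible guess. Stack
    \<open>6\<close> is empty at the end, so every run accepts, and the trivial relation describes
    this.\<close>
  interpret compiled_decider ?K ?G "{False}" 6 rank_program rank_time "\<lambda>_ _. True"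
  proof
    show "com_ok ?K ?G rank_program"
      by (rule com_ok_rank_program) auto
    show "finite ?G"
      using D.finite_sim_symbols by simp
    show "Blank \<in> ?G" "Bit True \<in> ?G" "Bit False \<in> ?G"
      by (auto simp: D.sim_symbols_def)
    show "2 \<le> ?K" "6 < ?K"
      using out_simps(2) by auto
    show "poly_bounded rank_time"
      by (rule poly_bounded_rank_time)
    show "\<exists>t s'. t \<le> rank_time (length x) \<and> exec rank_program (begin_store x g) t s' \<and>
        (scanned (s' 6) = Blank \<longleftrightarrow> True)" for x g
      using ranks by blast
  qed simp
  have "\<exists>cs. path M x cs \<and> halted M (last cs) \<and> outputs (last cs) (number (rank A x))" for x
  proof -
    \<comment> \<open>The one guess that the machine can make.\<close>
    let ?g = "replicate (length x) False"
    obtain t s' where s': "exec rank_program (begin_store x ?g) t s'" "s' out = stk (bits (rank_bits x))"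
      using ranks by blast
    obtain cs i where cs: "path M x cs" "halted M (last cs)" "last cs = (i, proj s')"
      using output_path[of ?g x t s'] s'(1) by fastforce
    have "last (proj s') = s' out"
      unfolding proj_def by simp
    then have "outputs (last cs) (number (rank A x))"
      unfolding cs(3) outputs_def Let_def
      by (auto simp: s'(2) stk_def number_def rank_bits_def rev_map)
    then show ?thesis
      using cs by blast
  qed
  then have "poly_time_computable (\<lambda>x. number (rank A x))"
    unfolding poly_time_computable_def using poly_time_M deterministic_M[OF refl] by blast
  then show ?thesis
    unfolding strong_P_rankable_def by blast
qed

end

section \<open>Assembling the machines\<close>

lemma fresh_mark:
  assumes "machine_wf M"
  shows "\<exists>b. \<forall>q rs q' as a. (q, rs, q', as) \<in> instrs M \<longrightarrow> a \<in> set as \<longrightarrow> fst a \<noteq> Mark b"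
proof -
  let ?X = "\<Union>(q, rs, q', as)\<in>instrs M. fst ` set as"
  have "finite ?X"
    using assms by (auto simp: machine_wf_def)
  \<comment> \<open>A machine writes only finitely many symbols, so among infinitely many marks one
    is free.\<close>
  moreover have "infinite (range Mark)"
    by (rule range_inj_infinite) (simp add: inj_def)
  ultimately obtain b where b: "Mark b \<notin> ?X"
    by (meson finite_subset image_subsetI)
  have "fst a \<in> ?X" if "(q, rs, q', as) \<in> instrs M" "a \<in> set as" for q rs q' as a
    using that by (intro UN_I[of "(q, rs, q', as)"]) auto
  with b show ?thesis
    by metis
qed

theorem theorem18:
  assumes "class_P = class_UP \<inter> class_coUP"
  shows "\<forall>A. nongappy A \<and> semistrong_P_rankable A \<longrightarrow> strong_P_rankable A"
proof (intro allI impI, elim conjE)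
  fix A assume "nongappy A" "semistrong_P_rankable A"
  obtain p :: "nat poly" where p: "\<And>n. \<exists>y\<in>A. n \<le> length y \<and> length y \<le> poly p n"
    using \<open>nongappy A\<close> unfolding nongappy_def by blast
  obtain f where f: "poly_time_computable f" "\<And>x. f x = (if x \<in> A then number (rank A x) else not_in_set)"
    using \<open>semistrong_P_rankable A\<close> unfolding semistrong_P_rankable_def by auto
  obtain F where F: "poly_time F" "deterministic F"
      "\<And>x. \<exists>cs. path F x cs \<and> halted F (last cs) \<and> outputs (last cs) (f x)"
    using f(1) unfolding poly_time_computable_def by blast
  have machine_wf: "machine_wf M" if "poly_time M" for M
    using that by (simp add: poly_time_def)
  obtain q :: "nat poly" where q: "\<And>x cs. path F x cs \<Longrightarrow> length cs \<le> poly q (length x)"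
    using F(1) by (auto simp: poly_time_def)
  obtain b where b: "\<And>q rs q' as a. (q, rs, q', as) \<in> instrs F \<Longrightarrow> a \<in> set as \<Longrightarrow> fst a \<noteq> Mark b"
    using fresh_mark[OF machine_wf[OF F(1)]] by metis
  \<comment> \<open>The composition with \<open>[:1, 1:]\<close> substitutes \<open>n + 1\<close>
    into \<open>p\<close>, so this is the padding length
    \<open>2 * n + 2 * poly p (n + 1) + 3\<close>.\<close>
  obtain cf where cf: "\<And>n. horner_value cf n = poly ([:3, 2:] + smult 2 (pcompose p [:1, 1:])) n"
    using horner_value_poly by metis
  \<comment> \<open>The scratch set is left open, as two sets are needed: one to obtain
    \<open>D\<close>, and a larger one with room for the tapes of \<open>D\<close>.\<close>
  have computer: "nongappy_rank_computer S F b A q p cf"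
    if "{20..<22 + n_tapes F} \<subseteq> S" "S \<subseteq> {20..}" for S
  proof
    show "\<exists>cs. path F x cs \<and> halted F (last cs) \<and>
        outputs (last cs) (if x \<in> A then number (rank A x) else not_in_set)" for x
      using F(3)[of x] unfolding f(2) .
    show "i \<notin> S" if "i < 20" for i
      using \<open>S \<subseteq> {20..}\<close> that by auto
    show "horner_value cf n = 2 * n + 2 * poly p (n + 1) + 3" for n
      by (simp add: cf poly_pcompose)
  qed (use that F(2) machine_wf[OF F(1)] b q p in auto)
  \<comment> \<open>The language depends on \<open>A\<close> and \<open>cf\<close> only, so it is
    the same for both scratch sets.\<close>
  define L where "L = nongappy_rank_computer.prefix_lang A cf"
  have "L \<in> class_P"
    unfolding L_def assms
    by (rule nongappy_rank_computer.prefix_lang_UP_coUP[OF computer[of "{20..<22 + n_tapes F}"]]) auto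
  then obtain D where D: "poly_time D" "deterministic D" "lang D = L"
    by (auto simp: class_P_def)
  obtain r :: "nat poly" where r: "\<And>x cs. path D x cs \<Longrightarrow> length cs \<le> poly r (length x)"
    using D(1) by (auto simp: poly_time_def)
  obtain c where c: "\<And>q rs q' as a. (q, rs, q', as) \<in> instrs D \<Longrightarrow> a \<in> set as \<Longrightarrow> fst a \<noteq> Mark c"
    using fresh_mark[OF machine_wf[OF D(1)]] by metis
  \<comment> \<open>The first tape beyond those needed for simulating either \<open>F\<close> or
    \<open>D\<close>.\<close>
  let ?out = "22 + max (n_tapes F) (n_tapes D)"
  interpret nongappy_rank_computer "{20..<?out}" F b A q p cf
    by (rule computer) auto
  interpret ranker "{20..<?out}" F b A q p cf D c r ?out
  proof
    show "lang D = prefix_lang"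
      using D(3) by (simp add: L_def)
  qed (use D machine_wf[OF D(1)] c r in auto)
  show "strong_P_rankable A"
    by (rule strong_P_rankable_A)
qed

end
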